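(* Let $\epsilon\in(-1,-1/2)$, let $W$ be a bulk set with associated neighborhood $\tilde W$, let $W_0$ be an open interval with $W\subset W_0\subset\tilde W$ and $\operatorname{dist}(W_0,\partial\tilde W)>0$, fix $\alpha\in(0,1)$, and for $r\ge0$ let $\eta_r=N_r^{-1+\alpha}$, $\Omega_r=W_0+i(\eta_r,10)$ and $S_r(z)=N_r^{-1}\operatorname{Tr}(H_r-z)^{-1}$. Then there are constants $K_l,K_u\in(0,\infty)$ such that for every $p>0$ and all sufficiently large $r$, \[\mathbb{P}\Big(\operatorname{Im}S_r(\Omega_r)\subset[K_l,K_u]\ \text{and}\ |S_r(\Omega_r)|\subset(K_l,K_u\log N_r)\Big)\ge1-N_r^{-p}.\]
   Context: Let $\epsilon > -1$ and $t_r = 2^{-(1+\epsilon) r}$. For $r\ge 0$ let $\mathcal{P}_r$ be the partition of $\mathbb{N}$ into consecutive blocks $\{1,\dots,2^r\}, \{2^r+1,\dots,2\cdot 2^r\},\dots$, and $d(x,y) = \min\{r \ge 0 : x, y \text{ lie in a common member of } \mathcal{P}_r\}$. Let $(\Phi_{\infty,r})_{r\ge0}$ be independent random real symmetric operators on $\ell^2(\mathbb{N})$ with centered Gaussian entries independent up to symmetry and $\mathbb{E}|\langle \delta_y, \Phi_{\infty,r}\delta_x\rangle|^2 = 2^{-r}\cdot 2$ if $d(x,y)=0$, $=2^{-r}$ if $1\le d(x,y)\le r$, $=0$ otherwise. Let $N_n=2^n$, $B_n=\{1,\dots,N_n\}$, $\Phi_{n,r}=1_{B_n}\Phi_{\infty,r}1_{B_n}$,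 and $H_n=\sum_{r=0}^n\sqrt{t_r}\,\Phi_{n,r}$. The density of states $\rho_n$ of $H_n$ is defined by $\mathbb{E}\,N_n^{-1}\operatorname{Tr}f(H_n)=\int f\rho_n$ for continuous $f$. A closed interval $W$ is a bulk set if some neighborhood $\tilde W$ of $W$ satisfies $\liminf_{n}\inf_{E\in\tilde W}\rho_n(E)>0$. *)

theory Defs
  imports "HOL-Probability.Probability" "Jordan_Normal_Form.Char_Poly"
    "Jordan_Normal_Form.Gauss_Jordan_Elimination"
begin

definition Nsz :: "nat \<Rightarrow> nat" where
  "Nsz n = 2 ^ n"

text \<open>Hierarchical distance: least r such that x and y lie in a common block
  {k 2^r + 1, ..., (k+1) 2^r} (points of \<nat> are 1,2,3,...).\<close>
definition hdist :: "nat \<Rightarrow> nat \<Rightarrow> nat" where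
  "hdist x y = (LEAST r. (x - 1) div 2 ^ r = (y - 1) div 2 ^ r)"

definition var_entry :: "nat \<Rightarrow> nat \<Rightarrow> nat \<Rightarrow> real" where
  "var_entry r x y =
     (if hdist x y = 0 then 2 / 2 ^ r
      else if hdist x y \<le> r then 1 / 2 ^ r else 0)"

text \<open>Underlying probability space: i.i.d. standard Gaussians g(r,x,y);
  the entry (x,y) of Phi_{\<infinity>,r} uses g(r, min x y, max x y), so the entries are
  independent up to symmetry.\<close>
definition Gspace :: "(nat \<times> nat \<times> nat \<Rightarrow> real) measure" where
  "Gspace = PiM UNIV (\<lambda>_. std_normal_distribution)"

definition Phi :: "nat \<Rightarrow> (nat \<times> nat \<times> nat \<Rightarrow> real) \<Rightarrow> nat \<Rightarrow> nat \<Rightarrow> real" where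
  "Phi r \<omega> x y = sqrt (var_entry r x y) * \<omega> (r, min x y, max x y)"

definition tscale :: "real \<Rightarrow> nat \<Rightarrow> real" where
  "tscale eps r = 2 powr (- (1 + eps) * real r)"

text \<open>H_n = sum_{r=0}^n sqrt(t_r) 1_{B_n} Phi_{\<infinity>,r} 1_{B_n}, as an N_n x N_n matrix
  (matrix index i corresponds to the site i+1).\<close>
definition Hmat :: "real \<Rightarrow> nat \<Rightarrow> (nat \<times> nat \<times> nat \<Rightarrow> real) \<Rightarrow> real mat" where
  "Hmat eps n \<omega> = mat (Nsz n) (Nsz n)
     (\<lambda>(i, j). \<Sum>r\<le>n. sqrt (tscale eps r) * Phi r \<omega> (i + 1) (j + 1))"

definition mtrace :: "'a::comm_ring_1 mat \<Rightarrow> 'a" where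
  "mtrace A = (\<Sum>i<dim_row A. A $$ (i, i))"

definition Stieltjes :: "real \<Rightarrow> nat \<Rightarrow> (nat \<times> nat \<times> nat \<Rightarrow> real) \<Rightarrow> complex \<Rightarrow> complex" where
  "Stieltjes eps n \<omega> z =
     (case mat_inverse (map_mat complex_of_real (Hmat eps n \<omega>) - z \<cdot>\<^sub>m 1\<^sub>m (Nsz n)) of
        Some B \<Rightarrow> mtrace B / of_nat (Nsz n)
      | None \<Rightarrow> 0)"

text \<open>Tr f(H) for a real symmetric H: sum of f over the eigenvalues (with multiplicity).\<close>
definition trace_fun :: "(real \<Rightarrow> real) \<Rightarrow> real mat \<Rightarrow> real" where
  "trace_fun f H = (\<Sum>e\<in>#proots (char_poly H). f e)"

definition is_dos :: "real \<Rightarrow> (nat \<Rightarrow> real \<Rightarrow> real) \<Rightarrow> bool" where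
  "is_dos eps \<rho> \<longleftrightarrow>
    (\<forall>n f. continuous_on UNIV f \<and> (\<exists>R. \<forall>x. R < \<bar>x\<bar> \<longrightarrow> f x = 0) \<longrightarrow>
       integrable lborel (\<lambda>E. f E * \<rho> n E) \<and>
       (LINT E|lborel. f E * \<rho> n E) =
         (LINT \<omega>|Gspace. trace_fun f (Hmat eps n \<omega>) / real (Nsz n)))"

definition bulk_set :: "(nat \<Rightarrow> real \<Rightarrow> real) \<Rightarrow> real set \<Rightarrow> real set \<Rightarrow> bool" where
  "bulk_set \<rho> W Wt \<longleftrightarrow> (\<exists>a b. a \<le> b \<and> W = {a..b}) \<and> W \<subseteq> interior Wt \<and>
     (\<exists>\<kappa>>0. eventually (\<lambda>n. \<forall>E\<in>Wt. \<kappa> \<le> \<rho> n E) sequentially)"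

definition Omega :: "real \<Rightarrow> real set \<Rightarrow> nat \<Rightarrow> complex set" where
  "Omega \<alpha> W0 r = {Complex x y | x y. x \<in> W0 \<and> real (Nsz r) powr (-1 + \<alpha>) < y \<and> y < 10}"

end

theory Submission
  imports Defs "Jordan_Normal_Form.Schur_Decomposition" "HOL-Real_Asymp.Real_Asymp"
begin

text \<open>
  Write \<open>H\<^sub>n = H\<^sub>0 + V\<close>, where \<open>V\<close> is the Gaussian matrix of the last level with variance \<open>t / N\<close>,
  \<open>t = t\<^sub>n = N\<^sup>-\<^sup>\<tau>\<close> and \<open>\<tau> = 1 + \<epsilon> < 1/2\<close>, and put \<open>S = N\<^sup>-\<^sup>1 Tr (H\<^sub>n - z)\<^sup>-\<^sup>1\<close>, \<open>\<eta> = Im z\<close>.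

  Upper bound. Let \<open>X = \<eta> Im Tr (H\<^sub>n - z)\<^sup>-\<^sup>1\<close>. Changing one diagonal entry changes \<open>X\<close> by at most one, and by
  Wegner's estimate each diagonal summand of \<open>X\<close> integrates to at most \<open>\<pi> \<eta>\<close> over its own diagonal Gaussian.
  Hence \<open>E (X exp X) \<le> C N \<eta> E (exp X)\<close>, so \<open>X\<close> exceeds a multiple of \<open>N \<eta>\<close> with exponentially
  small probability, at every scale \<open>\<eta> \<ge> N\<^sup>\<alpha>\<^sup>-\<^sup>1\<close>. Summing over dyadic heights bounds \<open>|S|\<close> by a multiple of \<open>ln N\<close>.

  Lower bound at scales \<open>\<eta> \<ge> N\<^sup>-\<^sup>\<theta>\<close> with \<open>\<tau> < \<theta> < 1/2\<close>. The density of states bounds \<open>E (Im S)\<close> from below, and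
  changing one row changes \<open>S\<close> by at most \<open>2 / (N \<eta>)\<close>, so McDiarmid's inequality applies. The bound holds for
  \<open>H\<^sub>n\<^sub>-\<^sub>1\<close>, which is a diagonal block of \<open>H\<^sub>0\<close>, as well.

  Lower bound at small scales. With \<open>w = z + t S\<close> and \<open>S\<^sub>0(w) = N\<^sup>-\<^sup>1 Tr (H\<^sub>0 - w)\<^sup>-\<^sup>1\<close>, the defect \<open>P = S - S\<^sub>0(w)\<close>,
  weighted by a bounded function of \<open>Im S\<close>, has moments of order \<open>(N \<eta>)\<^sup>-\<^sup>2\<^sup>p\<close>: this is Gaussian integration by
  parts, the estimates being deterministic because \<open>t Im S \<le> Im w\<close>. If \<open>Im S\<close> is bounded below, then
  \<open>Im w \<ge> t Im S\<close> is at least \<open>N\<^sup>-\<^sup>\<theta>\<close>, a scale where \<open>Im S\<^sub>0\<close> is controlled, so the bound on \<open>Im S\<close> propagates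
  downwards in \<open>\<eta>\<close>.
\<close>

subsection \<open>Resolvents of real symmetric matrices\<close>

text \<open>The matrix is perturbed only once, by its last Gaussian level; there is no induction
  over levels. A single step suffices because \<open>t\<close> exceeds the scale N^(-1/2) down to
  which McDiarmid's inequality (N rows, each moving S by at most 2 / (N \<eta>)) still concentrates.
  This is the meaning of \<open>eps < -1/2\<close>: it leaves room for an exponent \<theta> between
  \<tau> and 1/2.

  The obstacle is a circularity. Estimates of the defect contain inverse powers of Im S, but a lower
  bound on Im S is the goal and cannot be assumed under an expectation. The weight cancels these
  powers sample by sample, so the moments are computed without restricting to any event. The lower
  bound enters only afterwards, for a fixed sample outside a bad set.

  A second difficulty is that w depends on S and hence on V. The matrix of the previous level is
  independent of V, but its resolvent at w is not and has to be differentiated through w.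

  Uniformity in z costs a union bound over O(N^2) grid points, because Im S changes by at most a
  constant factor when z moves by half its height.\<close>

definition msym :: "nat \<Rightarrow> (nat \<Rightarrow> nat \<Rightarrow> real) \<Rightarrow> bool" where
  "msym N H \<longleftrightarrow> (\<forall>i<N. \<forall>j<N. H i j = H j i)"

definition shifted :: "nat \<Rightarrow> (nat \<Rightarrow> nat \<Rightarrow> real) \<Rightarrow> complex \<Rightarrow> complex mat" where
  "shifted N H z = mat N N (\<lambda>(i, j). of_real (H i j) - (if i = j then z else 0))"

text \<open>Matrices are functions of which only the indices below \<open>N\<close> matter. Cramer's rule gives the resolvent
  \<open>(H - z)\<^sup>-\<^sup>1\<close>; its value is junk when \<open>z\<close> is an eigenvalue.\<close>
definition res :: "nat \<Rightarrow> (nat \<Rightarrow> nat \<Rightarrow> real) \<Rightarrow> complex \<Rightarrow> nat \<Rightarrow> nat \<Rightarrow> complex" where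
  "res N H z i j = cofactor (shifted N H z) j i / det (shifted N H z)"

lemma msymD: "msym N H \<Longrightarrow> i < N \<Longrightarrow> j < N \<Longrightarrow> H i j = H j i"
  by (simp add: msym_def)

lemma shifted_carrier [simp]: "shifted N H z \<in> carrier_mat N N"
  by (simp add: shifted_def)

lemma mat_mult_entry:
  assumes "A \<in> carrier_mat N N" and "B \<in> carrier_mat N N" and "i < N" and "j < N"
  shows "(A * B) $$ (i, j) = (\<Sum>k<N. A $$ (i, k) * B $$ (k, j))"
  using assms by (auto simp: scalar_prod_def atLeast0LessThan intro!: sum.cong)

lemma sum_mult_indicator_eq:
  fixes f :: "nat \<Rightarrow> 'a::semiring_1"
  shows "j < N \<Longrightarrow> (\<Sum>b<N. f b * (if b = j then 1 else 0)) = f j"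
  by (subst sum.remove[of _ j]) auto

text \<open>The quadratic form of a real symmetric H is real, so pairing (H - z) x = v with x leaves
  only the z term in the imaginary part. Invertibility off the real axis, Ward's identity, the
  operator bound and the reality of eigenvalues all rest on this identity.\<close>

lemma energy_identity:
  assumes H: "msym N H" and x: "\<And>i. i < N \<Longrightarrow> (\<Sum>k<N. of_real (H i k) * x k) - z * x i = v i"
  shows "Im (\<Sum>i<N. x i * cnj (v i)) = Im z * (\<Sum>i<N. (cmod (x i))\<^sup>2)"
proof -
  define Q where "Q = (\<Sum>i<N. \<Sum>k<N. of_real (H i k) * (x i * cnj (x k)))"
  have "cnj Q = (\<Sum>i<N. \<Sum>k<N. of_real (H i k) * (x k * cnj (x i)))"
    by (simp add: Q_def mult.commute)
  also have "\<dots> = (\<Sum>i<N. \<Sum>k<N. of_real (H k i) * (x i * cnj (x k)))"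
    by (rule sum.swap)
  also have "\<dots> = Q"
    unfolding Q_def by (intro sum.cong refl) (simp add: msymD[OF H])
  finally have "Im Q = 0"
    by (metis Reals_cnj_iff complex_is_Real_iff)
  have "(\<Sum>i<N. x i * cnj (v i)) = (\<Sum>i<N. x i * cnj ((\<Sum>k<N. of_real (H i k) * x k) - z * x i))"
    using x by (intro sum.cong) auto
  also have "\<dots> = Q - cnj z * (\<Sum>i<N. x i * cnj (x i))"
    by (simp add: Q_def algebra_simps sum_distrib_left sum_subtractf)
  also have "(\<Sum>i<N. x i * cnj (x i)) = of_real (\<Sum>i<N. (cmod (x i))\<^sup>2)"
    by (simp only: complex_norm_square of_real_sum)
  finally show ?thesis
    using \<open>Im Q = 0\<close> by simp
qed

lemma det_shifted_nonzero:
  assumes H: "msym N H" and z: "0 < Im z"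
  shows "det (shifted N H z) \<noteq> 0"
proof
  assume "det (shifted N H z) = 0"
  then obtain v where v: "v \<in> carrier_vec N" "v \<noteq> 0\<^sub>v N" and e: "shifted N H z *\<^sub>v v = 0\<^sub>v N"
    using det_0_iff_vec_prod_zero_field[OF shifted_carrier] by blast
  define x where "x i = v $ i" for i
  have "(\<Sum>k<N. of_real (H i k) * x k) - z * x i = 0" if i: "i < N" for i
  proof -
    have "0 = (shifted N H z *\<^sub>v v) $ i" using e i by simp
    also have "\<dots> = (\<Sum>k<N. (of_real (H i k) - (if i = k then z else 0)) * x k)"
      using i v by (auto simp: shifted_def scalar_prod_def x_def atLeast0LessThan intro!: sum.cong)
    also have "\<dots> = (\<Sum>k<N. of_real (H i k) * x k) - (\<Sum>k<N. if i = k then z * x k else 0)"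
      unfolding sum_subtractf[symmetric] by (intro sum.cong) (auto simp: algebra_simps)
    finally show ?thesis using i by simp
  qed
  from energy_identity[OF H this] z have "(\<Sum>i<N. (cmod (x i))\<^sup>2) = 0"
    by simp
  then have "\<forall>i<N. x i = 0"
    by (subst (asm) sum_nonneg_eq_0_iff) auto
  then have "v = 0\<^sub>v N"
    using v by (intro eq_vecI) (auto simp: x_def)
  with v show False by simp
qed

lemma res_identities:
  assumes H: "msym N H" and z: "0 < Im z" and i: "i < N" and j: "j < N"
  shows res_right: "(\<Sum>k<N. of_real (H i k) * res N H z k j) = z * res N H z i j + (if i = j then 1 else 0)"
    and res_left: "(\<Sum>k<N. res N H z i k * of_real (H k j)) = z * res N H z i j + (if i = j then 1 else 0)"
proof -
  let ?A = "shifted N H z"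
  have d: "det ?A \<noteq> 0" using det_shifted_nonzero[OF H z] .
  have adj: "adj_mat ?A $$ (a, b) = det ?A * res N H z a b" if "a < N" "b < N" for a b
    using that d by (simp add: adj_mat_def res_def shifted_def)
  have "(?A * adj_mat ?A) $$ (i, j) = (\<Sum>k<N. ?A $$ (i, k) * adj_mat ?A $$ (k, j))"
    using i j adj_mat(1)[OF shifted_carrier[of N H z]] by (intro mat_mult_entry) auto
  also have "\<dots> = (\<Sum>k<N. det ?A * ((of_real (H i k) - (if i = k then z else 0)) * res N H z k j))"
    using i j by (intro sum.cong refl) (simp add: adj, simp add: shifted_def)
  finally have "det ?A * (if i = j then 1 else 0)
      = det ?A * (\<Sum>k<N. (of_real (H i k) - (if i = k then z else 0)) * res N H z k j)"
    using i j adj_mat(2)[OF shifted_carrier[of N H z]] by (simp add: sum_distrib_left)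
  then have "(if i = j then 1 else 0) = (\<Sum>k<N. (of_real (H i k) - (if i = k then z else 0)) * res N H z k j)"
    using d by simp
  also have "\<dots> = (\<Sum>k<N. of_real (H i k) * res N H z k j) - (\<Sum>k<N. if i = k then z * res N H z k j else 0)"
    unfolding sum_subtractf[symmetric] by (intro sum.cong) (auto simp: algebra_simps)
  finally show "(\<Sum>k<N. of_real (H i k) * res N H z k j) = z * res N H z i j + (if i = j then 1 else 0)"
    using i by (auto simp: algebra_simps)
  have "(adj_mat ?A * ?A) $$ (i, j) = (\<Sum>k<N. adj_mat ?A $$ (i, k) * ?A $$ (k, j))"
    using i j adj_mat(1)[OF shifted_carrier[of N H z]] by (intro mat_mult_entry) auto
  also have "\<dots> = (\<Sum>k<N. det ?A * (res N H z i k * (of_real (H k j) - (if k = j then z else 0))))"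
    using i j by (intro sum.cong refl) (simp add: adj, simp add: shifted_def)
  finally have "det ?A * (if i = j then 1 else 0)
      = det ?A * (\<Sum>k<N. res N H z i k * (of_real (H k j) - (if k = j then z else 0)))"
    using i j adj_mat(3)[OF shifted_carrier[of N H z]] by (simp add: sum_distrib_left)
  then have "(if i = j then 1 else 0) = (\<Sum>k<N. res N H z i k * (of_real (H k j) - (if k = j then z else 0)))"
    using d by simp
  also have "\<dots> = (\<Sum>k<N. res N H z i k * of_real (H k j)) - (\<Sum>k<N. if k = j then z * res N H z i k else 0)"
    unfolding sum_subtractf[symmetric] by (intro sum.cong) (auto simp: algebra_simps)
  finally show "(\<Sum>k<N. res N H z i k * of_real (H k j)) = z * res N H z i j + (if i = j then 1 else 0)"
    using j by (auto simp: algebra_simps)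
qed

text \<open>Matrix and spectral parameter vary together because the comparison needed later is
  between the full matrix at z and the previous level at the shifted point w. The formula results
  from expanding G' (H' - H) G with the left identity for G' and the right identity for G.\<close>

lemma resolvent_identity:
  assumes H: "msym N H" "msym N H'" and z: "0 < Im z" "0 < Im z'" and i: "i < N" and j: "j < N"
  shows "res N H' z' i j - res N H z i j =
    (z' - z) * (\<Sum>k<N. res N H' z' i k * res N H z k j)
    - (\<Sum>k<N. \<Sum>l<N. res N H' z' i k * of_real (H' k l - H k l) * res N H z l j)"
proof -
  let ?G = "res N H z" and ?G' = "res N H' z'"
  have "(\<Sum>k<N. \<Sum>l<N. ?G' i k * of_real (H' k l - H k l) * ?G l j)
      = (\<Sum>k<N. \<Sum>l<N. ?G' i k * of_real (H' k l) * ?G l j) - (\<Sum>k<N. \<Sum>l<N. ?G' i k * of_real (H k l) * ?G l j)"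
    by (simp add: sum_subtractf algebra_simps)
  also have "(\<Sum>k<N. \<Sum>l<N. ?G' i k * of_real (H' k l) * ?G l j) = (\<Sum>l<N. (\<Sum>k<N. ?G' i k * of_real (H' k l)) * ?G l j)"
    by (subst sum.swap) (simp add: sum_distrib_right)
  also have "\<dots> = (\<Sum>l<N. z' * (?G' i l * ?G l j) + (if i = l then ?G l j else 0))"
    using res_left[OF H(2) z(2) i] by (intro sum.cong) (auto simp: algebra_simps)
  also have "\<dots> = z' * (\<Sum>l<N. ?G' i l * ?G l j) + ?G i j"
    using i by (simp add: sum.distrib sum_distrib_left)
  also have "(\<Sum>k<N. \<Sum>l<N. ?G' i k * of_real (H k l) * ?G l j) = (\<Sum>k<N. ?G' i k * (\<Sum>l<N. of_real (H k l) * ?G l j))"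
    by (simp add: sum_distrib_left mult.assoc)
  also have "\<dots> = (\<Sum>k<N. z * (?G' i k * ?G k j) + (if k = j then ?G' i k else 0))"
    using res_right[OF H(1) z(1) _ j] by (intro sum.cong) (auto simp: algebra_simps)
  also have "\<dots> = z * (\<Sum>l<N. ?G' i l * ?G l j) + ?G' i j"
    using j by (simp add: sum.distrib sum_distrib_left)
  finally show ?thesis by (simp add: algebra_simps)
qed

lemma res_solves:
  assumes H: "msym N H" and z: "0 < Im z" and i: "i < N"
  shows "(\<Sum>k<N. of_real (H i k) * (\<Sum>j<N. res N H z k j * v j)) - z * (\<Sum>j<N. res N H z i j * v j) = v i"
proof -
  have "(\<Sum>k<N. of_real (H i k) * (\<Sum>j<N. res N H z k j * v j))
     = (\<Sum>j<N. (\<Sum>k<N. of_real (H i k) * res N H z k j) * v j)"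
    by (simp add: sum_distrib_left sum_distrib_right mult.assoc) (rule sum.swap)
  also have "\<dots> = (\<Sum>j<N. z * (res N H z i j * v j) + (if i = j then v j else 0))"
    using res_right[OF H z i] by (intro sum.cong) (auto simp: algebra_simps)
  finally show ?thesis
    using i by (simp add: sum.distrib sum_distrib_left)
qed

text \<open>Multiplying (H - z) x = v from the left by the resolvent. Entries of the resolvent can
  thus be identified by exhibiting a solution, which yields its symmetry and the reduction to a
  diagonal block.\<close>

lemma res_unique:
  assumes H: "msym N H" and z: "0 < Im z" and i: "i < N"
    and x: "\<And>i. i < N \<Longrightarrow> (\<Sum>k<N. of_real (H i k) * x k) - z * x i = v i"
  shows "x i = (\<Sum>j<N. res N H z i j * v j)"
proof -
  have "(\<Sum>j<N. res N H z i j * v j) = (\<Sum>j<N. res N H z i j * ((\<Sum>k<N. of_real (H j k) * x k) - z * x j))"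
    using x by (intro sum.cong) auto
  also have "\<dots> = (\<Sum>j<N. \<Sum>k<N. res N H z i j * of_real (H j k) * x k) - (\<Sum>j<N. z * res N H z i j * x j)"
    by (simp add: algebra_simps sum_subtractf sum_distrib_left)
  also have "(\<Sum>j<N. \<Sum>k<N. res N H z i j * of_real (H j k) * x k) = (\<Sum>k<N. (\<Sum>j<N. res N H z i j * of_real (H j k)) * x k)"
    by (subst sum.swap) (simp add: sum_distrib_right)
  also have "\<dots> = (\<Sum>j<N. z * res N H z i j * x j + (if i = j then x j else 0))"
    using res_left[OF H z i] by (intro sum.cong) (auto simp: algebra_simps)
  finally show ?thesis using i by (simp add: sum.distrib)
qed

lemma res_sym:
  assumes H: "msym N H" and z: "0 < Im z" and i: "i < N" and j: "j < N"
  shows "res N H z i j = res N H z j i"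
proof -
  \<comment> \<open>Since H is symmetric, row j of the resolvent solves the system that determines
    column j.\<close>
  have "(\<Sum>k<N. of_real (H a k) * res N H z j k) - z * res N H z j a = (if a = j then 1 else 0)" if "a < N" for a
    using res_left[OF H z j that] msymD[OF H _ that] by (auto simp: mult.commute)
  from res_unique[OF H z i this] have "res N H z j i = (\<Sum>b<N. res N H z i b * (if b = j then 1 else 0))"
    by simp
  then show ?thesis using j by (simp add: sum_mult_indicator_eq)
qed

lemma Ward:
  assumes H: "msym N H" and z: "0 < Im z" and i: "i < N"
  shows "(\<Sum>j<N. (cmod (res N H z i j))\<^sup>2) = Im (res N H z i i) / Im z"
proof -
  have "(\<Sum>k<N. of_real (H a k) * res N H z k i) - z * res N H z a i = (if a = i then 1 else 0)" if "a < N" for a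
    using res_right[OF H z that i] by simp
  from energy_identity[OF H this]
  have "Im (\<Sum>a<N. res N H z a i * cnj (if a = i then 1 else 0)) = Im z * (\<Sum>a<N. (cmod (res N H z a i))\<^sup>2)" .
  moreover have "(\<Sum>a<N. res N H z a i * cnj (if a = i then 1 else 0)) = res N H z i i"
    using i by (simp add: if_distrib cong: if_cong)
  moreover have "(\<Sum>a<N. (cmod (res N H z a i))\<^sup>2) = (\<Sum>a<N. (cmod (res N H z i a))\<^sup>2)"
    using res_sym[OF H z i] by (intro sum.cong) auto
  ultimately show ?thesis using z by (simp add: field_simps)
qed

lemma res_apply_energy:
  assumes H: "msym N H" and z: "0 < Im z"
  shows "Im (\<Sum>i<N. (\<Sum>j<N. res N H z i j * of_real (v j)) * of_real (v i))
    = Im z * (\<Sum>i<N. (cmod (\<Sum>j<N. res N H z i j * of_real (v j)))\<^sup>2)"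
  using energy_identity[OF H res_solves[OF H z, of _ "\<lambda>j. of_real (v j)"]] by simp

text \<open>For x = G v the energy identity and Cauchy-Schwarz give Im z |x|^2 \<le> |x| |v|, so the
  operator norm of G is at most 1 / Im z.\<close>

lemma res_op_bound:
  assumes H: "msym N H" and z: "0 < Im z"
  shows "(\<Sum>i<N. (cmod (\<Sum>j<N. res N H z i j * v j))\<^sup>2) \<le> (\<Sum>i<N. (cmod (v i))\<^sup>2) / (Im z)\<^sup>2"
proof -
  define x where "x i = (\<Sum>j<N. res N H z i j * v j)" for i
  define a where "a = L2_set (\<lambda>i. cmod (x i)) {..<N}"
  define b where "b = L2_set (\<lambda>i. cmod (v i)) {..<N}"
  have a2: "a\<^sup>2 = (\<Sum>i<N. (cmod (x i))\<^sup>2)" and b2: "b\<^sup>2 = (\<Sum>i<N. (cmod (v i))\<^sup>2)"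
    by (simp_all add: a_def b_def L2_set_def sum_nonneg)
  have ab: "0 \<le> a" "0 \<le> b" by (simp_all add: a_def b_def L2_set_nonneg)
  have "Im z * a\<^sup>2 = Im (\<Sum>i<N. x i * cnj (v i))"
    using energy_identity[OF H res_solves[OF H z, of _ v]] by (simp add: a2 x_def)
  also have "\<dots> \<le> cmod (\<Sum>i<N. x i * cnj (v i))" using abs_Im_le_cmod abs_le_D1 by blast
  also have "\<dots> \<le> (\<Sum>i<N. \<bar>cmod (x i)\<bar> * \<bar>cmod (v i)\<bar>)"
    by (rule order_trans[OF norm_sum]) (simp add: norm_mult)
  also have "\<dots> \<le> a * b" unfolding a_def b_def by (rule L2_set_mult_ineq)
  finally have "Im z * a * a \<le> b * a" by (simp add: power2_eq_square algebra_simps)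
  then have "Im z * a \<le> b"
    using ab by (cases "a = 0") auto
  then have "(Im z * a)\<^sup>2 \<le> b\<^sup>2" using ab z by (intro power_mono) auto
  then have "a\<^sup>2 * (Im z)\<^sup>2 \<le> b\<^sup>2" by (simp add: power_mult_distrib mult.commute)
  then have "a\<^sup>2 \<le> b\<^sup>2 / (Im z)\<^sup>2" using z by (simp add: pos_le_divide_eq)
  then show ?thesis unfolding a2 b2 x_def .
qed

lemma res_diag_Im_pos:
  assumes H: "msym N H" and z: "0 < Im z" and i: "i < N"
  shows "0 < Im (res N H z i i)"
proof -
  have "0 \<le> Im (res N H z i i) / Im z"
    unfolding Ward[OF H z i, symmetric] by (intro sum_nonneg) auto
  \<comment> \<open>Strictness: a vanishing imaginary part would kill the whole row i by Ward's
    identity, contradicting G (H - z) = 1.\<close>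
  moreover have "Im (res N H z i i) \<noteq> 0"
  proof
    assume "Im (res N H z i i) = 0"
    then have "(\<Sum>j<N. (cmod (res N H z i j))\<^sup>2) = 0" using Ward[OF H z i] by simp
    then have "\<forall>j<N. res N H z i j = 0" by (subst (asm) sum_nonneg_eq_0_iff) auto
    with res_left[OF H z i i] i show False by simp
  qed
  ultimately show ?thesis using z by (simp add: zero_le_divide_iff)
qed

lemma res_entry_bound:
  assumes H: "msym N H" and z: "0 < Im z" and i: "i < N" and j: "j < N"
  shows "cmod (res N H z i j) \<le> 1 / Im z"
proof -
  define e :: "nat \<Rightarrow> complex" where "e b = (if b = j then 1 else 0)" for b
  have col: "(\<Sum>b<N. res N H z a b * e b) = res N H z a j" for a
    unfolding e_def by (rule sum_mult_indicator_eq[OF j])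
  have "(\<Sum>b<N. (cmod (e b))\<^sup>2) = (\<Sum>b<N. 1 * (if b = j then 1 else 0))"
    by (intro sum.cong) (auto simp: e_def)
  then have unit: "(\<Sum>b<N. (cmod (e b))\<^sup>2) = 1" using j by (simp add: sum_mult_indicator_eq)
  have "(cmod (res N H z i j))\<^sup>2 \<le> (\<Sum>a<N. (cmod (res N H z a j))\<^sup>2)"
    by (rule member_le_sum) (use i in auto)
  also have "\<dots> \<le> 1 / (Im z)\<^sup>2"
    using res_op_bound[OF H z, of e] unfolding col unit .
  also have "\<dots> = (1 / Im z)\<^sup>2" by (simp add: power_divide)
  finally show ?thesis by (rule power2_le_imp_le) (use z in auto)
qed

text \<open>The Sherman-Morrison formula, with the denominator 1 + \<sigma> (v, G v) kept as a
  factor so that no division occurs.\<close>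

lemma rank_one_shift:
  assumes H: "msym N H" and H': "msym N H'" and z: "0 < Im z"
    and upd: "\<And>i j. i < N \<Longrightarrow> j < N \<Longrightarrow> H' i j = H i j + \<sigma> * v i * v j" and i: "i < N"
  shows "(\<Sum>j<N. res N H' z i j * of_real (v j)) *
      (1 + of_real \<sigma> * (\<Sum>i<N. (\<Sum>j<N. res N H z i j * of_real (v j)) * of_real (v i)))
    = (\<Sum>j<N. res N H z i j * of_real (v j))"
    and "j < N \<Longrightarrow> res N H' z i j - res N H z i j
      = - of_real \<sigma> * (\<Sum>j<N. res N H' z i j * of_real (v j)) * (\<Sum>i<N. res N H z j i * of_real (v i))"
proof -
  define x where "x i = (\<Sum>j<N. res N H z i j * of_real (v j))" for i
  define x' where "x' i = (\<Sum>j<N. res N H' z i j * of_real (v j))" for i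
  have diff: "res N H' z i j - res N H z i j = - of_real \<sigma> * x' i * x j" if j: "j < N" for j
  proof -
    have "res N H' z i j - res N H z i j
      = - (\<Sum>k<N. \<Sum>l<N. res N H' z i k * of_real (H' k l - H k l) * res N H z l j)"
      using resolvent_identity[OF H H' z z i j] by simp
    also have "(\<Sum>k<N. \<Sum>l<N. res N H' z i k * of_real (H' k l - H k l) * res N H z l j)
      = (\<Sum>k<N. \<Sum>l<N. of_real \<sigma> * ((res N H' z i k * of_real (v k)) * (res N H z j l * of_real (v l))))"
      using res_sym[OF H z _ j] by (intro sum.cong refl) (auto simp: upd)
    also have "\<dots> = of_real \<sigma> * (x' i * x j)"
      by (simp only: x_def x'_def sum_product) (simp only: sum_distrib_left)
    finally show ?thesis by simp
  qed
  have "x' i - x i = (\<Sum>j<N. (res N H' z i j - res N H z i j) * of_real (v j))"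
    by (simp add: x_def x'_def sum_subtractf algebra_simps)
  also have "\<dots> = - of_real \<sigma> * x' i * (\<Sum>j<N. x j * of_real (v j))"
    by (simp add: diff sum_distrib_left sum_negf mult.assoc)
  finally show "(\<Sum>j<N. res N H' z i j * of_real (v j)) *
      (1 + of_real \<sigma> * (\<Sum>i<N. (\<Sum>j<N. res N H z i j * of_real (v j)) * of_real (v i)))
    = (\<Sum>j<N. res N H z i j * of_real (v j))"
    unfolding x_def[symmetric] x'_def[symmetric] by (simp add: algebra_simps)
  show "res N H' z i j - res N H z i j
      = - of_real \<sigma> * (\<Sum>j<N. res N H' z i j * of_real (v j)) * (\<Sum>i<N. res N H z j i * of_real (v i))"
    if "j < N" using diff[OF that] by (simp add: x_def x'_def)
qed

text \<open>By Sherman-Morrison the trace changes by - \<sigma> (sum of x_i^2) / (1 + \<sigma>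
  \<beta>) with x = G v. The denominator has imaginary part \<sigma> Im z |x|^2, which is why the
  bound does not see the size of the perturbation.\<close>

lemma trace_rank_one_bound:
  assumes H: "msym N H" and z: "0 < Im z"
    and upd: "\<And>i j. i < N \<Longrightarrow> j < N \<Longrightarrow> H' i j = H i j + \<sigma> * v i * v j"
  shows "cmod ((\<Sum>i<N. res N H' z i i) - (\<Sum>i<N. res N H z i i)) \<le> 1 / Im z"
proof -
  have H': "msym N H'" using H by (auto simp: msym_def upd)
  define x where "x i = (\<Sum>j<N. res N H z i j * of_real (v j))" for i
  define x' where "x' i = (\<Sum>j<N. res N H' z i j * of_real (v j))" for i
  define \<beta> where "\<beta> = (\<Sum>i<N. x i * of_real (v i))"
  define m where "m = (\<Sum>i<N. (cmod (x i))\<^sup>2)"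
  have m0: "0 \<le> m" unfolding m_def by (intro sum_nonneg) auto
  have x': "x' i * (1 + of_real \<sigma> * \<beta>) = x i" if "i < N" for i
    using rank_one_shift(1)[OF H H' z upd that] by (simp add: x_def x'_def \<beta>_def)
  have Im\<beta>: "Im \<beta> = Im z * m"
    using res_apply_energy[OF H z, of v] by (simp add: \<beta>_def m_def x_def)
  have "(\<Sum>i<N. res N H' z i i) - (\<Sum>i<N. res N H z i i) = (\<Sum>i<N. - of_real \<sigma> * x' i * x i)"
    unfolding sum_subtractf[symmetric] x_def x'_def
    by (intro sum.cong refl rank_one_shift(2)[OF H H' z upd]) auto
  also have "\<dots> = - of_real \<sigma> * (\<Sum>i<N. x' i * x i)" by (simp add: sum_distrib_left mult.assoc)
  finally have D: "(\<Sum>i<N. res N H' z i i) - (\<Sum>i<N. res N H z i i) = - of_real \<sigma> * (\<Sum>i<N. x' i * x i)" .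
  show ?thesis
  proof (cases "\<sigma> = 0 \<or> m = 0")
    case True
    then have "- of_real \<sigma> * (\<Sum>i<N. x' i * x i) = 0"
    proof
      assume "m = 0"
      then have "\<forall>i<N. x i = 0" unfolding m_def by (subst (asm) sum_nonneg_eq_0_iff) auto
      then show ?thesis by simp
    qed simp
    then show ?thesis unfolding D using z by (simp only: norm_zero) simp
  next
    case False
    then have mp: "0 < m" and s: "\<sigma> \<noteq> 0" using m0 by auto
    have "\<bar>\<sigma>\<bar> * (Im z * m) = \<bar>Im (1 + of_real \<sigma> * \<beta>)\<bar>" using mp z by (simp add: Im\<beta> abs_mult)
    also have "\<dots> \<le> cmod (1 + of_real \<sigma> * \<beta>)" by (rule abs_Im_le_cmod)
    finally have le: "\<bar>\<sigma>\<bar> * (Im z * m) \<le> cmod (1 + of_real \<sigma> * \<beta>)" .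
    have pos: "0 < \<bar>\<sigma>\<bar> * (Im z * m)" using mp z s by simp
    have "(1 + of_real \<sigma> * \<beta>) * (\<Sum>i<N. x' i * x i) = (\<Sum>i<N. (x' i * (1 + of_real \<sigma> * \<beta>)) * x i)"
      by (simp add: sum_distrib_left algebra_simps)
    also have "\<dots> = (\<Sum>i<N. x i * x i)" by (intro sum.cong) (auto simp: x')
    finally have "cmod (1 + of_real \<sigma> * \<beta>) * cmod (\<Sum>i<N. x' i * x i) = cmod (\<Sum>i<N. x i * x i)"
      by (metis norm_mult)
    also have "\<dots> \<le> m" unfolding m_def
      by (rule order_trans[OF norm_sum]) (simp add: norm_mult power2_eq_square)
    finally have "\<bar>\<sigma>\<bar> * (Im z * m) * cmod (\<Sum>i<N. x' i * x i) \<le> m"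
      using mult_right_mono[OF le, of "cmod (\<Sum>i<N. x' i * x i)"] by simp
    then have "m * (Im z * (\<bar>\<sigma>\<bar> * cmod (\<Sum>i<N. x' i * x i))) \<le> m * 1"
      by (simp add: ac_simps)
    then have "Im z * (\<bar>\<sigma>\<bar> * cmod (\<Sum>i<N. x' i * x i)) \<le> 1"
      using mp by (simp only: mult_le_cancel_left_pos)
    then show ?thesis unfolding D using z by (simp add: norm_mult field_simps)
  qed
qed

text \<open>A change of row and column a has the form e u^T + u e^T, which polarizes into half the
  difference of the rank one matrices built from e + u and e - u. Two rank one bounds add
  up.\<close>

lemma trace_row_change_bound:
  assumes H: "msym N H" and H': "msym N H'" and z: "0 < Im z"
    and upd: "\<And>i j. i < N \<Longrightarrow> j < N \<Longrightarrow> i \<noteq> a \<Longrightarrow> j \<noteq> a \<Longrightarrow> H' i j = H i j"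
  shows "cmod ((\<Sum>i<N. res N H' z i i) - (\<Sum>i<N. res N H z i i)) \<le> 2 / Im z"
proof (cases "a < N")
  case True
  define e :: "nat \<Rightarrow> real" where "e i = (if i = a then 1 else 0)" for i
  \<comment> \<open>The diagonal entry is halved because e u^T + u e^T counts it twice.\<close>
  define u where "u i = (if i = a then (H' a a - H a a) / 2 else H' a i - H a i)" for i
  define H1 where "H1 i j = H i j + (1/2) * (e i + u i) * (e j + u j)" for i j
  have H1: "msym N H1" using H by (auto simp: msym_def H1_def)
  have "H' i j = H1 i j + (- 1/2) * (e i - u i) * (e j - u j)" if "i < N" "j < N" for i j
    using that upd[OF that] msymD[OF H that] msymD[OF H' that]
    by (auto simp: H1_def e_def u_def field_simps)
  from trace_rank_one_bound[OF H1 z this]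
  have "cmod ((\<Sum>i<N. res N H' z i i) - (\<Sum>i<N. res N H1 z i i)) \<le> 1 / Im z" by simp
  moreover have "cmod ((\<Sum>i<N. res N H1 z i i) - (\<Sum>i<N. res N H z i i)) \<le> 1 / Im z"
    by (rule trace_rank_one_bound[OF H z]) (rule H1_def)
  ultimately show ?thesis
    using norm_triangle_ineq[of "(\<Sum>i<N. res N H' z i i) - (\<Sum>i<N. res N H1 z i i)"
      "(\<Sum>i<N. res N H1 z i i) - (\<Sum>i<N. res N H z i i)"] by simp
next
  case False
  have "H' i j = H i j + 0 * 0 * 0" if "i < N" "j < N" for i j
    using upd[OF that] that False by auto
  from trace_rank_one_bound[OF H z, of H' 0 "\<lambda>_. 0"] this
  have "cmod ((\<Sum>i<N. res N H' z i i) - (\<Sum>i<N. res N H z i i)) \<le> 1 / Im z" by simp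
  also have "\<dots> \<le> 2 / Im z" using z by (intro divide_right_mono) auto
  finally show ?thesis .
qed

section \<open>Differentiability of the resolvent in the matrix and in the spectral
  parameter\<close>

lemma res_line_derivative:
  assumes A: "msym N A" and K: "msym N K" and z: "0 < Im z" and i: "i < N" and j: "j < N"
  defines "G \<equiv> \<lambda>x. res N (\<lambda>i j. A i j + x * K i j) z"
  shows "((\<lambda>x. G x i j) has_vector_derivative
    - (\<Sum>k<N. \<Sum>l<N. G x i k * of_real (K k l) * G x l j)) (at x)"
proof -
  have sym: "msym N (\<lambda>i j. A i j + x * K i j)" for x
    using A K by (auto simp: msym_def)
  have diff: "G y i j - G x i j = - of_real (y - x) * (\<Sum>k<N. \<Sum>l<N. G y i k * of_real (K k l) * G x l j)"
    if "i < N" "j < N" for y i j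
    using resolvent_identity[OF sym[of x] sym[of y] z z that]
    by (simp add: G_def sum_distrib_left algebra_simps sum_subtractf)
  \<comment> \<open>The bound is uniform along the line. With the resolvent identity it gives
    Lipschitz continuity, and continuity turns the exact difference formula into a
    derivative.\<close>
  have bd: "cmod (G y i j) \<le> 1 / Im z" if "i < N" "j < N" for y i j
    using res_entry_bound[OF sym z that] by (simp add: G_def)
  have lim: "((\<lambda>y. G y i j) \<longlongrightarrow> G x i j) (at x)" if "i < N" "j < N" for i j
  proof -
    define C where "C = (\<Sum>k<N. \<Sum>l<N. \<bar>K k l\<bar> / (Im z)\<^sup>2)"
    have le: "norm (G y i j - G x i j) \<le> \<bar>y - x\<bar> * C" for y
    proof -
      have "cmod (\<Sum>k<N. \<Sum>l<N. G y i k * of_real (K k l) * G x l j) \<le> C"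
        unfolding C_def
      proof (intro sum_norm_le)
        fix k l assume "k \<in> {..<N}" "l \<in> {..<N}"
        then have "cmod (G y i k) * \<bar>K k l\<bar> * cmod (G x l j) \<le> (1 / Im z) * \<bar>K k l\<bar> * (1 / Im z)"
          using z that by (intro mult_mono bd) auto
        then show "cmod (G y i k * of_real (K k l) * G x l j) \<le> \<bar>K k l\<bar> / (Im z)\<^sup>2"
          by (simp add: norm_mult power2_eq_square)
      qed
      then show ?thesis unfolding diff[OF that]
        by (simp add: norm_mult mult_left_mono flip: of_real_diff)
    qed
    have "((\<lambda>y. \<bar>y - x\<bar> * C) \<longlongrightarrow> \<bar>x - x\<bar> * C) (at x)"
      by (intro tendsto_intros)
    then have "((\<lambda>y. \<bar>y - x\<bar> * C) \<longlongrightarrow> 0) (at x)" by simp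
    with always_eventually[OF allI[OF le]] have "((\<lambda>y. G y i j - G x i j) \<longlongrightarrow> 0) (at x)"
      by (rule Lim_null_comparison)
    then show ?thesis by (simp add: LIM_zero_iff)
  qed
  have "((\<lambda>y. - (\<Sum>k<N. \<Sum>l<N. G y i k * of_real (K k l) * G x l j)) \<longlongrightarrow>
      - (\<Sum>k<N. \<Sum>l<N. G x i k * of_real (K k l) * G x l j)) (at x)"
    using i by (intro tendsto_intros lim) auto
  then have "((\<lambda>y. (G y i j - G x i j) /\<^sub>R (y - x)) \<longlongrightarrow>
      - (\<Sum>k<N. \<Sum>l<N. G x i k * of_real (K k l) * G x l j)) (at x)"
    by (rule Lim_transform_eventually)
      (auto simp: eventually_at_filter diff[OF i j] scaleR_conv_of_real simp flip: of_real_diff)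
  from tendsto_Re[OF this] tendsto_Im[OF this] show ?thesis
    unfolding has_vector_derivative_complex_iff has_field_derivative_iff
    by (simp add: divide_inverse mult.commute)
qed

lemma res_param_derivative:
  assumes H: "msym N H" and z: "0 < Im z" and i: "i < N" and j: "j < N"
  shows "((\<lambda>w. res N H w i j) has_field_derivative (\<Sum>k<N. res N H z i k * res N H z k j)) (at z)"
proof -
  \<comment> \<open>Nearby points stay above half the height of z, so the resolvents there are
    bounded by 2 / Im z uniformly.\<close>
  have ev: "\<forall>\<^sub>F w in at z. Im z / 2 < Im w \<and> w \<noteq> z"
  proof -
    have "\<forall>\<^sub>F w in at z. Im z / 2 < Im w"
      by (rule order_tendstoD(1)[of Im "Im z"]) (use z in \<open>auto intro!: tendsto_intros\<close>)
    then show ?thesis by (auto simp: eventually_at_filter elim: eventually_mono)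
  qed
  have diff: "res N H w i j - res N H z i j = (w - z) * (\<Sum>k<N. res N H w i k * res N H z k j)"
    if "i < N" "j < N" "Im z / 2 < Im w" for w i j
    using resolvent_identity[OF H H z _ that(1,2), of w] that z by simp
  have lim: "((\<lambda>w. res N H w i j) \<longlongrightarrow> res N H z i j) (at z)" if "i < N" "j < N" for i j
  proof -
    define C where "C = (\<Sum>k<N. (2 / Im z) * (1 / Im z))"
    have "\<forall>\<^sub>F w in at z. norm (res N H w i j - res N H z i j) \<le> norm (w - z) * C"
      using ev
    proof (rule eventually_mono)
      fix w assume w: "Im z / 2 < Im w \<and> w \<noteq> z"
      have "cmod (\<Sum>k<N. res N H w i k * res N H z k j) \<le> C"
        unfolding C_def
      proof (rule sum_norm_le)
        fix k assume "k \<in> {..<N}"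
        then have k: "k < N" by simp
        have "cmod (res N H w i k) \<le> 1 / Im w" using res_entry_bound[OF H _ that(1) k] w z by auto
        also have "\<dots> \<le> 2 / Im z" using w z by (simp add: field_simps)
        finally show "cmod (res N H w i k * res N H z k j) \<le> 2 / Im z * (1 / Im z)"
          unfolding norm_mult using res_entry_bound[OF H z k that(2)] z by (intro mult_mono) auto
      qed
      then show "norm (res N H w i j - res N H z i j) \<le> norm (w - z) * C"
        using diff[OF that, of w] w by (simp add: norm_mult mult_left_mono)
    qed
    moreover have "((\<lambda>w. norm (w - z) * C) \<longlongrightarrow> norm (z - z) * C) (at z)"
      by (intro tendsto_intros)
    then have "((\<lambda>w. norm (w - z) * C) \<longlongrightarrow> 0) (at z)" by simp
    ultimately have "((\<lambda>w. res N H w i j - res N H z i j) \<longlongrightarrow> 0) (at z)"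
      by (rule Lim_null_comparison)
    then show ?thesis by (simp add: LIM_zero_iff)
  qed
  have "((\<lambda>w. \<Sum>k<N. res N H w i k * res N H z k j) \<longlongrightarrow> (\<Sum>k<N. res N H z i k * res N H z k j)) (at z)"
    using i by (intro tendsto_intros lim) auto
  then have "((\<lambda>w. (res N H w i j - res N H z i j) / (w - z)) \<longlongrightarrow> (\<Sum>k<N. res N H z i k * res N H z k j)) (at z)"
    by (rule Lim_transform_eventually) (use ev in \<open>auto elim!: eventually_mono simp: diff[OF i j]\<close>)
  then show ?thesis by (simp add: has_field_derivative_iff)
qed

subsection \<open>The normalized trace and its spectral representation\<close>

definition mmul :: "nat \<Rightarrow> (nat \<Rightarrow> nat \<Rightarrow> complex) \<Rightarrow> (nat \<Rightarrow> nat \<Rightarrow> complex) \<Rightarrow> nat \<Rightarrow> nat \<Rightarrow> complex" where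
  "mmul N A B i j = (\<Sum>k<N. A i k * B k j)"

definition frob :: "nat \<Rightarrow> (nat \<Rightarrow> nat \<Rightarrow> complex) \<Rightarrow> real" where
  "frob N A = sqrt (\<Sum>i<N. \<Sum>j<N. (cmod (A i j))\<^sup>2)"

text \<open>The Stieltjes transform with size, matrix and spectral parameter as independent
  arguments: the matrix of one level is also read at the size of the next one, and at a random
  point.\<close>

definition ntr :: "nat \<Rightarrow> (nat \<Rightarrow> nat \<Rightarrow> real) \<Rightarrow> complex \<Rightarrow> complex" where
  "ntr N H z = (\<Sum>i<N. res N H z i i) / of_nat N"

lemma frob_nonneg [simp]: "0 \<le> frob N A"
  by (simp add: frob_def sum_nonneg)

lemma frob_sq: "(frob N A)\<^sup>2 = (\<Sum>i<N. \<Sum>j<N. (cmod (A i j))\<^sup>2)"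
  by (simp add: frob_def sum_nonneg)

lemma frob_Cauchy_Schwarz:
  "cmod (\<Sum>i<N. \<Sum>j<N. A i j * B i j) \<le> frob N A * frob N B"
proof -
  have "cmod (\<Sum>i<N. \<Sum>j<N. A i j * B i j) = cmod (\<Sum>p\<in>{..<N}\<times>{..<N}. A (fst p) (snd p) * B (fst p) (snd p))"
    by (simp add: sum.cartesian_product case_prod_beta)
  also have "\<dots> \<le> (\<Sum>p\<in>{..<N}\<times>{..<N}. \<bar>cmod (A (fst p) (snd p))\<bar> * \<bar>cmod (B (fst p) (snd p))\<bar>)"
    by (rule order_trans[OF norm_sum]) (simp add: norm_mult)
  also have "\<dots> \<le> L2_set (\<lambda>p. cmod (A (fst p) (snd p))) ({..<N}\<times>{..<N}) * L2_set (\<lambda>p. cmod (B (fst p) (snd p))) ({..<N}\<times>{..<N})"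
    by (rule L2_set_mult_ineq)
  also have "\<dots> = frob N A * frob N B"
    by (simp add: L2_set_def frob_def sum.cartesian_product case_prod_beta)
  finally show ?thesis .
qed

lemma frob_transpose: "frob N (\<lambda>i j. A j i) = frob N A"
  unfolding frob_def by (subst sum.swap) simp

lemma frob_cnj: "frob N (\<lambda>i j. cnj (A i j)) = frob N A"
  by (simp add: frob_def)

text \<open>By symmetry each row of A G is G applied to a row of A, so the operator bound applies
  row by row: a resolvent factor costs 1 / Im z in Hilbert-Schmidt norm.\<close>

lemma frob_mmul_res:
  assumes H: "msym N H" and z: "0 < Im z"
  shows "frob N (mmul N A (res N H z)) \<le> frob N A / Im z"
proof -
  have "(frob N (mmul N A (res N H z)))\<^sup>2 = (\<Sum>i<N. \<Sum>j<N. (cmod (\<Sum>k<N. res N H z j k * A i k))\<^sup>2)"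
    unfolding frob_sq mmul_def
    by (intro sum.cong refl arg_cong[where f = "\<lambda>x. (cmod x)\<^sup>2"]) (simp add: res_sym[OF H z] mult.commute)
  also have "\<dots> \<le> (\<Sum>i<N. (\<Sum>j<N. (cmod (A i j))\<^sup>2) / (Im z)\<^sup>2)"
    by (intro sum_mono res_op_bound[OF H z])
  also have "\<dots> = (frob N A / Im z)\<^sup>2"
    by (simp only: power_divide frob_sq sum_divide_distrib)
  finally show ?thesis by (rule power2_le_imp_le) (use z in simp)
qed

lemma frob_res:
  assumes H: "msym N H" and z: "0 < Im z" and N: "0 < N"
  shows "(frob N (res N H z))\<^sup>2 = real N * Im (ntr N H z) / Im z"
proof -
  have "(frob N (res N H z))\<^sup>2 = (\<Sum>i<N. Im (res N H z i i) / Im z)"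
    unfolding frob_sq by (intro sum.cong refl Ward[OF H z]) auto
  then show ?thesis using N by (simp add: ntr_def Im_divide_of_nat flip: sum_divide_distrib)
qed

lemma ntr_Im_pos:
  assumes H: "msym N H" and z: "0 < Im z" and N: "0 < N"
  shows "0 < Im (ntr N H z)"
  using N by (auto simp: ntr_def Im_divide_of_nat intro!: divide_pos_pos sum_pos res_diag_Im_pos[OF H z])

lemma ntr_bound:
  assumes H: "msym N H" and z: "0 < Im z" and N: "0 < N"
  shows "cmod (ntr N H z) \<le> 1 / Im z"
proof -
  have "cmod (\<Sum>i<N. res N H z i i) \<le> (\<Sum>i<N. 1 / Im z)"
    by (rule sum_norm_le) (auto intro: res_entry_bound[OF H z])
  then show ?thesis using N z by (simp add: ntr_def norm_divide field_simps)
qed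

lemma ntr_param_derivative:
  assumes H: "msym N H" and z: "0 < Im z"
  shows "(ntr N H has_field_derivative ((\<Sum>i<N. \<Sum>k<N. res N H z i k * res N H z k i) / of_nat N)) (at z)"
  unfolding ntr_def[abs_def]
  by (intro DERIV_cdivide DERIV_sum res_param_derivative[OF H z]) auto

text \<open>The derivative is the normalized trace of G^2. It is bounded by the squared
  Hilbert-Schmidt norm of G, which Ward's identity evaluates exactly.\<close>

lemma ntr_derivative_bound:
  assumes H: "msym N H" and z: "0 < Im z" and N: "0 < N"
  shows "cmod ((\<Sum>i<N. \<Sum>k<N. res N H z i k * res N H z k i) / of_nat N) \<le> Im (ntr N H z) / Im z"
proof -
  have "cmod (\<Sum>i<N. \<Sum>k<N. res N H z i k * res N H z k i) \<le> frob N (res N H z) * frob N (\<lambda>i k. res N H z k i)"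
    by (rule frob_Cauchy_Schwarz)
  also have "\<dots> = real N * Im (ntr N H z) / Im z"
    unfolding frob_transpose[of N "res N H z"] using frob_res[OF H z N] by (simp add: power2_eq_square)
  finally show ?thesis using N by (simp add: norm_divide field_simps)
qed

section \<open>The library inverse and the spectral representation\<close>

lemma matrix_uminus_shift:
  "map_mat complex_of_real (mat N N (\<lambda>(i, j). H i j)) - z \<cdot>\<^sub>m 1\<^sub>m N = shifted N H z"
  by (rule eq_matI) (auto simp: shifted_def)

lemma res_mat_inverse:
  assumes H: "msym N H" and z: "0 < Im z"
  defines "G \<equiv> mat N N (\<lambda>(i, j). res N H z i j)"
  shows "shifted N H z * G = 1\<^sub>m N" and "G * shifted N H z = 1\<^sub>m N" and "G \<in> carrier_mat N N"
proof -
  show G: "G \<in> carrier_mat N N" by (simp add: G_def)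
  show "shifted N H z * G = 1\<^sub>m N"
  proof (rule eq_matI)
    fix i j assume "i < dim_row (1\<^sub>m N :: complex mat)" "j < dim_col (1\<^sub>m N :: complex mat)"
    then have ij: "i < N" "j < N" by auto
    have "(shifted N H z * G) $$ (i, j) = (\<Sum>k<N. (of_real (H i k) - (if i = k then z else 0)) * res N H z k j)"
      using ij by (subst mat_mult_entry[OF shifted_carrier G]) (auto simp: shifted_def G_def intro!: sum.cong)
    also have "\<dots> = (\<Sum>k<N. of_real (H i k) * res N H z k j) - (\<Sum>k<N. if i = k then z * res N H z k j else 0)"
      unfolding sum_subtractf[symmetric] by (intro sum.cong) (auto simp: algebra_simps)
    finally show "(shifted N H z * G) $$ (i, j) = 1\<^sub>m N $$ (i, j)"
      using ij by (simp add: res_right[OF H z])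
  qed (auto simp: shifted_def G_def)
  then show "G * shifted N H z = 1\<^sub>m N"
    using mat_mult_left_right_inverse[OF shifted_carrier G] by simp
qed

text \<open>The resolvent is a two-sided inverse, so \<open>mat_inverse\<close> succeeds and the
  default value 0 in \<open>Stieltjes\<close> is never met in the upper half plane.\<close>

lemma Stieltjes_eq_ntr:
  assumes H: "msym (Nsz n) (\<lambda>i j. Hmat eps n \<omega> $$ (i, j))" and z: "0 < Im z"
  shows "Stieltjes eps n \<omega> z = ntr (Nsz n) (\<lambda>i j. Hmat eps n \<omega> $$ (i, j)) z"
proof -
  define N where "N = Nsz n"
  define h where "h i j = Hmat eps n \<omega> $$ (i, j)" for i j
  define G where "G = mat N N (\<lambda>(i, j). res N h z i j)"
  have hs: "msym N h" using H by (simp add: N_def h_def[abs_def])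
  have "Hmat eps n \<omega> = mat N N (\<lambda>(i, j). h i j)"
    by (rule eq_matI) (auto simp: h_def N_def Hmat_def)
  then have M: "map_mat complex_of_real (Hmat eps n \<omega>) - z \<cdot>\<^sub>m 1\<^sub>m N = shifted N h z"
    by (simp add: matrix_uminus_shift)
  note G = res_mat_inverse[OF hs z, folded G_def]
  have "mat_inverse (shifted N h z) \<noteq> None"
  proof
    assume "mat_inverse (shifted N h z) = None"
    then have "shifted N h z \<notin> Units (ring_mat TYPE(complex) N ())"
      by (rule mat_inverse(1)[OF shifted_carrier])
    with G show False by (auto simp: Units_def ring_mat_def)
  qed
  then obtain B where B: "mat_inverse (shifted N h z) = Some B" by auto
  from mat_inverse(2)[OF shifted_carrier this]
  have B': "B * shifted N h z = 1\<^sub>m N" "B \<in> carrier_mat N N" by auto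
  have "B = B * (shifted N h z * G)" using G(1) B' by simp
  also have "\<dots> = G" using B' G(3) by (simp add: assoc_mult_mat[OF B'(2) shifted_carrier G(3), symmetric])
  finally have "B = G" .
  have "Stieltjes eps n \<omega> z = mtrace B / of_nat N"
    unfolding Stieltjes_def N_def[symmetric] M B by simp
  also have "\<dots> = ntr N h z" unfolding \<open>B = G\<close>
    by (simp add: mtrace_def ntr_def G_def)
  finally show ?thesis by (simp add: N_def h_def[abs_def])
qed

text \<open>Back substitution: working upwards from the last row, T X = 1 forces X to be upper
  triangular too, and the diagonal of the product then decouples.\<close>

lemma upper_triangular_inverse_diag:
  fixes T X :: "complex mat"
  assumes T: "T \<in> carrier_mat N N" "upper_triangular T" and X: "X \<in> carrier_mat N N"
    and TX: "T * X = 1\<^sub>m N" and i: "i < N"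
  shows "T $$ (i, i) * X $$ (i, i) = 1"
proof -
  have ent: "(\<Sum>k<N. T $$ (i, k) * X $$ (k, j)) = (if i = j then 1 else 0)" if "i < N" "j < N" for i j
    using TX mat_mult_entry[OF T(1) X that] that by simp
  have split: "(\<Sum>k<N. T $$ (i, k) * X $$ (k, j)) = T $$ (i, i) * X $$ (i, j) + (\<Sum>k\<in>{i<..<N}. T $$ (i, k) * X $$ (k, j))"
    if "i < N" for i j
  proof -
    have "(\<Sum>k<N. T $$ (i, k) * X $$ (k, j)) = (\<Sum>k\<in>insert i {i<..<N}. T $$ (i, k) * X $$ (k, j))"
      using T that by (intro sum.mono_neutral_right) (auto simp: upper_triangular_def)
    then show ?thesis by simp
  qed
  have main: "(\<forall>j\<le>i. (\<Sum>k\<in>{i<..<N}. T $$ (i, k) * X $$ (k, j)) = 0)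
     \<and> (\<forall>j<i. X $$ (i, j) = 0)" if "i < N" for i
    using that
  proof (induction "N - i" arbitrary: i rule: less_induct)
    case less
    have zero: "X $$ (k, j) = 0" if "k \<in> {i<..<N}" "j \<le> i" for k j
      using less(1)[of k] less(2) that by auto
    have s: "(\<Sum>k\<in>{i<..<N}. T $$ (i, k) * X $$ (k, j)) = 0" if "j \<le> i" for j
      using zero that by (intro sum.neutral) auto
    have d: "T $$ (i, i) * X $$ (i, i) = 1"
      using ent[OF less(2) less(2)] split[OF less(2), of i] s[of i] by simp
    have "X $$ (i, j) = 0" if "j < i" for j
    proof -
      have "T $$ (i, i) * X $$ (i, j) = 0"
        using ent[OF less(2), of j] split[OF less(2), of j] s[of j] that less(2) by simp
      with d show ?thesis by auto
    qed
    with s show ?case by auto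
  qed
  show ?thesis using ent[OF i i] split[OF i, of i] main[OF i] by simp
qed

text \<open>One list of eigenvalues has to serve both the density of states, defined through roots
  of the real characteristic polynomial, and the trace of the resolvent. A complex Schur form
  provides it: the energy identity makes its diagonal real, and the factorization descends to the
  reals because the embedding of polynomials is injective.\<close>

lemma spectral_representation:
  assumes H: "msym N H"
  shows "\<exists>es. length es = N
    \<and> (\<forall>z. 0 < Im z \<longrightarrow> (\<Sum>i<N. res N H z i i) = (\<Sum>e\<leftarrow>es. 1 / (complex_of_real e - z)))
    \<and> (\<forall>f. trace_fun f (mat N N (\<lambda>(i, j). H i j)) = (\<Sum>e\<leftarrow>es. f e))"
proof -
  define R where "R = mat N N (\<lambda>(i, j). H i j)"
  define A where "A = map_mat complex_of_real R"
  have R: "R \<in> carrier_mat N N" and A: "A \<in> carrier_mat N N" by (auto simp: R_def A_def)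
  obtain as where "char_poly A = (\<Prod>a\<leftarrow>as. [:- a, 1:])"
    using char_poly_factorized[OF A] by auto
  from schur_decomposition_exists[OF A this] obtain B where B: "B \<in> carrier_mat N N" "upper_triangular B"
    and sim: "similar_mat A B" by auto
  then obtain P Q where "similar_mat_wit A B P Q" by (auto simp: similar_mat_def)
  from similar_mat_witD2[OF A this] have PQ: "P * Q = 1\<^sub>m N" "Q * P = 1\<^sub>m N" "A = P * B * Q"
    "P \<in> carrier_mat N N" "Q \<in> carrier_mat N N" by auto
  define as where "as = diag_mat B"
  have cp: "char_poly A = (\<Prod>a\<leftarrow>as. [:- a, 1:])"
    using char_poly_similar[OF sim] char_poly_upper_triangular[OF B] by (simp add: as_def)
  have la: "length as = N" using B by (simp add: as_def diag_mat_def)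
  have real: "Im a = 0" if "a \<in> set as" for a
  proof (rule ccontr)
    assume "Im a \<noteq> 0"
    have "poly (char_poly A) a = 0" using that unfolding cp
      by (induction as) auto
    then have "eigenvalue A a" using eigenvalue_root_char_poly[OF A] by simp
    then obtain v where v: "v \<in> carrier_vec N" "v \<noteq> 0\<^sub>v N" "A *\<^sub>v v = a \<cdot>\<^sub>v v"
      using A by (auto simp: eigenvalue_def eigenvector_def)
    define x where "x i = vec_index v i" for i
    have "(\<Sum>k<N. of_real (H i k) * x k) - a * x i = 0" if "i < N" for i
    proof -
      have "vec_index (A *\<^sub>v v) i = (\<Sum>k<N. of_real (H i k) * x k)"
        using that v(1) by (auto simp: A_def R_def scalar_prod_def x_def atLeast0LessThan intro!: sum.cong)
      with v that show ?thesis by (simp add: x_def)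
    qed
    from energy_identity[OF H this] \<open>Im a \<noteq> 0\<close> have "(\<Sum>i<N. (cmod (x i))\<^sup>2) = 0" by simp
    then have "\<forall>i<N. x i = 0" by (subst (asm) sum_nonneg_eq_0_iff) auto
    then have "v = 0\<^sub>v N" using v by (intro eq_vecI) (auto simp: x_def)
    with v show False by simp
  qed
  define es where "es = map Re as"
  have as: "as = map complex_of_real es"
    using real by (simp add: es_def map_idI complex_eq_iff)
  interpret ph: map_poly_inj_idom_hom complex_of_real ..
  have lin: "map_poly complex_of_real (\<Prod>e\<leftarrow>es. [:- e, 1:]) = (\<Prod>a\<leftarrow>map complex_of_real es. [:- a, 1:])" for es
    by (induction es) (simp_all add: ph.hom_mult map_poly_pCons del: mult_pCons_left)
  have "char_poly A = map_poly complex_of_real (char_poly R)"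
    unfolding A_def by (rule of_real_hom.char_poly_hom[OF R])
  then have "map_poly complex_of_real (char_poly R) = map_poly complex_of_real (\<Prod>e\<leftarrow>es. [:- e, 1:])"
    using cp unfolding lin as[symmetric] by simp
  then have cR: "char_poly R = (\<Prod>e\<leftarrow>es. [:- e, 1:])"
    by (rule ph.injectivity)
  have "proots (\<Prod>e\<leftarrow>es. [:- e, 1:]) = mset es" for es :: "real list"
  proof (induction es)
    case (Cons e es)
    have "(\<Prod>e\<leftarrow>es. [:- e, 1:]) \<noteq> 0" by (auto simp: prod_list_zero_iff)
    then show ?case using Cons by (simp add: proots_mult del: mult_pCons_left)
  qed simp
  then have tf: "trace_fun f R = (\<Sum>e\<leftarrow>es. f e)" for f
    unfolding trace_fun_def cR by (simp add: sum_mset_sum_list flip: mset_map)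
  have "(\<Sum>i<N. res N H z i i) = (\<Sum>e\<leftarrow>es. 1 / (complex_of_real e - z))" if z: "0 < Im z" for z
  proof -
    define G where "G = mat N N (\<lambda>(i, j). res N H z i j)"
    note G = res_mat_inverse[OF H z, folded G_def]
    \<comment> \<open>In the Schur basis the resolvent inverts a triangular matrix, so its diagonal
      entries are 1 / (e - z). The trace is unchanged by cyclicity.\<close>
    define X where "X = Q * G * P"
    have X: "X \<in> carrier_mat N N" using PQ G by (simp add: X_def)
    define T where "T = B - z \<cdot>\<^sub>m 1\<^sub>m N"
    have T: "T \<in> carrier_mat N N" "upper_triangular T" using B by (auto simp: T_def upper_triangular_def)
    have sh: "shifted N H z = P * T * Q"
    proof -
      have "P * T * Q = P * B * Q - P * (z \<cdot>\<^sub>m 1\<^sub>m N) * Q"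
        using PQ B unfolding T_def
        by (simp add: mult_minus_distrib_mat[of _ N N _ N] minus_mult_distrib_mat[of _ N N _ _ N])
      also have "P * (z \<cdot>\<^sub>m 1\<^sub>m N) * Q = z \<cdot>\<^sub>m 1\<^sub>m N"
        using PQ by (simp add: mult_smult_distrib[of _ N N _ N] mult_smult_assoc_mat[of _ N N _ N])
      finally show ?thesis using PQ(3) by (simp add: A_def R_def flip: matrix_uminus_shift)
    qed
    have "T * X = (Q * P) * T * (Q * G * P)" using PQ T by (simp add: X_def)
    also have "\<dots> = Q * (P * T * Q) * G * P"
      using PQ(4,5) T(1) G(3) by (simp add: assoc_mult_mat[of _ N N _ N _ N])
    also have "\<dots> = Q * (shifted N H z * G) * P" unfolding sh[symmetric]
      using PQ(4,5) G(3) by (simp add: assoc_mult_mat[of _ N N _ N _ N])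
    also have "\<dots> = 1\<^sub>m N" using G PQ by simp
    finally have TX: "T * X = 1\<^sub>m N" .
    have tr: "(\<Sum>i<N. (U * V) $$ (i, i)) = (\<Sum>i<N. (V * U) $$ (i, i))"
      if "U \<in> carrier_mat N N" "V \<in> carrier_mat N N" for U V :: "complex mat"
    proof -
      have "(\<Sum>i<N. (U * V) $$ (i, i)) = (\<Sum>i<N. \<Sum>k<N. U $$ (i, k) * V $$ (k, i))"
        using that by (intro sum.cong mat_mult_entry) auto
      also have "\<dots> = (\<Sum>i<N. \<Sum>k<N. V $$ (i, k) * U $$ (k, i))"
        by (subst sum.swap) (simp add: mult.commute)
      also have "\<dots> = (\<Sum>i<N. (V * U) $$ (i, i))"
        using that by (intro sum.cong mat_mult_entry[symmetric]) auto
      finally show ?thesis .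
    qed
    have "(\<Sum>i<N. res N H z i i) = (\<Sum>i<N. G $$ (i, i))" by (simp add: G_def)
    also have "\<dots> = (\<Sum>i<N. ((G * P) * Q) $$ (i, i))"
      using PQ G(3) by (simp add: assoc_mult_mat[of _ N N _ N _ N])
    also have "\<dots> = (\<Sum>i<N. X $$ (i, i))"
      using PQ G(3) by (subst tr) (auto simp: X_def assoc_mult_mat[of _ N N _ N _ N])
    also have "\<dots> = (\<Sum>i<N. 1 / (of_real (es ! i) - z))"
    proof (intro sum.cong refl)
      fix i assume "i \<in> {..<N}"
      then have i: "i < N" by simp
      have "as ! i = B $$ (i, i)" using B(1) i by (simp add: as_def diag_mat_def)
      moreover have "as ! i = complex_of_real (es ! i)"
        using arg_cong[OF as, of "\<lambda>xs. xs ! i"] i la by (simp add: es_def)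
      ultimately have "T $$ (i, i) = of_real (es ! i) - z" using B(1) i by (simp add: T_def)
      with upper_triangular_inverse_diag[OF T X TX i]
      have e: "(of_real (es ! i) - z) * X $$ (i, i) = 1" by simp
      then have "of_real (es ! i) - z \<noteq> 0" by (metis mult_zero_left zero_neq_one)
      with e show "X $$ (i, i) = 1 / (of_real (es ! i) - z)"
        by (simp only: eq_divide_eq if_False if_True mult.commute simp_thms)
    qed
    also have "\<dots> = (\<Sum>e\<leftarrow>es. 1 / (of_real e - z))"
      using la by (simp add: sum_list_sum_nth atLeast0LessThan es_def)
    finally show ?thesis .
  qed
  with tf la show ?thesis unfolding R_def by (intro exI[of _ es]) (auto simp: es_def)
qed

subsection \<open>Resampling and concentration in the Gaussian product space\<close>

interpretation Gs: prob_space Gspace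
  unfolding Gspace_def by (intro prob_space_PiM prob_space_normal_density) auto

lemma std_normal_prob: "prob_space std_normal_distribution"
  by (rule prob_space_normal_density) simp

lemma space_Gspace [simp]: "space Gspace = UNIV"
  by (simp add: Gspace_def space_PiM)

lemma measure_Gspace_UNIV [simp]: "measure Gspace UNIV = 1"
  using Gs.prob_space by simp

lemma sets_Gspace_cong: "sets Gspace = sets (PiM UNIV (\<lambda>_. borel))"
  unfolding Gspace_def by (intro sets_PiM_cong) auto

lemma measurable_component_Gspace [measurable]: "(\<lambda>\<omega>. \<omega> i) \<in> borel_measurable Gspace"
  unfolding measurable_cong_sets[OF sets_Gspace_cong refl] by measurable

lemma measurable_into_Gspace:
  assumes "\<And>i. (\<lambda>x. f x i) \<in> borel_measurable M"
  shows "f \<in> measurable M Gspace"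
  unfolding measurable_cong_sets[OF refl sets_Gspace_cong]
  by (rule measurable_PiM_single'[where f = "\<lambda>i x. f x i", simplified]) (use assms in auto)

lemma measurable_override [measurable]:
  "(\<lambda>p. override_on (fst p) (snd p) J) \<in> measurable (Gspace \<Otimes>\<^sub>M Gspace) Gspace"
proof (rule measurable_into_Gspace)
  fix i show "(\<lambda>x. override_on (fst x) (snd x) J i) \<in> borel_measurable (Gspace \<Otimes>\<^sub>M Gspace)"
    by (cases "i \<in> J") (simp_all add: override_on_def)
qed

lemma measurable_fun_upd_Gspace [measurable]:
  "(\<lambda>p. (fst p)(i := snd p)) \<in> measurable (Gspace \<Otimes>\<^sub>M borel) Gspace"
proof (rule measurable_into_Gspace)
  fix j show "(\<lambda>x. ((fst x)(i := snd x)) j) \<in> borel_measurable (Gspace \<Otimes>\<^sub>M borel)"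
    by (cases "j = i") simp_all
qed

text \<open>Replacing the coordinates in J by those of an independent copy preserves the product
  law: the probability of a finite cylinder factors into the coordinates outside J and those
  inside.\<close>

lemma distr_override: "distr (Gspace \<Otimes>\<^sub>M Gspace) Gspace (\<lambda>p. override_on (fst p) (snd p) J) = Gspace"
proof -
  interpret P: product_prob_space "\<lambda>_. std_normal_distribution" UNIV
    by (intro product_prob_spaceI std_normal_prob)
  interpret pair_prob_space Gspace Gspace ..
  have "Gspace = distr (Gspace \<Otimes>\<^sub>M Gspace) Gspace (\<lambda>p. override_on (fst p) (snd p) J)"
  proof (rule measure_eqI_PiM_infinite[where I = UNIV and M = "\<lambda>_. std_normal_distribution"])
    fix A :: "nat \<times> nat \<times> nat \<Rightarrow> real set" and F :: "(nat \<times> nat \<times> nat) set"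
    assume F: "finite F" and A: "\<And>i. i \<in> F \<Longrightarrow> A i \<in> sets std_normal_distribution"
    define E where "E F = prod_emb UNIV (\<lambda>_. std_normal_distribution) F (Pi\<^sub>E F A)" for F
    have E: "E F = {\<omega>. \<forall>i\<in>F. \<omega> i \<in> A i}" for F
      by (auto simp: E_def prod_emb_def space_PiM restrict_def PiE_def Pi_def extensional_def)
    have Em: "emeasure Gspace (E K) = (\<Prod>i\<in>K. emeasure std_normal_distribution (A i))"
      if "K \<subseteq> F" for K
      unfolding E_def Gspace_def using F A that
      by (intro P.emeasure_PiM_emb) (auto intro: finite_subset)
    have Es: "E K \<in> sets Gspace" if "K \<subseteq> F" for K
      unfolding E_def Gspace_def using F A that by (intro sets_PiM_I) (auto intro: finite_subset)
    have "emeasure (distr (Gspace \<Otimes>\<^sub>M Gspace) Gspace (\<lambda>p. override_on (fst p) (snd p) J)) (E F)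
      = emeasure (Gspace \<Otimes>\<^sub>M Gspace) ((\<lambda>p. override_on (fst p) (snd p) J) -` E F \<inter> space (Gspace \<Otimes>\<^sub>M Gspace))"
      by (intro emeasure_distr Es) auto
    also have "(\<lambda>p. override_on (fst p) (snd p) J) -` E F \<inter> space (Gspace \<Otimes>\<^sub>M Gspace) = E (F - J) \<times> E (F \<inter> J)"
      by (auto simp: E space_pair_measure override_on_def split: if_splits)
    also have "emeasure (Gspace \<Otimes>\<^sub>M Gspace) (E (F - J) \<times> E (F \<inter> J)) = emeasure Gspace (E (F - J)) * emeasure Gspace (E (F \<inter> J))"
      by (intro Gs.emeasure_pair_measure_Times Es) auto
    also have "\<dots> = (\<Prod>i\<in>F. emeasure std_normal_distribution (A i))"
      using F by (subst (1 2) Em) (auto simp: prod.Int_Diff[of F _ J] mult.commute)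
    finally show "emeasure Gspace (prod_emb UNIV (\<lambda>_. std_normal_distribution) F (Pi\<^sub>E F A)) =
      emeasure (distr (Gspace \<Otimes>\<^sub>M Gspace) Gspace (\<lambda>p. override_on (fst p) (snd p) J))
        (prod_emb UNIV (\<lambda>_. std_normal_distribution) F (Pi\<^sub>E F A))"
      using Em[of F] by (simp add: E_def)
  qed (simp_all only: sets_distr Gs.finite_measure_axioms, simp_all only: Gspace_def)
  then show ?thesis by simp
qed

text \<open>The tower property given the coordinates outside J. Conditional expectations are
  expressed as averages over an independent copy, so that Fubini takes the place of
  conditioning.\<close>

lemma integral_override:
  fixes F :: "_ \<Rightarrow> 'b :: {banach, second_countable_topology}"
  assumes F: "F \<in> borel_measurable Gspace" and bd: "\<And>\<omega>. norm (F \<omega>) \<le> B"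
  shows "(\<integral>\<omega>. F \<omega> \<partial>Gspace) = (\<integral>\<omega>. (\<integral>\<omega>'. F (override_on \<omega> \<omega>' J) \<partial>Gspace) \<partial>Gspace)"
proof -
  interpret PP: pair_prob_space Gspace Gspace ..
  note [measurable] = F
  have "(\<integral>\<omega>. F \<omega> \<partial>Gspace) = (\<integral>\<omega>. F \<omega> \<partial>distr (Gspace \<Otimes>\<^sub>M Gspace) Gspace (\<lambda>p. override_on (fst p) (snd p) J))"
    by (simp add: distr_override)
  also have "\<dots> = (\<integral>p. F (override_on (fst p) (snd p) J) \<partial>(Gspace \<Otimes>\<^sub>M Gspace))"
    by (intro integral_distr) auto
  also have "\<dots> = (\<integral>\<omega>. (\<integral>\<omega>'. F (override_on \<omega> \<omega>' J) \<partial>Gspace) \<partial>Gspace)"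
    by (subst PP.integral_fst'[symmetric])
      (auto intro!: PP.P.integrable_const_bound[of _ B] simp: bd)
  finally show ?thesis .
qed

lemma distr_component_Gspace: "distr Gspace std_normal_distribution (\<lambda>\<omega>. \<omega> i) = std_normal_distribution"
proof -
  interpret P: product_prob_space "\<lambda>_. std_normal_distribution" UNIV
    by (intro product_prob_spaceI std_normal_prob)
  show ?thesis unfolding Gspace_def by (rule P.PiM_component) simp
qed

lemma integral_fun_upd:
  fixes F :: "_ \<Rightarrow> 'b :: {banach, second_countable_topology}"
  assumes F: "F \<in> borel_measurable Gspace" and bd: "\<And>\<omega>. norm (F \<omega>) \<le> B"
  shows "(\<integral>\<omega>. F \<omega> \<partial>Gspace) = (\<integral>\<omega>. (\<integral>x. F (fun_upd \<omega> i x) \<partial>std_normal_distribution) \<partial>Gspace)"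
proof -
  note [measurable] = F
  have "(\<integral>\<omega>'. F (override_on \<omega> \<omega>' {i}) \<partial>Gspace) = (\<integral>x. F (fun_upd \<omega> i x) \<partial>std_normal_distribution)" for \<omega>
  proof -
    have [measurable]: "(\<lambda>x. F (fun_upd \<omega> i x)) \<in> borel_measurable borel"
    proof -
      have "(\<lambda>x. fun_upd \<omega> i x) \<in> measurable borel Gspace"
        by (rule measurable_into_Gspace) (auto simp: fun_upd_def)
      then show ?thesis by measurable
    qed
    have "(\<integral>x. F (fun_upd \<omega> i x) \<partial>std_normal_distribution)
      = (\<integral>x. F (fun_upd \<omega> i x) \<partial>distr Gspace std_normal_distribution (\<lambda>\<omega>. \<omega> i))"
      by (simp add: distr_component_Gspace)
    also have "\<dots> = (\<integral>\<omega>'. F (fun_upd \<omega> i (\<omega>' i)) \<partial>Gspace)"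
      by (rule integral_distr) auto
    also have "(\<lambda>\<omega>'. fun_upd \<omega> i (\<omega>' i)) = (\<lambda>\<omega>'. override_on \<omega> \<omega>' {i})"
      by (auto simp: override_on_def fun_eq_iff)
    then have "(\<integral>\<omega>'. F (fun_upd \<omega> i (\<omega>' i)) \<partial>Gspace) = (\<integral>\<omega>'. F (override_on \<omega> \<omega>' {i}) \<partial>Gspace)"
      by metis
    finally show ?thesis by simp
  qed
  then show ?thesis using integral_override[OF F bd, of "{i}"] by simp
qed

text \<open>Induction on the number of blocks. Averaging over the last block leaves a function with
  the same bounded differences that depends on the other blocks only; the fluctuation within that
  block is handled by Hoeffding's lemma, which supplies the factor exp (l^2 c^2 / 8).\<close>

lemma McDiarmid_exp:
  assumes "F \<in> borel_measurable Gspace" and "\<And>\<omega>. \<bar>F \<omega>\<bar> \<le> B"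
    and "\<And>k \<omega> \<omega>'. k < m \<Longrightarrow> (\<And>i. i \<notin> J k \<Longrightarrow> \<omega> i = \<omega>' i) \<Longrightarrow> \<bar>F \<omega> - F \<omega>'\<bar> \<le> c"
    and "\<And>\<omega> \<omega>'. (\<And>k i. k < m \<Longrightarrow> i \<in> J k \<Longrightarrow> \<omega> i = \<omega>' i) \<Longrightarrow> F \<omega> = F \<omega>'"
    and l: "0 < l"
  shows "(\<integral>\<omega>. exp (l * F \<omega>) \<partial>Gspace) \<le> exp (real m * (l\<^sup>2 * c\<^sup>2 / 8)) * exp (l * (\<integral>\<omega>. F \<omega> \<partial>Gspace))"
  using assms(1-4)
proof (induction m arbitrary: F)
  case 0
  have "F \<omega> = F (\<lambda>_. 0)" for \<omega> using 0(4) by auto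
  then obtain y where "F = (\<lambda>_. y)" by blast
  then show ?case by (simp add: Gs.prob_space)
next
  case (Suc m)
  note [measurable] = Suc.prems(1)
  define G where "G \<omega> = (\<integral>\<omega>'. F (override_on \<omega> \<omega>' (J m)) \<partial>Gspace)" for \<omega>
  have [measurable]: "(\<lambda>\<omega>'. override_on \<omega> \<omega>' (J m)) \<in> measurable Gspace Gspace" for \<omega>
    by (rule measurable_into_Gspace) (auto simp: override_on_def)
  have int: "integrable Gspace (\<lambda>\<omega>'. F (override_on \<omega> \<omega>' (J m)))" for \<omega>
    by (rule Gs.integrable_const_bound[of _ B]) (auto simp: Suc.prems(2))
  have Gm [measurable]: "G \<in> borel_measurable Gspace"
    unfolding G_def[abs_def]
    by (rule Gs.borel_measurable_lebesgue_integral) (simp add: case_prod_beta)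
  have Gb: "\<bar>G \<omega>\<bar> \<le> B" for \<omega>
  proof -
    have "norm (G \<omega>) \<le> (\<integral>\<omega>'. norm (F (override_on \<omega> \<omega>' (J m))) \<partial>Gspace)"
      unfolding G_def by (rule integral_norm_bound)
    also have "\<dots> \<le> (\<integral>\<omega>'. B \<partial>Gspace)"
      using int by (intro integral_mono integrable_norm) (auto simp: Suc.prems(2))
    finally show ?thesis by (simp add: Gs.prob_space)
  qed
  have Gd: "\<bar>G \<omega> - G \<omega>'\<bar> \<le> c" if "k < m" "\<And>i. i \<notin> J k \<Longrightarrow> \<omega> i = \<omega>' i" for k \<omega> \<omega>'
  proof -
    have "norm (G \<omega> - G \<omega>') = norm (\<integral>x. F (override_on \<omega> x (J m)) - F (override_on \<omega>' x (J m)) \<partial>Gspace)"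
      unfolding G_def by (simp add: int)
    also have "\<dots> \<le> (\<integral>x. norm (F (override_on \<omega> x (J m)) - F (override_on \<omega>' x (J m))) \<partial>Gspace)"
      by (rule integral_norm_bound)
    also have "\<dots> \<le> (\<integral>x. c \<partial>Gspace)"
    proof (intro integral_mono integrable_norm)
      fix x show "norm (F (override_on \<omega> x (J m)) - F (override_on \<omega>' x (J m))) \<le> c"
        using Suc.prems(3)[of k "override_on \<omega> x (J m)" "override_on \<omega>' x (J m)"] that
        by (auto simp: override_on_def)
    qed (auto intro: int)
    finally show ?thesis by (simp add: Gs.prob_space)
  qed
  have Gdep: "G \<omega> = G \<omega>'" if "\<And>k i. k < m \<Longrightarrow> i \<in> J k \<Longrightarrow> \<omega> i = \<omega>' i" for \<omega> \<omega>'
  proof -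
    have "F (override_on \<omega> x (J m)) = F (override_on \<omega>' x (J m))" for x
      using that by (intro Suc.prems(4)) (auto simp: override_on_def less_Suc_eq)
    then show ?thesis by (simp add: G_def)
  qed
  have one: "(\<integral>\<omega>'. exp (l * F (override_on \<omega> \<omega>' (J m))) \<partial>Gspace) \<le> exp (l\<^sup>2 * c\<^sup>2 / 8) * exp (l * G \<omega>)" for \<omega>
  proof -
    define f where "f \<omega>' = F (override_on \<omega> \<omega>' (J m))" for \<omega>'
    \<comment> \<open>The hypothesis bounds an oscillation. Starting from the infimum turns it into
      the interval [a, a + c] that Hoeffding's lemma asks for.\<close>
    define a where "a = Inf (range f)"
    have bb: "bdd_below (range f)"
      by (rule bdd_belowI[of _ "- B"]) (use Suc.prems(2) in \<open>auto simp: f_def abs_le_iff minus_le_iff\<close>)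
    have ab: "a \<le> f x \<and> f x \<le> a + c" for x
    proof
      show "a \<le> f x" unfolding a_def by (rule cInf_lower[OF _ bb]) simp
      have "f x - c \<le> a" unfolding a_def
      proof (rule cInf_greatest)
        fix y assume "y \<in> range f"
        then obtain x' where "y = f x'" by auto
        moreover have "\<bar>f x - f x'\<bar> \<le> c" unfolding f_def
          by (rule Suc.prems(3)[of m]) (auto simp: override_on_def)
        ultimately show "f x - c \<le> y" by auto
      qed simp
      then show "f x \<le> a + c" by simp
    qed
    have [measurable]: "f \<in> borel_measurable Gspace" unfolding f_def[abs_def] by measurable
    interpret I: interval_bounded_random_variable Gspace f a "a + c"
    proof
      show "f \<in> borel_measurable Gspace" by fact
      show "AE x in Gspace. f x \<in> {a..a + c}" by (intro AE_I2) (simp add: ab)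
    qed
    have eG: "(\<integral>x. f x \<partial>Gspace) = G \<omega>" by (simp add: f_def[abs_def] G_def)
    have inte: "integrable Gspace (\<lambda>x. exp (l * (f x - G \<omega>)))"
    proof (rule Gs.integrable_const_bound[of _ "exp (l * (a + c - G \<omega>))"])
      show "AE x in Gspace. norm (exp (l * (f x - G \<omega>))) \<le> exp (l * (a + c - G \<omega>))"
        using ab l by (intro AE_I2) auto
    qed measurable
    have "(\<integral>\<^sup>+ x. exp (l * (f x - G \<omega>)) \<partial>Gspace) \<le> ennreal (exp (l\<^sup>2 * c\<^sup>2 / 8))"
      using I.Hoeffdings_lemma_nn_integral[OF l] by (simp add: eG)
    then have "(\<integral>x. exp (l * (f x - G \<omega>)) \<partial>Gspace) \<le> exp (l\<^sup>2 * c\<^sup>2 / 8)"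
      by (subst (asm) nn_integral_eq_integral[OF inte]) auto
    then have "(\<integral>x. exp (l * (f x - G \<omega>)) \<partial>Gspace) * exp (l * G \<omega>) \<le> exp (l\<^sup>2 * c\<^sup>2 / 8) * exp (l * G \<omega>)"
      by (intro mult_right_mono) auto
    also have "(\<integral>x. exp (l * (f x - G \<omega>)) \<partial>Gspace) * exp (l * G \<omega>) = (\<integral>x. exp (l * f x) \<partial>Gspace)"
      by (subst integral_mult_left_zero[symmetric])
        (intro Bochner_Integration.integral_cong, auto simp: exp_add[symmetric] algebra_simps)
    finally show ?thesis by (simp add: f_def)
  qed
  have eF: "norm (exp (l * F \<omega>)) \<le> exp (l * B)" for \<omega>
    using Suc.prems(2)[of \<omega>] l by auto
  have "(\<integral>\<omega>. exp (l * F \<omega>) \<partial>Gspace) = (\<integral>\<omega>. (\<integral>\<omega>'. exp (l * F (override_on \<omega> \<omega>' (J m))) \<partial>Gspace) \<partial>Gspace)"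
    by (rule integral_override[OF _ eF]) simp
  also have "\<dots> \<le> (\<integral>\<omega>. exp (l\<^sup>2 * c\<^sup>2 / 8) * exp (l * G \<omega>) \<partial>Gspace)"
  proof (intro integral_mono one)
    show "integrable Gspace (\<lambda>\<omega>. exp (l\<^sup>2 * c\<^sup>2 / 8) * exp (l * G \<omega>))"
      by (intro integrable_mult_right Gs.integrable_const_bound[of _ "exp (l * B)"] AE_I2)
        (use Gb l in \<open>auto simp: abs_le_iff\<close>)
    show "integrable Gspace (\<lambda>\<omega>. \<integral>\<omega>'. exp (l * F (override_on \<omega> \<omega>' (J m))) \<partial>Gspace)"
    proof (rule Gs.integrable_const_bound[of _ "exp (l\<^sup>2 * c\<^sup>2 / 8) * exp (l * B)"])
      have "\<bar>\<integral>\<omega>'. exp (l * F (override_on \<omega> \<omega>' (J m))) \<partial>Gspace\<bar> \<le> exp (l\<^sup>2 * c\<^sup>2 / 8) * exp (l * B)" for \<omega>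
      proof -
        have "0 \<le> (\<integral>\<omega>'. exp (l * F (override_on \<omega> \<omega>' (J m))) \<partial>Gspace)"
          by (rule integral_nonneg_AE) auto
        moreover have "exp (l\<^sup>2 * c\<^sup>2 / 8) * exp (l * G \<omega>) \<le> exp (l\<^sup>2 * c\<^sup>2 / 8) * exp (l * B)"
          using Gb[of \<omega>] l by auto
        ultimately show ?thesis using one[of \<omega>] by linarith
      qed
      then show "AE \<omega> in Gspace. norm (\<integral>\<omega>'. exp (l * F (override_on \<omega> \<omega>' (J m))) \<partial>Gspace) \<le> exp (l\<^sup>2 * c\<^sup>2 / 8) * exp (l * B)"
        by (intro AE_I2) simp
    next
      show "(\<lambda>\<omega>. \<integral>\<omega>'. exp (l * F (override_on \<omega> \<omega>' (J m))) \<partial>Gspace) \<in> borel_measurable Gspace"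
        by (rule Gs.borel_measurable_lebesgue_integral) (simp add: case_prod_beta)
    qed
  qed
  also have "\<dots> = exp (l\<^sup>2 * c\<^sup>2 / 8) * (\<integral>\<omega>. exp (l * G \<omega>) \<partial>Gspace)"
    by simp
  also have "\<dots> \<le> exp (l\<^sup>2 * c\<^sup>2 / 8) * (exp (real m * (l\<^sup>2 * c\<^sup>2 / 8)) * exp (l * (\<integral>\<omega>. G \<omega> \<partial>Gspace)))"
    by (intro mult_left_mono Suc.IH Gm Gb Gd Gdep) auto
  also have "(\<integral>\<omega>. G \<omega> \<partial>Gspace) = (\<integral>\<omega>. F \<omega> \<partial>Gspace)"
    unfolding G_def by (rule integral_override[symmetric, of _ B]) (auto simp: Suc.prems(2))
  finally show ?case by (simp add: exp_add[symmetric] algebra_simps add_divide_distrib)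
qed

lemma McDiarmid:
  assumes F: "F \<in> borel_measurable Gspace" and B: "\<And>\<omega>. \<bar>F \<omega>\<bar> \<le> B"
    and diff: "\<And>k \<omega> \<omega>'. k < m \<Longrightarrow> (\<And>i. i \<notin> J k \<Longrightarrow> \<omega> i = \<omega>' i) \<Longrightarrow> \<bar>F \<omega> - F \<omega>'\<bar> \<le> c"
    and dep: "\<And>\<omega> \<omega>'. (\<And>k i. k < m \<Longrightarrow> i \<in> J k \<Longrightarrow> \<omega> i = \<omega>' i) \<Longrightarrow> F \<omega> = F \<omega>'"
    and s: "0 < s" and c: "0 < c" and m: "0 < m"
  shows "measure Gspace {\<omega>. F \<omega> \<ge> (\<integral>\<omega>. F \<omega> \<partial>Gspace) + s} \<le> exp (- 2 * s\<^sup>2 / (real m * c\<^sup>2))"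
proof -
  \<comment> \<open>The minimizer of m l^2 c^2 / 8 - l s, the exponent of the Chernoff
    bound.\<close>
  define l where "l = 4 * s / (real m * c\<^sup>2)"
  have l: "0 < l" using s c m by (simp add: l_def)
  define E where "E = (\<integral>\<omega>. F \<omega> \<partial>Gspace)"
  note [measurable] = F
  have inte: "integrable Gspace (\<lambda>\<omega>. exp (l * F \<omega>))"
    by (rule Gs.integrable_const_bound[of _ "exp (l * B)"]) (use B l in \<open>auto simp: abs_le_iff\<close>)
  have "exp (l * (E + s)) * measure Gspace {\<omega>. F \<omega> \<ge> E + s} \<le> (\<integral>\<omega>. exp (l * F \<omega>) \<partial>Gspace)"
  proof -
    have "measure Gspace {\<omega>\<in>space Gspace. exp (l * F \<omega>) \<ge> exp (l * (E + s))} \<le> (\<integral>\<omega>. exp (l * F \<omega>) \<partial>Gspace) / exp (l * (E + s))"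
      by (rule integral_Markov_inequality_measure[OF inte, where A = "{}"]) auto
    moreover have "{\<omega>\<in>space Gspace. exp (l * F \<omega>) \<ge> exp (l * (E + s))} = {\<omega>. F \<omega> \<ge> E + s}"
      using l by simp
    ultimately show ?thesis by (simp add: field_simps)
  qed
  also have "\<dots> \<le> exp (real m * (l\<^sup>2 * c\<^sup>2 / 8)) * exp (l * E)"
    unfolding E_def by (rule McDiarmid_exp[OF F B diff dep l])
  finally have "measure Gspace {\<omega>. F \<omega> \<ge> E + s} \<le> exp (real m * (l\<^sup>2 * c\<^sup>2 / 8)) * exp (l * E) / exp (l * (E + s))"
    by (simp add: field_simps)
  also have "\<dots> = exp (real m * (l\<^sup>2 * c\<^sup>2 / 8) - l * s)"
    by (simp add: exp_add[symmetric] exp_diff[symmetric] algebra_simps)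
  also have "real m * (l\<^sup>2 * c\<^sup>2 / 8) - l * s = - 2 * s\<^sup>2 / (real m * c\<^sup>2)"
    using c m by (simp add: l_def field_simps power2_eq_square)
  finally show ?thesis by (simp add: E_def)
qed

text \<open>As a rule of the measurability prover this matches every function application.\<close>
declare measurable_component_Gspace [measurable del]

section \<open>Gaussian integration by parts\<close>

lemma std_normal_IBP:
  fixes f f' :: "real \<Rightarrow> complex"
  assumes der: "\<And>x. (f has_vector_derivative f' x) (at x)"
    and f: "\<And>x. cmod (f x) \<le> B" and f': "\<And>x. cmod (f' x) \<le> B"
    and m [measurable]: "f' \<in> borel_measurable borel"
  shows "(\<integral>x. of_real x * f x \<partial>std_normal_distribution) = (\<integral>x. f' x \<partial>std_normal_distribution)"
proof -
  let ?g = std_normal_density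
  have "continuous_on UNIV f"
    using der by (intro continuous_at_imp_continuous_on ballI has_vector_derivative_continuous) auto
  then have [measurable]: "f \<in> borel_measurable borel" by (rule borel_measurable_continuous_onI)
  \<comment> \<open>The derivative of the density times f, because the density g satisfies g' = - x
    g. Its integral over [-n, n] is a boundary term, which vanishes in the limit since f is
    bounded.\<close>
  define h where "h x = ?g x *\<^sub>R (f' x - of_real x * f x)" for x
  have i1: "integrable lborel (\<lambda>x. ?g x *\<^sub>R f' x)"
  proof (rule Bochner_Integration.integrable_bound)
    show "integrable lborel (\<lambda>x. B * ?g x)" by simp
    show "AE x in lborel. norm (?g x *\<^sub>R f' x) \<le> norm (B * ?g x)"
      using f' by (intro AE_I2) (auto simp: abs_mult mult.commute[of B] intro!: mult_mono order_trans[OF _ abs_ge_self])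
  qed measurable
  have i2: "integrable lborel (\<lambda>x. ?g x *\<^sub>R (of_real x * f x))"
  proof (rule Bochner_Integration.integrable_bound)
    show "integrable lborel (\<lambda>x. B * (?g x * \<bar>x\<bar> ^ 1))"
      by (intro integrable_mult_right integrable_std_normal_moment_abs)
    show "AE x in lborel. norm (?g x *\<^sub>R (of_real x * f x)) \<le> norm (B * (?g x * \<bar>x\<bar> ^ 1))"
    proof (intro AE_I2)
      fix x
      have "?g x * \<bar>x\<bar> * cmod (f x) \<le> ?g x * \<bar>x\<bar> * \<bar>B\<bar>"
        using f[of x] by (intro mult_left_mono) auto
      then show "norm (?g x *\<^sub>R (of_real x * f x)) \<le> norm (B * (?g x * \<bar>x\<bar> ^ 1))"
        by (simp add: norm_mult abs_mult algebra_simps)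
    qed
  qed measurable
  have ih: "integrable lborel h"
    unfolding h_def scaleR_diff_right by (intro Bochner_Integration.integrable_diff i1 i2)
  have dg: "(?g has_real_derivative - x * ?g x) (at x)" for x
    unfolding std_normal_density_def by (auto intro!: derivative_eq_intros simp: field_simps)
  have dF: "((\<lambda>x. ?g x *\<^sub>R f x) has_vector_derivative h x) (at x)" for x
    using has_vector_derivative_scaleR[OF dg der, of x]
    by (simp add: h_def scaleR_conv_of_real algebra_simps)
  have lim0: "((\<lambda>x. ?g x *\<^sub>R f x) \<longlongrightarrow> 0) F" if "(?g \<longlongrightarrow> 0) F" for F
  proof (rule Lim_null_comparison)
    show "\<forall>\<^sub>F x in F. norm (?g x *\<^sub>R f x) \<le> ?g x * B"
      using f by (intro always_eventually allI) (auto intro!: mult_left_mono)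
    show "((\<lambda>x. ?g x * B) \<longlongrightarrow> 0) F" using tendsto_mult_right[OF that, of B] by (simp add: mult.commute)
  qed
  have gt: "(?g \<longlongrightarrow> 0) at_top" unfolding std_normal_density_def by real_asymp
  have gb: "(?g \<longlongrightarrow> 0) at_bot" unfolding std_normal_density_def by real_asymp
  have seq: "(\<lambda>n. integral {- real n..real n} h) \<longlonglongrightarrow> (\<integral>x. h x \<partial>lborel)"
  proof -
    have "(\<lambda>n. LINT x:{- real n..real n}|lborel. h x) \<longlonglongrightarrow> (LINT x:(\<Union>n. {- real n..real n})|lborel. h x)"
    proof (rule set_integral_cont_up)
      show "incseq (\<lambda>n. {- real n..real n})" by (intro incseq_SucI) auto
      show "set_integrable lborel (\<Union>n. {- real n..real n}) h"
        unfolding set_integrable_def by (rule integrable_mult_indicator[OF _ ih]) simp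
    qed auto
    moreover have "(\<Union>n. {- real n..real n}) = UNIV"
    proof -
      have "x \<in> {- real (nat \<lceil>\<bar>x\<bar>\<rceil>)..real (nat \<lceil>\<bar>x\<bar>\<rceil>)}" for x
        using real_nat_ceiling_ge[of "\<bar>x\<bar>"] unfolding atLeastAtMost_iff by linarith
      then show ?thesis by blast
    qed
    moreover have "(LINT x:{- real n..real n}|lborel. h x) = integral {- real n..real n} h" for n
      by (rule set_borel_integral_eq_integral(2))
        (unfold set_integrable_def, rule integrable_mult_indicator[OF _ ih], simp)
    ultimately show ?thesis by (simp add: set_lebesgue_integral_def)
  qed
  moreover have "integral {- real n..real n} h = ?g (real n) *\<^sub>R f (real n) - ?g (- real n) *\<^sub>R f (- real n)" for n
    by (intro integral_unique fundamental_theorem_of_calculus)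
      (auto intro: has_vector_derivative_at_within dF)
  moreover have "(\<lambda>n. ?g (real n) *\<^sub>R f (real n) - ?g (- real n) *\<^sub>R f (- real n)) \<longlonglongrightarrow> 0 - 0"
  proof (intro tendsto_diff)
    show "(\<lambda>n. ?g (real n) *\<^sub>R f (real n)) \<longlonglongrightarrow> 0"
      by (rule filterlim_compose[OF lim0[OF gt] filterlim_real_sequentially])
    have "filterlim (\<lambda>n. - real n) at_bot sequentially"
      using filterlim_real_sequentially by (simp add: filterlim_uminus_at_bot)
    then show "(\<lambda>n. ?g (- real n) *\<^sub>R f (- real n)) \<longlonglongrightarrow> 0"
      by (rule filterlim_compose[OF lim0[OF gb]])
  qed
  ultimately have "(\<integral>x. h x \<partial>lborel) = 0" by (auto dest: LIMSEQ_unique)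
  moreover have "(\<integral>x. h x \<partial>lborel) = (\<integral>x. ?g x *\<^sub>R f' x \<partial>lborel) - (\<integral>x. ?g x *\<^sub>R (of_real x * f x) \<partial>lborel)"
    unfolding h_def scaleR_diff_right by (rule Bochner_Integration.integral_diff[OF i1 i2])
  ultimately show ?thesis
    by (subst (1 2) integral_density) auto
qed

lemma measurable_fun_upd_section [measurable]:
  "(\<lambda>x. fun_upd \<omega> i x) \<in> measurable borel Gspace"
  by (rule measurable_into_Gspace) (auto simp: fun_upd_def)

text \<open>The factor \<omega> i is unbounded, so the resampling identity for bounded functions
  does not apply to the integrand. It is applied to indicators instead, to identify the law of the
  updated point; integrability under that law then justifies Fubini, and the one-dimensional formula
  applies to the inner integral.\<close>

lemma Gspace_IBP:
  fixes F D :: "(nat \<times> nat \<times> nat \<Rightarrow> real) \<Rightarrow> complex"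
  assumes F [measurable]: "F \<in> borel_measurable Gspace" and D [measurable]: "D \<in> borel_measurable Gspace"
    and bF: "\<And>\<omega>. cmod (F \<omega>) \<le> B" and bD: "\<And>\<omega>. cmod (D \<omega>) \<le> B"
    and der: "\<And>\<omega> x. ((\<lambda>x. F (fun_upd \<omega> i x)) has_vector_derivative D (fun_upd \<omega> i x)) (at x)"
  shows "(\<integral>\<omega>. of_real (\<omega> i) * F \<omega> \<partial>Gspace) = (\<integral>\<omega>. D \<omega> \<partial>Gspace)"
    and "integrable Gspace (\<lambda>\<omega>. of_real (\<omega> i) * F \<omega>)"
proof -
  note [measurable] = measurable_component_Gspace[of i]
  interpret PP: pair_prob_space Gspace std_normal_distribution
    by (intro pair_prob_space.intro pair_sigma_finite.intro prob_space_imp_sigma_finite std_normal_prob Gs.prob_space_axioms)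
  let ?n = std_normal_distribution
  have "integrable ?n (\<lambda>x. \<bar>x\<bar>)"
    using integrable_std_normal_moment_abs[of 1] by (subst integrable_density) auto
  then have iabs: "integrable Gspace (\<lambda>\<omega>. \<bar>\<omega> i\<bar>)"
    by (subst (asm) distr_component_Gspace[of i, symmetric], subst (asm) integrable_distr_eq) auto
  show int: "integrable Gspace (\<lambda>\<omega>. of_real (\<omega> i) * F \<omega>)"
  proof (rule Bochner_Integration.integrable_bound)
    show "integrable Gspace (\<lambda>\<omega>. B * \<bar>\<omega> i\<bar>)" using iabs by simp
    show "AE \<omega> in Gspace. norm (of_real (\<omega> i) * F \<omega>) \<le> norm (B * \<bar>\<omega> i\<bar>)"
    proof (intro AE_I2)
      fix \<omega>
      have "\<bar>\<omega> i\<bar> * cmod (F \<omega>) \<le> \<bar>\<omega> i\<bar> * \<bar>B\<bar>" using bF[of \<omega>] by (intro mult_left_mono) auto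
      then show "norm (of_real (\<omega> i) * F \<omega>) \<le> norm (B * \<bar>\<omega> i\<bar>)"
        by (simp add: norm_mult abs_mult mult.commute)
    qed
  qed measurable
  have dist: "distr (Gspace \<Otimes>\<^sub>M ?n) Gspace (\<lambda>p. (fst p)(i := snd p)) = Gspace"
  proof (rule measure_eqI)
    show "sets (distr (Gspace \<Otimes>\<^sub>M ?n) Gspace (\<lambda>p. (fst p)(i := snd p))) = sets Gspace" by simp
    fix A assume "A \<in> sets (distr (Gspace \<Otimes>\<^sub>M ?n) Gspace (\<lambda>p. (fst p)(i := snd p)))"
    then have A [measurable]: "A \<in> sets Gspace" by simp
    have m: "(\<lambda>p. (fst p)(i := snd p)) \<in> measurable (Gspace \<Otimes>\<^sub>M ?n) Gspace"
      using measurable_fun_upd_Gspace by (simp cong: measurable_cong_sets)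
    have "measure (distr (Gspace \<Otimes>\<^sub>M ?n) Gspace (\<lambda>p. (fst p)(i := snd p))) A
      = (\<integral>\<omega>. indicator A \<omega> \<partial>distr (Gspace \<Otimes>\<^sub>M ?n) Gspace (\<lambda>p. (fst p)(i := snd p)))"
      by simp
    also have "\<dots> = (\<integral>p. indicator A ((fst p)(i := snd p)) \<partial>(Gspace \<Otimes>\<^sub>M ?n))"
      by (rule integral_distr[OF m]) simp
    also have "\<dots> = (\<integral>\<omega>. (\<integral>x. indicator A (fun_upd \<omega> i x) \<partial>?n) \<partial>Gspace)"
      by (subst PP.integral_fst'[symmetric])
        (auto intro!: PP.P.integrable_const_bound[of _ 1] measurable_compose[OF m] simp: indicator_def)
    also have "\<dots> = (\<integral>\<omega>. indicator A \<omega> \<partial>Gspace)"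
      by (rule integral_fun_upd[symmetric, of _ 1]) (auto simp: indicator_def)
    finally have "measure (distr (Gspace \<Otimes>\<^sub>M ?n) Gspace (\<lambda>p. (fst p)(i := snd p))) A = measure Gspace A" by simp
    note eq = this
    interpret Q: prob_space "distr (Gspace \<Otimes>\<^sub>M ?n) Gspace (\<lambda>p. (fst p)(i := snd p))"
      by (rule PP.P.prob_space_distr[OF m])
    from eq show "emeasure (distr (Gspace \<Otimes>\<^sub>M ?n) Gspace (\<lambda>p. (fst p)(i := snd p))) A = emeasure Gspace A"
      by (simp add: Q.emeasure_eq_measure Gs.emeasure_eq_measure)
  qed
  have m: "(\<lambda>p. (fst p)(i := snd p)) \<in> measurable (Gspace \<Otimes>\<^sub>M ?n) Gspace"
    using measurable_fun_upd_Gspace by (simp cong: measurable_cong_sets)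
  have int2: "integrable (Gspace \<Otimes>\<^sub>M ?n) (\<lambda>p. of_real (((fst p)(i := snd p)) i) * F ((fst p)(i := snd p)))"
    using int by (subst (asm) dist[symmetric], subst (asm) integrable_distr_eq[OF m]) auto
  have "(\<integral>\<omega>. of_real (\<omega> i) * F \<omega> \<partial>Gspace)
    = (\<integral>p. of_real (((fst p)(i := snd p)) i) * F ((fst p)(i := snd p)) \<partial>(Gspace \<Otimes>\<^sub>M ?n))"
    by (subst dist[symmetric], rule integral_distr[OF m]) simp
  also have "\<dots> = (\<integral>\<omega>. (\<integral>x. of_real x * F (fun_upd \<omega> i x) \<partial>?n) \<partial>Gspace)"
    by (subst PP.integral_fst'[symmetric, OF int2]) simp
  also have "\<dots> = (\<integral>\<omega>. (\<integral>x. D (fun_upd \<omega> i x) \<partial>?n) \<partial>Gspace)"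
    by (intro Bochner_Integration.integral_cong refl std_normal_IBP[OF der bF bD]) measurable
  also have "\<dots> = (\<integral>\<omega>. D \<omega> \<partial>Gspace)"
    by (rule integral_fun_upd[symmetric, OF D bD])
  finally show "(\<integral>\<omega>. of_real (\<omega> i) * F \<omega> \<partial>Gspace) = (\<integral>\<omega>. D \<omega> \<partial>Gspace)" .
qed

subsection \<open>Wegner estimate and exponential tails\<close>

text \<open>An affine substitution in the integral of 1 / (1 + y^2). The factor sqrt 2 is the
  standard deviation of a diagonal entry of level 0.\<close>

lemma Cauchy_density_integral:
  fixes a b :: real
  assumes b: "0 < b"
  shows "integrable lborel (\<lambda>x. b / ((a + sqrt 2 * x)\<^sup>2 + b\<^sup>2))"
    and "(\<integral>x. b / ((a + sqrt 2 * x)\<^sup>2 + b\<^sup>2) \<partial>lborel) = pi / sqrt 2"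
proof -
  let ?f = "\<lambda>y::real. inverse (1 + y\<^sup>2)"
  have i: "integrable lborel ?f"
    using integrable_inverse_1_plus_square by (simp add: set_integrable_def)
  have I: "(\<integral>y. ?f y \<partial>lborel) = pi"
    using LBINT_inverse_1_plus_square
    by (simp add: interval_lebesgue_integral_def set_lebesgue_integral_def)
  have c: "sqrt 2 / b \<noteq> 0" using b by simp
  have e: "b / ((a + sqrt 2 * x)\<^sup>2 + b\<^sup>2) = (1 / b) * ?f (a / b + (sqrt 2 / b) * x)" for x
  proof -
    have eq: "a / b + (sqrt 2 / b) * x = (a + sqrt 2 * x) / b" by (simp add: add_divide_distrib)
    have "1 + ((a + sqrt 2 * x) / b)\<^sup>2 = ((a + sqrt 2 * x)\<^sup>2 + b\<^sup>2) / b\<^sup>2"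
      using b by (simp only: power_divide) (simp add: add_divide_distrib)
    then show ?thesis unfolding eq using b by (simp add: power2_eq_square)
  qed
  show "integrable lborel (\<lambda>x. b / ((a + sqrt 2 * x)\<^sup>2 + b\<^sup>2))"
    unfolding e by (intro integrable_mult_right lborel_integrable_real_affine i c)
  have "pi = \<bar>sqrt 2 / b\<bar> *\<^sub>R (\<integral>x. ?f (a / b + (sqrt 2 / b) * x) \<partial>lborel)"
    using lborel_integral_real_affine[OF c, of ?f "a / b"] by (simp add: I)
  then show "(\<integral>x. b / ((a + sqrt 2 * x)\<^sup>2 + b\<^sup>2) \<partial>lborel) = pi / sqrt 2"
    unfolding e integral_mult_right_zero using b by (simp add: field_simps del: inverse_eq_divide)
qed

text \<open>The hypothesis says 1 / g x = 1 / \<beta> + sqrt 2 x, so Im g is a Cauchy kernel in x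
  whose total mass does not depend on \<beta>. The Gaussian density is at most 1.\<close>

lemma Wegner_1d:
  assumes \<beta>: "0 < Im \<beta>"
    and g: "\<And>x. g x * (1 + of_real (sqrt 2 * x) * \<beta>) = \<beta>"
  shows "integrable std_normal_distribution (\<lambda>x. Im (g x))"
    and "(\<integral>x. Im (g x) \<partial>std_normal_distribution) \<le> pi"
proof -
  define a where "a = Re (1 / \<beta>)"
  define b where "b = - Im (1 / \<beta>)"
  have nz: "\<beta> \<noteq> 0" using \<beta> by auto
  have b: "0 < b" using \<beta> nz unfolding b_def
    by (simp add: Im_divide cmod_power2[symmetric] zero_less_divide_iff)
  have ab: "1 / \<beta> = Complex a (- b)" by (simp add: a_def b_def complex_eq_iff)
  have Im: "Im (g x) = b / ((a + sqrt 2 * x)\<^sup>2 + b\<^sup>2)" for x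
  proof -
    have "g x * (1 / \<beta> + of_real (sqrt 2 * x)) = 1"
      using g[of x] nz by (simp add: field_simps)
    then have "g x = 1 / (1 / \<beta> + of_real (sqrt 2 * x))"
      by (metis mult_zero_right zero_neq_one nonzero_eq_divide_eq)
    also have "1 / \<beta> + of_real (sqrt 2 * x) = Complex (a + sqrt 2 * x) (- b)"
      unfolding ab by (simp add: complex_eq_iff)
    finally show ?thesis by (simp add: Im_divide)
  qed
  let ?h = "\<lambda>x. b / ((a + sqrt 2 * x)\<^sup>2 + b\<^sup>2)"
  have le1: "std_normal_density x \<le> 1" for x
  proof -
    have "1 \<le> sqrt (2 * pi)" using pi_gt3 by simp
    then have "1 / sqrt (2 * pi) \<le> 1" by simp
    then have "(1 / sqrt (2 * pi)) * exp (- x\<^sup>2 / 2) \<le> 1 * 1" by (intro mult_mono) auto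
    then show ?thesis unfolding std_normal_density_def by simp
  qed
  have h0: "0 \<le> ?h x" for x using b by simp
  have i: "integrable lborel (\<lambda>x. std_normal_density x * ?h x)"
  proof (rule Bochner_Integration.integrable_bound[OF Cauchy_density_integral(1)[OF b, of a]])
    show "AE x in lborel. norm (std_normal_density x * ?h x) \<le> norm (?h x)"
      unfolding real_norm_def abs_mult abs_of_nonneg[OF h0] abs_of_nonneg[OF normal_density_nonneg]
      using mult_right_mono[OF le1 h0] by (intro AE_I2) simp
  qed measurable
  show "integrable std_normal_distribution (\<lambda>x. Im (g x))"
    unfolding Im using i by (subst integrable_density) auto
  have "(\<integral>x. Im (g x) \<partial>std_normal_distribution) = (\<integral>x. std_normal_density x * ?h x \<partial>lborel)"
    unfolding Im by (subst integral_density) auto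
  also have "\<dots> \<le> (\<integral>x. ?h x \<partial>lborel)"
    using mult_right_mono[OF le1 h0] by (intro integral_mono i Cauchy_density_integral(1)[OF b]) simp
  also have "\<dots> \<le> pi" unfolding Cauchy_density_integral(2)[OF b] by (simp add: field_simps)
  finally show "(\<integral>x. Im (g x) \<partial>std_normal_distribution) \<le> pi" .
qed

text \<open>A single coordinate changes \<open>T\<close> by at most one, so in \<open>E (X\<^sub>k exp T)\<close> the exponential can be frozen
  at the value of coordinate \<open>k\<close> equal to \<open>0\<close> before integrating \<open>X\<^sub>k\<close> over it. This gives
  \<open>E (T exp T) \<le> M e\<^sup>2 E (exp T)\<close>, the Poisson-type estimate behind the exponential tail.\<close>
lemma exponential_tail:
  fixes X :: "nat \<Rightarrow> (nat \<times> nat \<times> nat \<Rightarrow> real) \<Rightarrow> real" and m :: nat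
  defines "T \<equiv> \<lambda>\<omega>. \<Sum>k<m. X k \<omega>"
  assumes meas: "\<And>k. k < m \<Longrightarrow> X k \<in> borel_measurable Gspace"
    and X0: "\<And>k \<omega>. k < m \<Longrightarrow> 0 \<le> X k \<omega>" and X1: "\<And>k \<omega>. k < m \<Longrightarrow> X k \<omega> \<le> 1"
    and one: "\<And>k \<omega> x y. k < m \<Longrightarrow> \<bar>T (fun_upd \<omega> (i k) x) - T (fun_upd \<omega> (i k) y)\<bar> \<le> 1"
    and weg: "\<And>k \<omega>. k < m \<Longrightarrow> (\<integral>x. X k (fun_upd \<omega> (i k) x) \<partial>std_normal_distribution) \<le> q"
    and q: "0 < q" and m: "0 < m"
  shows "measure Gspace {\<omega>. T \<omega> \<ge> 4 * exp 2 * (real m * q)} \<le> 2 * exp (- 2 * exp 2 * (real m * q))"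
proof -
  define M where "M = real m * q"
  \<comment> \<open>Twice the constant in E (T exp T) \<le> M e^2 E (exp T). Splitting at T \<le> A
    then gives E (exp T) \<le> exp A + E (exp T) / 2, and half is absorbed on the left.\<close>
  define A where "A = 2 * exp 2 * M"
  have M: "0 < M" and A: "0 < A" using q m by (simp_all add: M_def A_def)
  have Tm [measurable]: "T \<in> borel_measurable Gspace" unfolding T_def using meas by measurable
  have T0: "0 \<le> T \<omega>" and Tb: "T \<omega> \<le> real m" for \<omega>
    unfolding T_def using X0 X1 sum_mono[of "{..<m}" "\<lambda>k. X k \<omega>" "\<lambda>_. 1"] by (auto intro: sum_nonneg)
  have integ: "integrable Gspace f" if "f \<in> borel_measurable Gspace" "\<And>\<omega>. \<bar>f \<omega>\<bar> \<le> B"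
    for f :: "_ \<Rightarrow> real" and B
    by (rule Gs.integrable_const_bound[of _ B]) (use that in auto)
  have expT: "integrable Gspace (\<lambda>\<omega>. exp (T \<omega>))"
    by (rule integ[of _ "exp (real m)"]) (use Tb in auto)
  have upd: "(\<lambda>\<omega>. fun_upd \<omega> j (0::real)) \<in> measurable Gspace Gspace" for j
  proof (rule measurable_into_Gspace)
    show "(\<lambda>\<omega>. fun_upd \<omega> j (0::real) k) \<in> borel_measurable Gspace" for k
      by (cases "k = j") (auto intro: measurable_component_Gspace)
  qed
  have one': "\<bar>T \<omega> - T (fun_upd \<omega> (i k) 0)\<bar> \<le> 1" if "k < m" for k \<omega>
    using one[OF that, of \<omega> "\<omega> (i k)" 0] by simp
  have Xexp: "\<bar>X k \<omega> * exp (1 + T \<omega>')\<bar> \<le> exp (1 + real m)" if "k < m" for k \<omega> \<omega>'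
  proof -
    have "X k \<omega> * exp (1 + T \<omega>') \<le> 1 * exp (1 + real m)"
      using X0[OF that] X1[OF that] Tb[of \<omega>'] by (intro mult_mono) auto
    then show ?thesis using X0[OF that] by (simp add: abs_mult)
  qed
  \<comment> \<open>One factor e is lost when coordinate k is frozen at 0 in the exponent, another
    when it is released again.\<close>
  have key: "(\<integral>\<omega>. X k \<omega> * exp (T \<omega>) \<partial>Gspace) \<le> q * exp 2 * (\<integral>\<omega>. exp (T \<omega>) \<partial>Gspace)" if k: "k < m" for k
  proof -
    note [measurable] = meas[OF k] measurable_compose[OF upd Tm]
    have "(\<integral>\<omega>. X k \<omega> * exp (T \<omega>) \<partial>Gspace) \<le> (\<integral>\<omega>. X k \<omega> * exp (1 + T (fun_upd \<omega> (i k) 0)) \<partial>Gspace)"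
    proof (rule integral_mono)
      have "\<bar>X k \<omega> * exp (T \<omega>)\<bar> \<le> exp (1 + real m)" for \<omega>
      proof -
        have "\<bar>X k \<omega> * exp (T \<omega>)\<bar> \<le> \<bar>X k \<omega> * exp (1 + T \<omega>)\<bar>"
          using X0[OF k, of \<omega>] by (auto simp: abs_mult intro!: mult_left_mono)
        then show ?thesis using Xexp[OF k, of \<omega> \<omega>] by linarith
      qed
      then show "integrable Gspace (\<lambda>\<omega>. X k \<omega> * exp (T \<omega>))" by (intro integ) measurable
      show "integrable Gspace (\<lambda>\<omega>. X k \<omega> * exp (1 + T (fun_upd \<omega> (i k) 0)))"
        by (rule integ[OF _ Xexp[OF k]]) measurable
      show "X k \<omega> * exp (T \<omega>) \<le> X k \<omega> * exp (1 + T (fun_upd \<omega> (i k) 0))" for \<omega>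
        using one'[OF k, of \<omega>] X0[OF k] by (intro mult_left_mono) auto
    qed
    also have "\<dots> = (\<integral>\<omega>. (\<integral>x. X k (fun_upd \<omega> (i k) x) * exp (1 + T (fun_upd (fun_upd \<omega> (i k) x) (i k) 0)) \<partial>std_normal_distribution) \<partial>Gspace)"
      by (rule integral_fun_upd[of _ "exp (1 + real m)"]) (use Xexp[OF k] in auto)
    also have "\<dots> = (\<integral>\<omega>. (\<integral>x. X k (fun_upd \<omega> (i k) x) \<partial>std_normal_distribution) * exp (1 + T (fun_upd \<omega> (i k) 0)) \<partial>Gspace)"
      by simp
    also have "\<dots> \<le> (\<integral>\<omega>. q * (exp 2 * exp (T \<omega>)) \<partial>Gspace)"
    proof (rule integral_mono_AE')
      show "integrable Gspace (\<lambda>\<omega>. q * (exp 2 * exp (T \<omega>)))" using expT by simp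
      have "exp (1 + T (fun_upd \<omega> (i k) 0)) \<le> exp 2 * exp (T \<omega>)" for \<omega>
        using one'[OF k, of \<omega>] by (simp add: exp_add[symmetric])
      then show "AE \<omega> in Gspace. (\<integral>x. X k (fun_upd \<omega> (i k) x) \<partial>std_normal_distribution) * exp (1 + T (fun_upd \<omega> (i k) 0))
          \<le> q * (exp 2 * exp (T \<omega>))"
        using weg[OF k] q by (intro AE_I2 mult_mono) auto
      show "AE \<omega> in Gspace. 0 \<le> q * (exp 2 * exp (T \<omega>))" using q by simp
    qed
    finally show ?thesis by simp
  qed
  have "(\<integral>\<omega>. T \<omega> * exp (T \<omega>) \<partial>Gspace) = (\<Sum>k<m. (\<integral>\<omega>. X k \<omega> * exp (T \<omega>) \<partial>Gspace))"
  proof -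
    have "(\<integral>\<omega>. T \<omega> * exp (T \<omega>) \<partial>Gspace) = (\<integral>\<omega>. (\<Sum>k<m. X k \<omega> * exp (T \<omega>)) \<partial>Gspace)"
      unfolding T_def by (simp add: sum_distrib_right)
    also have "\<dots> = (\<Sum>k<m. (\<integral>\<omega>. X k \<omega> * exp (T \<omega>) \<partial>Gspace))"
    proof (rule Bochner_Integration.integral_sum)
      fix k assume "k \<in> {..<m}"
      then have k: "k < m" by simp
      note [measurable] = meas[OF k]
      have "\<bar>X k \<omega> * exp (T \<omega>)\<bar> \<le> 1 * exp (real m)" for \<omega>
        unfolding abs_mult using X0[OF k, of \<omega>] X1[OF k, of \<omega>] Tb[of \<omega>] by (intro mult_mono) auto
      then show "integrable Gspace (\<lambda>\<omega>. X k \<omega> * exp (T \<omega>))" by (intro integ) measurable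
    qed
    finally show ?thesis .
  qed
  also have "\<dots> \<le> (\<Sum>k<m. q * exp 2 * (\<integral>\<omega>. exp (T \<omega>) \<partial>Gspace))"
    by (intro sum_mono key) auto
  finally have TE: "(\<integral>\<omega>. T \<omega> * exp (T \<omega>) \<partial>Gspace) \<le> M * exp 2 * (\<integral>\<omega>. exp (T \<omega>) \<partial>Gspace)"
    by (simp add: M_def)
  have TeT: "integrable Gspace (\<lambda>\<omega>. T \<omega> * exp (T \<omega>))"
  proof (rule integ[of _ "real m * exp (real m)"])
    show "\<bar>T \<omega> * exp (T \<omega>)\<bar> \<le> real m * exp (real m)" for \<omega>
      unfolding abs_mult using T0[of \<omega>] Tb[of \<omega>] by (intro mult_mono) auto
  qed measurable
  have "(\<integral>\<omega>. exp (T \<omega>) \<partial>Gspace) \<le> (\<integral>\<omega>. exp A + T \<omega> * exp (T \<omega>) / A \<partial>Gspace)"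
  proof (rule integral_mono[OF expT])
    show "integrable Gspace (\<lambda>\<omega>. exp A + T \<omega> * exp (T \<omega>) / A)" using TeT by simp
    fix \<omega>
    show "exp (T \<omega>) \<le> exp A + T \<omega> * exp (T \<omega>) / A"
    proof (cases "T \<omega> \<le> A")
      case True
      moreover have "0 \<le> T \<omega> * exp (T \<omega>) / A" using T0 A by simp
      ultimately show ?thesis by (simp add: add_increasing2)
    next
      case False
      then have "1 * exp (T \<omega>) \<le> (T \<omega> / A) * exp (T \<omega>)" using A by (intro mult_right_mono) auto
      then show ?thesis by (simp add: add_increasing)
    qed
  qed
  also have "\<dots> = exp A + (\<integral>\<omega>. T \<omega> * exp (T \<omega>) \<partial>Gspace) / A"
    using TeT by simp
  also have "\<dots> \<le> exp A + (M * exp 2 * (\<integral>\<omega>. exp (T \<omega>) \<partial>Gspace)) / A"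
    using TE A by (intro add_left_mono divide_right_mono) auto
  also have "(M * exp 2 * (\<integral>\<omega>. exp (T \<omega>) \<partial>Gspace)) / A = (\<integral>\<omega>. exp (T \<omega>) \<partial>Gspace) / 2"
    using M by (simp add: A_def)
  finally have E: "(\<integral>\<omega>. exp (T \<omega>) \<partial>Gspace) \<le> 2 * exp A" by simp
  have "measure Gspace {\<omega>\<in>space Gspace. exp (T \<omega>) \<ge> exp (2 * A)} \<le> (\<integral>\<omega>. exp (T \<omega>) \<partial>Gspace) / exp (2 * A)"
    by (rule integral_Markov_inequality_measure[OF expT, where A = "{}"]) auto
  also have "\<dots> \<le> 2 * exp A / exp (2 * A)" using E by (intro divide_right_mono) auto
  also have "\<dots> = 2 * exp (- A)" using exp_diff[of A "2 * A"] by simp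
  finally show ?thesis by (simp add: A_def M_def algebra_simps)
qed

subsection \<open>The hierarchical matrices\<close>

text \<open>Defined for all indices, not only those below \<open>Nsz n\<close>, so that the matrix
  of one level can be read at the size of the next. Index i stands for site i + 1.\<close>

definition Hfun :: "real \<Rightarrow> nat \<Rightarrow> (nat \<times> nat \<times> nat \<Rightarrow> real) \<Rightarrow> nat \<Rightarrow> nat \<Rightarrow> real" where
  "Hfun eps n \<omega> i j = (\<Sum>r\<le>n. sqrt (tscale eps r) * Phi r \<omega> (i + 1) (j + 1))"

lemma Nsz_pos [simp]: "0 < Nsz n" by (simp add: Nsz_def)

lemma hdist_sym: "hdist x y = hdist y x"
  unfolding hdist_def by (intro arg_cong[where f = Least] ext) auto

lemma Phi_sym: "Phi r \<omega> x y = Phi r \<omega> y x"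
  by (simp add: Phi_def var_entry_def hdist_sym[of x y] min.commute max.commute)

lemma msym_Hfun [simp]: "msym N (Hfun eps n \<omega>)"
  by (simp add: msym_def Hfun_def Phi_sym)

lemma res_cong:
  assumes "\<And>i j. i < N \<Longrightarrow> j < N \<Longrightarrow> H i j = H' i j"
  shows "res N H = res N H'"
proof -
  have "shifted N H z = shifted N H' z" for z
    by (rule eq_matI) (auto simp: shifted_def assms)
  then show ?thesis by (simp add: res_def[abs_def])
qed

lemma Stieltjes_eq: "0 < Im z \<Longrightarrow> Stieltjes eps n \<omega> z = ntr (Nsz n) (Hfun eps n \<omega>) z"
proof -
  assume z: "0 < Im z"
  have eq: "Hmat eps n \<omega> $$ (i, j) = Hfun eps n \<omega> i j" if "i < Nsz n" "j < Nsz n" for i j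
    using that by (simp add: Hmat_def Hfun_def)
  have "msym (Nsz n) (\<lambda>i j. Hmat eps n \<omega> $$ (i, j))"
    using msym_Hfun[of "Nsz n" eps n \<omega>] by (simp add: msym_def eq)
  from Stieltjes_eq_ntr[OF this z] show ?thesis
    using res_cong[of "Nsz n" "\<lambda>i j. Hmat eps n \<omega> $$ (i, j)", OF eq] by (simp add: ntr_def)
qed

lemma Hmat_eq: "Hmat eps n \<omega> = mat (Nsz n) (Nsz n) (\<lambda>(i, j). Hfun eps n \<omega> i j)"
  by (simp add: Hmat_def Hfun_def)

section \<open>Measurability of resolvent entries\<close>

lemma measurable_det:
  fixes f :: "nat \<Rightarrow> nat \<Rightarrow> 'a \<Rightarrow> complex"
  assumes "\<And>i j. i < N \<Longrightarrow> j < N \<Longrightarrow> f i j \<in> borel_measurable M"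
  shows "(\<lambda>\<omega>. Determinant.det (mat N N (\<lambda>(i, j). f i j \<omega>))) \<in> borel_measurable M"
proof -
  have "(\<lambda>\<omega>. \<Sum>p\<in>{p. p permutes {0..<N}}. signof p * (\<Prod>i = 0..<N. f i (p i) \<omega>)) \<in> borel_measurable M"
  proof (intro borel_measurable_sum borel_measurable_times borel_measurable_prod borel_measurable_const)
    fix p i assume "p \<in> {p. p permutes {0..<N}}" "i \<in> {0..<N}"
    then show "f i (p i) \<in> borel_measurable M"
      using permutes_in_image[of p "{0..<N}" i] by (intro assms) auto
  qed
  also have "(\<lambda>\<omega>. \<Sum>p\<in>{p. p permutes {0..<N}}. signof p * (\<Prod>i = 0..<N. f i (p i) \<omega>))
    = (\<lambda>\<omega>. Determinant.det (mat N N (\<lambda>(i, j). f i j \<omega>)))"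
  proof (rule ext)
    fix \<omega>
    have "(\<Prod>i = 0..<N. f i (p i) \<omega>) = (\<Prod>i = 0..<N. mat N N (\<lambda>(i, j). f i j \<omega>) $$ (i, p i))"
      if "p permutes {0..<N}" for p
      using permutes_in_image[OF that] by (intro prod.cong) auto
    then show "(\<Sum>p\<in>{p. p permutes {0..<N}}. signof p * (\<Prod>i = 0..<N. f i (p i) \<omega>))
      = Determinant.det (mat N N (\<lambda>(i, j). f i j \<omega>))"
      by (auto simp: Determinant.det_def intro!: sum.cong)
  qed
  finally show ?thesis .
qed

text \<open>The spectral point may depend on the sample because the previous level is evaluated at
  the random point w. Cramer's rule makes each entry a quotient of determinants, which are
  polynomials in the matrix entries.\<close>

lemma measurable_res:
  assumes H: "\<And>i j. i < N \<Longrightarrow> j < N \<Longrightarrow> (\<lambda>\<omega>. H \<omega> i j) \<in> borel_measurable M"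
    and w [measurable]: "w \<in> borel_measurable M" and i: "i < N" and j: "j < N"
  shows "(\<lambda>\<omega>. res N (H \<omega>) (w \<omega>) i j) \<in> borel_measurable M"
proof -
  have ent: "(\<lambda>\<omega>. complex_of_real (H \<omega> a b) - (if a = b then w \<omega> else 0)) \<in> borel_measurable M"
    if "a < N" "b < N" for a b
    using H[OF that] by (cases "a = b") simp_all
  define e where "e a b = (\<lambda>\<omega>. complex_of_real (H \<omega> a b) - (if a = b then w \<omega> else 0))" for a b
  have sh: "shifted N (H \<omega>) (w \<omega>) = mat N N (\<lambda>(a, b). e a b \<omega>)" for \<omega>
    by (simp add: shifted_def e_def)
  have del: "mat_delete (mat N N (\<lambda>(a, b). e a b \<omega>)) j i
    = mat (N - 1) (N - 1) (\<lambda>(a, b). e (if a < j then a else Suc a) (if b < i then b else Suc b) \<omega>)" for \<omega>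
    using i j by (intro eq_matI) (auto simp: mat_delete_def)
  have "(\<lambda>\<omega>. Determinant.det (mat N N (\<lambda>(a, b). e a b \<omega>))) \<in> borel_measurable M"
    by (rule measurable_det) (simp add: e_def ent)
  moreover have "(\<lambda>\<omega>. Determinant.det (mat (N - 1) (N - 1)
      (\<lambda>(a, b). e (if a < j then a else Suc a) (if b < i then b else Suc b) \<omega>))) \<in> borel_measurable M"
    by (rule measurable_det) (unfold e_def, rule ent, auto)
  ultimately show ?thesis
    unfolding res_def cofactor_def sh del by measurable
qed

lemma measurable_Hfun: "(\<lambda>\<omega>. Hfun eps n \<omega> i j) \<in> borel_measurable Gspace"
  unfolding Hfun_def Phi_def
  by (intro borel_measurable_sum borel_measurable_times borel_measurable_const measurable_component_Gspace)

lemma measurable_ntr: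
  assumes "\<And>i j. i < N \<Longrightarrow> j < N \<Longrightarrow> (\<lambda>\<omega>. H \<omega> i j) \<in> borel_measurable M"
    and "w \<in> borel_measurable M"
  shows "(\<lambda>\<omega>. ntr N (H \<omega>) (w \<omega>)) \<in> borel_measurable M"
  unfolding ntr_def
  by (intro borel_measurable_divide borel_measurable_sum measurable_res assms borel_measurable_const) auto

lemma measurable_ntr_Hfun [measurable]: "(\<lambda>\<omega>. ntr N (Hfun eps n \<omega>) z) \<in> borel_measurable Gspace"
  by (intro measurable_ntr measurable_Hfun borel_measurable_const)

section \<open>Dyadic blocks and the block structure of the matrices\<close>

lemma hdist_self [simp]: "hdist x x = 0"
  by (simp add: hdist_def)

text \<open>The minimum is attained: with r = x + y, both x - 1 and y - 1 are below 2^r, so both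
  sites lie in the first block of level r.\<close>

lemma hdist_witness: "(x - 1) div 2 ^ hdist x y = (y - 1) div 2 ^ hdist x y"
  unfolding hdist_def
proof (rule LeastI)
  define m where "m = x + y"
  have "m < 2 ^ m" by (rule less_exp)
  moreover have "x - 1 \<le> m" "y - 1 \<le> m" by (auto simp: m_def)
  ultimately have "x - 1 < 2 ^ m" "y - 1 < 2 ^ m" by linarith+
  then show "(x - 1) div 2 ^ m = (y - 1) div 2 ^ m" by simp
qed

lemma hdist_le:
  assumes "i < Nsz n" "j < Nsz n"
  shows "hdist (i + 1) (j + 1) \<le> n"
  unfolding hdist_def using assms by (intro Least_le) (simp add: Nsz_def)

lemma hdist_eq_0_iff: "hdist (i + 1) (j + 1) = 0 \<longleftrightarrow> i = j"
  using hdist_witness[of "i + 1" "j + 1"] by auto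

text \<open>A common dyadic block remains common at every coarser level, whereas the sites i + 1 and
  j + 1 lie in different blocks of size 2^m.\<close>

lemma hdist_separated:
  assumes "i < 2 ^ m" "2 ^ m \<le> j"
  shows "m < hdist (i + 1) (j + 1)"
proof (rule ccontr)
  assume "\<not> m < hdist (i + 1) (j + 1)"
  then obtain d where d: "m = hdist (i + 1) (j + 1) + d" using le_Suc_ex by (metis not_less)
  have "i div 2 ^ m = j div 2 ^ m"
    using hdist_witness[of "i + 1" "j + 1"] unfolding d power_add div_mult2_eq by simp
  moreover have "i div 2 ^ m = 0" using assms by simp
  moreover have "0 < j div 2 ^ m" using assms by (simp add: div_greater_zero_iff)
  ultimately show False by simp
qed

text \<open>Within the first N sites all distances are at most n, so the top level is a full matrix:
  a GOE matrix with variance 1 / N off the diagonal and 2 / N on it.\<close>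

lemma var_entry_top:
  assumes "i < Nsz n" "j < Nsz n"
  shows "var_entry n (i + 1) (j + 1) = (if i = j then 2 else 1) / real (Nsz n)"
  using hdist_le[OF assms] hdist_eq_0_iff[of i j] by (auto simp: var_entry_def Nsz_def)

lemma Hfun_Suc:
  "Hfun eps (Suc m) \<omega> i j = Hfun eps m \<omega> i j + sqrt (tscale eps (Suc m)) * Phi (Suc m) \<omega> (i + 1) (j + 1)"
  by (simp add: Hfun_def)

lemma Hfun_block:
  assumes "i < 2 ^ m" "2 ^ m \<le> j"
  shows "Hfun eps m \<omega> i j = 0"
  unfolding Hfun_def
proof (rule sum.neutral, rule ballI)
  fix r assume "r \<in> {..m}"
  then have "var_entry r (i + 1) (j + 1) = 0"
    using hdist_separated[OF assms] by (auto simp: var_entry_def)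
  then show "sqrt (tscale eps r) * Phi r \<omega> (i + 1) (j + 1) = 0" by (simp add: Phi_def)
qed

text \<open>A column of the small resolvent, extended by zero, solves the large system because the
  off-diagonal block vanishes; solutions are unique.\<close>

lemma res_block:
  assumes N: "N' \<le> N" and H: "msym N H" and z: "0 < Im z"
    and block: "\<And>i j. i < N' \<Longrightarrow> N' \<le> j \<Longrightarrow> j < N \<Longrightarrow> H i j = 0"
    and ij: "i < N'" "j < N'"
  shows "res N H z i j = res N' H z i j"
proof -
  have H': "msym N' H" using H N by (auto simp: msym_def)
  define x where "x k = (if k < N' then res N' H z k j else 0)" for k
  have "(\<Sum>k<N. of_real (H a k) * x k) - z * x a = (if a = j then 1 else 0)" if a: "a < N" for a
  proof -
    have s: "(\<Sum>k<N. of_real (H a k) * x k) = (\<Sum>k<N'. of_real (H a k) * res N' H z k j)"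
      using N by (intro sum.mono_neutral_cong_right) (auto simp: x_def)
    show ?thesis
    proof (cases "a < N'")
      case True
      then show ?thesis unfolding s using res_right[OF H' z True ij(2)] by (simp add: x_def)
    next
      case False
      then have "H a k = 0" if "k < N'" for k
        using block[OF that] a msymD[OF H a, of k] that N by auto
      then show ?thesis unfolding s using False ij by (simp add: x_def)
    qed
  qed
  from res_unique[OF H z _ this, of i] ij N
  have "x i = (\<Sum>b<N. res N H z i b * (if b = j then 1 else 0))" by simp
  then show ?thesis using ij N by (simp add: x_def sum_mult_indicator_eq)
qed

text \<open>\<open>Hfun eps m\<close> read at size \<open>2\<^sup>m\<^sup>+\<^sup>1\<close> is block diagonal and its first block is the matrix of level \<open>m\<close>
  for the same \<open>\<omega>\<close>, so no comparison of laws is needed.\<close>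
lemma ntr_half_block:
  assumes z: "0 < Im z"
  shows "Im (ntr (Nsz m) (Hfun eps m \<omega>) z) / 2 \<le> Im (ntr (Nsz (Suc m)) (Hfun eps m \<omega>) z)"
proof -
  have le: "Nsz m \<le> Nsz (Suc m)" by (simp add: Nsz_def)
  have "(\<Sum>i<Nsz m. Im (res (Nsz m) (Hfun eps m \<omega>) z i i)) = (\<Sum>i<Nsz m. Im (res (Nsz (Suc m)) (Hfun eps m \<omega>) z i i))"
    by (intro sum.cong refl arg_cong[of _ _ Im] res_block[OF le _ z, symmetric])
      (auto simp: Nsz_def Hfun_block)
  also have "\<dots> \<le> (\<Sum>i<Nsz (Suc m). Im (res (Nsz (Suc m)) (Hfun eps m \<omega>) z i i))"
    using le by (intro sum_mono2) (auto intro!: less_imp_le[OF res_diag_Im_pos[OF msym_Hfun z]])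
  finally show ?thesis
    by (simp add: ntr_def Im_divide_of_nat Nsz_def field_simps sum_distrib_left[symmetric] sum_divide_distrib[symmetric])
qed

text \<open>The diagonal Gaussians used here are those of level 0, which enter with variance 2 and
  weight 1 whatever n is. Wegner's estimate is therefore uniform in n and holds at every height. The
  threshold is that of \<open>exponential_tail\<close> divided by N Im z.\<close>

lemma upper_tail:
  assumes z: "0 < Im z"
  defines "q \<equiv> pi * Im z"
  shows "measure Gspace {\<omega>. 4 * exp 2 * pi \<le> Im (ntr (Nsz n) (Hfun eps n \<omega>) z)}
    \<le> 2 * exp (- 2 * exp 2 * (real (Nsz n) * q))"
proof -
  define N where "N = Nsz n"
  have N: "0 < N" by (simp add: N_def)
  define X where "X k \<omega> = Im z * Im (res N (Hfun eps n \<omega>) z k k)" for k \<omega>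
  define idx :: "nat \<Rightarrow> nat \<times> nat \<times> nat" where "idx k = (0, k + 1, k + 1)" for k
  have T: "(\<Sum>k<N. X k \<omega>) = real N * Im z * Im (ntr N (Hfun eps n \<omega>) z)" for \<omega>
    using N by (simp add: X_def ntr_def Im_divide_of_nat sum_distrib_left[symmetric] sum_divide_distrib[symmetric])
  have H0: "Hfun eps n (fun_upd \<omega> (idx k) x) i j
    = Hfun eps n (fun_upd \<omega> (idx k) y) i j + (sqrt 2 * (x - y)) * (if i = k then 1 else 0) * (if j = k then 1 else 0)"
    for \<omega> k x y i j
  proof -
    have "Hfun eps n (fun_upd \<omega> (idx k) x) i j - Hfun eps n (fun_upd \<omega> (idx k) y) i j
      = (\<Sum>r\<le>n. if r = 0 then sqrt 2 * (x - y) * (if i = k then 1 else 0) * (if j = k then 1 else 0) else 0)"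
      unfolding Hfun_def sum_subtractf[symmetric]
    proof (rule sum.cong[OF refl])
      fix r
      have t0: "tscale eps 0 = 1" by (simp add: tscale_def)
      show "sqrt (tscale eps r) * Phi r (fun_upd \<omega> (idx k) x) (i + 1) (j + 1)
          - sqrt (tscale eps r) * Phi r (fun_upd \<omega> (idx k) y) (i + 1) (j + 1)
        = (if r = 0 then sqrt 2 * (x - y) * (if i = k then 1 else 0) * (if j = k then 1 else 0) else 0)"
      proof (cases "r = 0 \<and> i = k \<and> j = k")
        case True
        then show ?thesis by (simp add: Phi_def var_entry_def idx_def t0 algebra_simps)
      next
        case False
        then have "(r, min (i + 1) (j + 1), max (i + 1) (j + 1)) \<noteq> idx k"
          by (auto simp: idx_def min_def max_def split: if_splits)
        then have "Phi r (fun_upd \<omega> (idx k) v) (i + 1) (j + 1) = Phi r \<omega> (i + 1) (j + 1)" for v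
          unfolding Phi_def by (simp only: fun_upd_apply if_False)
        with False show ?thesis by auto
      qed
    qed
    also have "\<dots> = sqrt 2 * (x - y) * (if i = k then 1 else 0) * (if j = k then 1 else 0)" by simp
    finally show ?thesis by simp
  qed
  have "measure Gspace {\<omega>. (\<Sum>k<N. X k \<omega>) \<ge> 4 * exp 2 * (real N * q)} \<le> 2 * exp (- 2 * exp 2 * (real N * q))"
  proof (rule exponential_tail[where i = idx])
    show "X k \<in> borel_measurable Gspace" if "k < N" for k
    proof -
      have [measurable]: "(\<lambda>\<omega>. res N (Hfun eps n \<omega>) z k k) \<in> borel_measurable Gspace"
        by (intro measurable_res measurable_Hfun that) simp
      show ?thesis unfolding X_def[abs_def] by measurable
    qed
    show "0 \<le> X k \<omega>" if "k < N" for k \<omega>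
      using res_diag_Im_pos[OF msym_Hfun z that, of eps n \<omega>] z by (simp add: X_def)
    show "X k \<omega> \<le> 1" if "k < N" for k \<omega>
    proof -
      have "Im (res N (Hfun eps n \<omega>) z k k) \<le> 1 / Im z"
        by (rule order_trans[OF order_trans[OF abs_ge_self abs_Im_le_cmod] res_entry_bound[OF msym_Hfun z that that]])
      then show ?thesis using z by (simp add: X_def field_simps)
    qed
    show "\<bar>(\<Sum>k<N. X k (fun_upd \<omega> (idx k') x)) - (\<Sum>k<N. X k (fun_upd \<omega> (idx k') y))\<bar> \<le> 1" if "k' < N" for k' \<omega> x y
    proof -
      let ?A = "Hfun eps n (fun_upd \<omega> (idx k') x)" and ?B = "Hfun eps n (fun_upd \<omega> (idx k') y)"
      have "cmod ((\<Sum>i<N. res N ?A z i i) - (\<Sum>i<N. res N ?B z i i)) \<le> 1 / Im z"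
        by (rule trace_rank_one_bound[OF msym_Hfun z, of N ?A eps n _ "sqrt 2 * (x - y)" "\<lambda>i. if i = k' then 1 else 0"]) (rule H0)
      then have "\<bar>Im ((\<Sum>i<N. res N ?A z i i) - (\<Sum>i<N. res N ?B z i i))\<bar> \<le> 1 / Im z"
        by (rule order_trans[OF abs_Im_le_cmod])
      then have "Im z * \<bar>Im ((\<Sum>i<N. res N ?A z i i) - (\<Sum>i<N. res N ?B z i i))\<bar> \<le> 1"
        using z by (simp add: field_simps)
      also have "Im z * \<bar>Im ((\<Sum>i<N. res N ?A z i i) - (\<Sum>i<N. res N ?B z i i))\<bar>
        = \<bar>(\<Sum>k<N. X k (fun_upd \<omega> (idx k') x)) - (\<Sum>k<N. X k (fun_upd \<omega> (idx k') y))\<bar>"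
        using z by (simp add: X_def sum_distrib_left[symmetric] right_diff_distrib[symmetric] abs_mult)
      finally show ?thesis .
    qed
    show "(\<integral>x. X k (fun_upd \<omega> (idx k) x) \<partial>std_normal_distribution) \<le> q" if k: "k < N" for k \<omega>
    proof -
      define g where "g x = res N (Hfun eps n (fun_upd \<omega> (idx k) x)) z k k" for x
      \<comment> \<open>As a function of its own diagonal coordinate, G_kk is a Moebius transform of
        its value at coordinate 0: Sherman-Morrison with v the k-th unit vector.\<close>
      have "g x * (1 + of_real (sqrt 2 * x) * g 0) = g 0" for x
      proof -
        note ks = sum_mult_indicator_eq[OF k, where 'a = complex]
        have upd: "Hfun eps n (fun_upd \<omega> (idx k) x) i j
            = Hfun eps n (fun_upd \<omega> (idx k) 0) i j + (sqrt 2 * x) * (if i = k then 1 else 0) * (if j = k then 1 else 0)"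
          for i j using H0[of \<omega> k x i j 0] by simp
        have i1: "complex_of_real (if j = k then 1 else 0) = (if j = k then 1 else 0)" for j by simp
        show ?thesis
          using rank_one_shift(1)[OF msym_Hfun msym_Hfun z upd k]
          unfolding i1 ks by (simp add: g_def)
      qed
      moreover have "0 < Im (g 0)" unfolding g_def by (rule res_diag_Im_pos[OF msym_Hfun z k])
      ultimately have "(\<integral>x. Im (g x) \<partial>std_normal_distribution) \<le> pi"
        by (intro Wegner_1d(2)[of "g 0"]) auto
      then show ?thesis using z by (simp add: X_def g_def[symmetric] q_def mult.commute)
    qed
    show "0 < q" using z by (simp add: q_def)
    show "0 < N" by fact
  qed
  also have "{\<omega>. (\<Sum>k<N. X k \<omega>) \<ge> 4 * exp 2 * (real N * q)} = {\<omega>. 4 * exp 2 * pi \<le> Im (ntr N (Hfun eps n \<omega>) z)}"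
  proof -
    have pos: "0 < real N * Im z" using N z by simp
    have "4 * exp 2 * (real N * q) = (real N * Im z) * (4 * exp 2 * pi)" by (simp add: q_def)
    then show ?thesis unfolding T by (simp only: mult_le_cancel_left_pos[OF pos])
  qed
  finally show ?thesis by (simp add: N_def)
qed

section \<open>Poisson kernels, the mean of Im S and its lower tail\<close>

lemma Im_inverse_shift:
  "Im (1 / (complex_of_real e - z)) = Im z / (cmod (complex_of_real e - z))\<^sup>2"
  by (simp add: Im_divide cmod_power2)

lemma ntr_spectral:
  assumes "msym N H"
  obtains es where "length es = N"
    and "\<And>z. 0 < Im z \<Longrightarrow> ntr N H z = (\<Sum>e\<leftarrow>es. 1 / (complex_of_real e - z)) / of_nat N"
    and "\<And>f. trace_fun f (mat N N (\<lambda>(i, j). H i j)) = (\<Sum>e\<leftarrow>es. f e)"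
  using spectral_representation[OF assms] by (auto simp: ntr_def)

lemma Im_sum_list: "Im (\<Sum>e\<leftarrow>es. f e) = (\<Sum>e\<leftarrow>es. Im (f e))"
  by (induction es) auto

text \<open>A Harnack inequality, proved for each Poisson kernel: the height shrinks at most by the
  factor 1/2, the distance to an eigenvalue grows at most by 3/2, and (1/2) / (9/4) = 2/9.\<close>

lemma ntr_Im_comparable:
  assumes H: "msym N H" and z: "0 < Im z" and d: "cmod (z' - z) \<le> Im z / 2"
  shows "2 / 9 * Im (ntr N H z) \<le> Im (ntr N H z')"
proof -
  obtain es where es: "\<And>z. 0 < Im z \<Longrightarrow> ntr N H z = (\<Sum>e\<leftarrow>es. 1 / (complex_of_real e - z)) / of_nat N"
    using ntr_spectral[OF H] by metis
  have "\<bar>Im z' - Im z\<bar> \<le> Im z / 2"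
    using abs_Im_le_cmod[of "z' - z"] d by simp
  then have z': "Im z / 2 \<le> Im z'" by linarith
  have tm: "2 / 9 * Im (1 / (complex_of_real e - z)) \<le> Im (1 / (complex_of_real e - z'))" for e
  proof -
    define r where "r = cmod (complex_of_real e - z)"
    define r' where "r' = cmod (complex_of_real e - z')"
    have zr: "Im z \<le> r" using abs_Im_le_cmod[of "complex_of_real e - z"] z by (simp add: r_def)
    have zr': "Im z' \<le> r'" using abs_Im_le_cmod[of "complex_of_real e - z'"] z z' by (simp add: r'_def)
    have "r' \<le> r + cmod (z' - z)"
      using norm_triangle_ineq4[of "complex_of_real e - z" "z' - z"] by (simp add: r_def r'_def)
    then have "r' \<le> 3 / 2 * r" using d zr by linarith
    moreover have rp: "0 < r" "0 < r'" using zr zr' z z' by linarith+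
    ultimately have "r'\<^sup>2 \<le> (3 / 2 * r)\<^sup>2" by (intro power_mono) auto
    then have le: "r'\<^sup>2 \<le> 9 / 4 * r\<^sup>2" by (simp add: power_mult_distrib power2_eq_square)
    have "2 / 9 * (Im z / r\<^sup>2) = (Im z / 2) / (9 / 4 * r\<^sup>2)" by simp
    also have "\<dots> \<le> Im z' / r'\<^sup>2"
      using le z z' rp by (intro frac_le) auto
    finally show ?thesis unfolding Im_inverse_shift r_def r'_def .
  qed
  have "2 / 9 * (\<Sum>e\<leftarrow>es. Im (1 / (complex_of_real e - z))) \<le> (\<Sum>e\<leftarrow>es. Im (1 / (complex_of_real e - z')))"
    unfolding sum_list_const_mult[symmetric] by (intro sum_list_mono tm)
  then have "2 / 9 * (\<Sum>e\<leftarrow>es. Im (1 / (complex_of_real e - z))) / real N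
      \<le> (\<Sum>e\<leftarrow>es. Im (1 / (complex_of_real e - z'))) / real N"
    by (intro divide_right_mono) auto
  moreover have "0 < Im z'" using z z' by linarith
  ultimately show ?thesis
    using z by (simp only: es Im_divide_of_nat Im_sum_list times_divide_eq_right)
qed

text \<open>The Cauchy kernels at heights y and 2 y differ in modulus by y / (|e - z| |e - w|). This
  is at most the Poisson kernel y / |e - z|^2 at the lower height, because w is farther from every
  eigenvalue.\<close>

lemma ntr_double_scale:
  assumes H: "msym N H" and y: "0 < y"
  shows "cmod (ntr N H (Complex E y)) \<le> cmod (ntr N H (Complex E (2 * y))) + Im (ntr N H (Complex E y))"
proof -
  obtain es where es: "\<And>z. 0 < Im z \<Longrightarrow> ntr N H z = (\<Sum>e\<leftarrow>es. 1 / (complex_of_real e - z)) / of_nat N"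
    using ntr_spectral[OF H] by metis
  let ?z = "Complex E y" and ?w = "Complex E (2 * y)"
  have tm: "cmod (1 / (complex_of_real e - ?z) - 1 / (complex_of_real e - ?w)) \<le> Im (1 / (complex_of_real e - ?z))" for e
  proof -
    have nz: "complex_of_real e - ?z \<noteq> 0" "complex_of_real e - ?w \<noteq> 0"
      using y by (auto simp: complex_eq_iff)
    have eq: "1 / (complex_of_real e - ?z) - 1 / (complex_of_real e - ?w) = (?z - ?w) / ((complex_of_real e - ?z) * (complex_of_real e - ?w))"
      using nz by (simp add: field_simps)
    have d: "cmod (?z - ?w) = y" using y by (simp add: cmod_def)
    have "cmod (1 / (complex_of_real e - ?z) - 1 / (complex_of_real e - ?w)) = y / (cmod (complex_of_real e - ?z) * cmod (complex_of_real e - ?w))"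
      unfolding eq by (simp only: norm_divide norm_mult d)
    also have "\<dots> \<le> y / (cmod (complex_of_real e - ?z) * cmod (complex_of_real e - ?z))"
    proof (intro divide_left_mono mult_left_mono)
      show "cmod (complex_of_real e - ?z) \<le> cmod (complex_of_real e - ?w)"
        using y by (simp add: cmod_def)
    qed (use y nz in auto)
    finally show ?thesis unfolding Im_inverse_shift by (simp add: power2_eq_square)
  qed
  have "cmod ((\<Sum>e\<leftarrow>es. 1 / (complex_of_real e - ?z)) - (\<Sum>e\<leftarrow>es. 1 / (complex_of_real e - ?w)))
      \<le> Im (\<Sum>e\<leftarrow>es. 1 / (complex_of_real e - ?z))"
  proof (induction es)
    case (Cons e es)
    have "(\<Sum>e\<leftarrow>e # es. 1 / (complex_of_real e - ?z)) - (\<Sum>e\<leftarrow>e # es. 1 / (complex_of_real e - ?w))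
      = (1 / (complex_of_real e - ?z) - 1 / (complex_of_real e - ?w))
      + ((\<Sum>e\<leftarrow>es. 1 / (complex_of_real e - ?z)) - (\<Sum>e\<leftarrow>es. 1 / (complex_of_real e - ?w)))"
      by simp
    with norm_triangle_mono[OF tm[of e] Cons] show ?case by (simp add: algebra_simps)
  qed simp
  then have "cmod ((\<Sum>e\<leftarrow>es. 1 / (complex_of_real e - ?z)) - (\<Sum>e\<leftarrow>es. 1 / (complex_of_real e - ?w))) / real N
      \<le> Im (\<Sum>e\<leftarrow>es. 1 / (complex_of_real e - ?z)) / real N"
    by (intro divide_right_mono) auto
  then have "cmod (ntr N H ?z - ntr N H ?w) \<le> Im (ntr N H ?z)"
    using y by (simp add: es Im_divide_of_nat norm_divide flip: diff_divide_distrib)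
  then show ?thesis using norm_triangle_sub[of "ntr N H ?z" "ntr N H ?w"] by linarith
qed

text \<open>The tent function f of height 1 / (2 y) and half-width h \<le> y lies below the Poisson
  kernel at E + i y and is an admissible test function for the density of states. On the middle half
  of its support, an interval of length h, it is at least 1 / (4 y).\<close>

lemma expected_Im_lower:
  assumes dos: "is_dos eps \<rho>" and low: "\<And>x. x \<in> Wt \<Longrightarrow> \<kappa> \<le> \<rho> n x" and \<kappa>: "0 < \<kappa>"
    and sub: "{E - h<..<E + h} \<subseteq> Wt" and h: "0 < h" "h \<le> y"
  shows "\<kappa> * h / (4 * y) \<le> (\<integral>\<omega>. Im (ntr (Nsz n) (Hfun eps n \<omega>) (Complex E y)) \<partial>Gspace)"
proof -
  define f where "f x = (1 / (2 * y)) * max 0 (1 - \<bar>x - E\<bar> / h)" for x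
  have y: "0 < y" using h by simp
  have fc: "continuous_on UNIV f" unfolding f_def by (intro continuous_intros) (use h in auto)
  have fz: "f x = 0" if "h \<le> \<bar>x - E\<bar>" for x using that h by (simp add: f_def max_def)
  have f0: "0 \<le> f x" for x using y by (simp add: f_def)
  have supp: "\<forall>x. \<bar>E\<bar> + h < \<bar>x\<bar> \<longrightarrow> f x = 0" by (auto intro: fz)
  have ipf: "integrable lborel (\<lambda>x. f x * \<rho> n x)"
    and ef: "(\<integral>x. f x * \<rho> n x \<partial>lborel) = (\<integral>\<omega>. trace_fun f (Hmat eps n \<omega>) / real (Nsz n) \<partial>Gspace)"
    using dos fc supp unfolding is_dos_def by blast+
  have pt: "\<kappa> / (4 * y) * indicator {E - h/2..E + h/2} x \<le> f x * \<rho> n x" for x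
  proof (cases "\<bar>x - E\<bar> < h")
    case True
    then have r: "\<kappa> \<le> \<rho> n x" using sub by (intro low) (auto simp: subset_iff abs_less_iff)
    show ?thesis
    proof (cases "x \<in> {E - h/2..E + h/2}")
      case True
      then have "\<bar>x - E\<bar> \<le> h / 2" unfolding atLeastAtMost_iff by linarith
      then have "\<bar>x - E\<bar> / h \<le> 1 / 2" using h by (simp add: field_simps)
      then have "1 / 2 \<le> max 0 (1 - \<bar>x - E\<bar> / h)" by linarith
      then have "1 / (2 * y) * (1 / 2) \<le> f x" unfolding f_def by (rule mult_left_mono) (use y in auto)
      then have "(1 / (2 * y) * (1 / 2)) * \<kappa> \<le> f x * \<rho> n x"
        using r \<kappa> f0[of x] by (intro mult_mono) auto
      then show ?thesis using True by simp
    next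
      case False
      then show ?thesis using f0[of x] r \<kappa> by simp
    qed
  next
    case False
    then have "x \<notin> {E - h/2..E + h/2}" using h by auto
    then show ?thesis using False fz[of x] by simp
  qed
  have "\<kappa> * h / (4 * y) = (\<integral>x. \<kappa> / (4 * y) * indicator {E - h/2..E + h/2} x \<partial>lborel)"
    using h by simp
  also have "\<dots> \<le> (\<integral>x. f x * \<rho> n x \<partial>lborel)"
    by (rule integral_mono[OF _ ipf pt]) (rule integrable_mult_right, rule integrable_real_indicator, use h in simp_all)
  finally have low': "\<kappa> * h / (4 * y) \<le> (\<integral>\<omega>. trace_fun f (Hmat eps n \<omega>) / real (Nsz n) \<partial>Gspace)"
    unfolding ef .
  moreover have "0 < \<kappa> * h / (4 * y)" using \<kappa> h y by simp
  \<comment> \<open>This yields integrability of the trace: a non-integrable function has integral 0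
    by convention, but the integral is bounded below by a positive number.\<close>
  ultimately have "(\<integral>\<omega>. trace_fun f (Hmat eps n \<omega>) / real (Nsz n) \<partial>Gspace) \<noteq> 0" by linarith
  then have it: "integrable Gspace (\<lambda>\<omega>. trace_fun f (Hmat eps n \<omega>) / real (Nsz n))"
    using not_integrable_integral_eq by blast
  have fP: "f e \<le> Im (1 / (complex_of_real e - Complex E y))" for e
  proof (cases "\<bar>e - E\<bar> \<le> y")
    case True
    have "(e - E)\<^sup>2 \<le> y\<^sup>2" using True y by (metis abs_le_square_iff abs_of_pos)
    then have c: "(cmod (complex_of_real e - Complex E y))\<^sup>2 \<le> 2 * y\<^sup>2"
      by (simp add: cmod_power2)
    have cp: "0 < (cmod (complex_of_real e - Complex E y))\<^sup>2"
      using y by (simp add: complex_eq_iff)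
    have "f e \<le> 1 / (2 * y) * 1" unfolding f_def using y h by (intro mult_left_mono) auto
    also have "\<dots> = y / (2 * y\<^sup>2)" using y by (simp add: power2_eq_square)
    also have "\<dots> \<le> y / (cmod (complex_of_real e - Complex E y))\<^sup>2"
      using y c cp by (intro divide_left_mono mult_pos_pos) auto
    finally show ?thesis unfolding Im_inverse_shift by simp
  next
    case False
    then have "f e = 0" using h by (intro fz) auto
    then show ?thesis unfolding Im_inverse_shift using y by simp
  qed
  have le: "trace_fun f (Hmat eps n \<omega>) / real (Nsz n) \<le> Im (ntr (Nsz n) (Hfun eps n \<omega>) (Complex E y))" for \<omega>
  proof -
    obtain es where es: "\<And>z. 0 < Im z \<Longrightarrow> ntr (Nsz n) (Hfun eps n \<omega>) z = (\<Sum>e\<leftarrow>es. 1 / (complex_of_real e - z)) / of_nat (Nsz n)"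
      "\<And>f. trace_fun f (mat (Nsz n) (Nsz n) (\<lambda>(i, j). Hfun eps n \<omega> i j)) = (\<Sum>e\<leftarrow>es. f e)"
      using ntr_spectral[OF msym_Hfun[of "Nsz n" eps n \<omega>]] by metis
    have "(\<Sum>e\<leftarrow>es. f e) / real (Nsz n) \<le> (\<Sum>e\<leftarrow>es. Im (1 / (complex_of_real e - Complex E y))) / real (Nsz n)"
      by (intro divide_right_mono sum_list_mono fP) auto
    moreover have "Im (ntr (Nsz n) (Hfun eps n \<omega>) (Complex E y)) = (\<Sum>e\<leftarrow>es. Im (1 / (complex_of_real e - Complex E y))) / real (Nsz n)"
      using y by (simp only: es(1) complex.sel Im_divide_of_nat Im_sum_list)
    ultimately show ?thesis unfolding Hmat_eq es(2) by linarith
  qed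
  have iI: "integrable Gspace (\<lambda>\<omega>. Im (ntr (Nsz n) (Hfun eps n \<omega>) (Complex E y)))"
  proof (rule Gs.integrable_const_bound[of _ "1 / y"])
    show "AE \<omega> in Gspace. norm (Im (ntr (Nsz n) (Hfun eps n \<omega>) (Complex E y))) \<le> 1 / y"
      using order_trans[OF abs_Im_le_cmod ntr_bound[OF msym_Hfun, of "Complex E y"]] y by (intro AE_I2) simp
  qed measurable
  have "(\<integral>\<omega>. trace_fun f (Hmat eps n \<omega>) / real (Nsz n) \<partial>Gspace)
      \<le> (\<integral>\<omega>. Im (ntr (Nsz n) (Hfun eps n \<omega>) (Complex E y)) \<partial>Gspace)"
    by (rule integral_mono[OF it iI le])
  with low' show ?thesis by linarith
qed

text \<open>Each of N blocks of coordinates moves Im S by at most 2 / (N Im z), so McDiarmid's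
  exponent is of order N (Im z)^2. This is useful only at heights well above N^(-1/2).\<close>

lemma lower_tail:
  assumes z: "0 < Im z" and K: "0 < K"
    and mean: "K \<le> (\<integral>\<omega>. Im (ntr (Nsz n) (Hfun eps n \<omega>) z) \<partial>Gspace)"
  shows "measure Gspace {\<omega>. Im (ntr (Nsz n) (Hfun eps n \<omega>) z) \<le> K / 2} \<le> exp (- (K\<^sup>2 * real (Nsz n) * (Im z)\<^sup>2 / 8))"
proof -
  define N where "N = Nsz n"
  have N: "0 < N" by (simp add: N_def)
  define F where "F \<omega> = - Im (ntr N (Hfun eps n \<omega>) z)" for \<omega>
  \<comment> \<open>Coordinates are keyed by level, smaller site and larger site, so block k carries
    the entries of row k from the diagonal onwards and affects only row and column k.\<close>
  define J :: "nat \<Rightarrow> (nat \<times> nat \<times> nat) set" where "J k = {(r, a, b). a = k + 1}" for k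
  have Fm [measurable]: "F \<in> borel_measurable Gspace" unfolding F_def[abs_def] by measurable
  have c: "0 < 2 / (real N * Im z)" using N z by simp
  have "measure Gspace {\<omega>. F \<omega> \<ge> (\<integral>\<omega>. F \<omega> \<partial>Gspace) + K / 2}
    \<le> exp (- 2 * (K / 2)\<^sup>2 / (real N * (2 / (real N * Im z))\<^sup>2))"
  proof (rule McDiarmid[where J = J, OF Fm _ _ _ _ c N])
    show "\<bar>F \<omega>\<bar> \<le> 1 / Im z" for \<omega>
      using order_trans[OF abs_Im_le_cmod ntr_bound[OF msym_Hfun z N]] by (simp add: F_def)
    show "\<bar>F \<omega> - F \<omega>'\<bar> \<le> 2 / (real N * Im z)" if k: "k < N" and eq: "\<And>i. i \<notin> J k \<Longrightarrow> \<omega> i = \<omega>' i" for k \<omega> \<omega>'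
    proof -
      have "Hfun eps n \<omega> i j = Hfun eps n \<omega>' i j" if "i \<noteq> k" "j \<noteq> k" for i j
        unfolding Hfun_def Phi_def using that
        by (intro sum.cong refl arg_cong2[where f = "(*)"] eq) (auto simp: J_def min_def)
      then have tr: "cmod ((\<Sum>i<N. res N (Hfun eps n \<omega>) z i i) - (\<Sum>i<N. res N (Hfun eps n \<omega>') z i i)) \<le> 2 / Im z"
        by (intro trace_row_change_bound[OF msym_Hfun msym_Hfun z, of _ k]) auto
      have "cmod (ntr N (Hfun eps n \<omega>) z - ntr N (Hfun eps n \<omega>') z) \<le> 2 / Im z / real N"
        unfolding ntr_def diff_divide_distrib[symmetric] norm_divide norm_of_nat
        by (rule divide_right_mono[OF tr]) simp
      moreover have "\<bar>F \<omega> - F \<omega>'\<bar> \<le> cmod (ntr N (Hfun eps n \<omega>) z - ntr N (Hfun eps n \<omega>') z)"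
        using abs_Im_le_cmod[of "ntr N (Hfun eps n \<omega>) z - ntr N (Hfun eps n \<omega>') z"] by (simp add: F_def abs_minus_commute)
      ultimately show ?thesis by (simp add: mult.commute)
    qed
    show "F \<omega> = F \<omega>'" if eq: "\<And>k i. k < N \<Longrightarrow> i \<in> J k \<Longrightarrow> \<omega> i = \<omega>' i" for \<omega> \<omega>'
    proof -
      have "Hfun eps n \<omega> i j = Hfun eps n \<omega>' i j" if "i < N" "j < N" for i j
        unfolding Hfun_def Phi_def using that
        by (intro sum.cong refl arg_cong2[where f = "(*)"] eq[of "min i j"]) (auto simp: J_def min_def)
      from res_cong[OF this] show ?thesis by (simp add: F_def ntr_def)
    qed
    show "0 < K / 2" using K by simp
  qed
  also have "- 2 * (K / 2)\<^sup>2 / (real N * (2 / (real N * Im z))\<^sup>2) = - (K\<^sup>2 * real N * (Im z)\<^sup>2 / 8)"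
    using N z by (simp add: power2_eq_square field_simps)
  finally have "measure Gspace {\<omega>. F \<omega> \<ge> (\<integral>\<omega>. F \<omega> \<partial>Gspace) + K / 2} \<le> exp (- (K\<^sup>2 * real N * (Im z)\<^sup>2 / 8))" .
  moreover have "measure Gspace {\<omega>. Im (ntr N (Hfun eps n \<omega>) z) \<le> K / 2}
      \<le> measure Gspace {\<omega>. F \<omega> \<ge> (\<integral>\<omega>. F \<omega> \<partial>Gspace) + K / 2}"
  proof (rule Gs.finite_measure_mono)
    have "(\<integral>\<omega>. F \<omega> \<partial>Gspace) \<le> - K" using mean by (simp add: F_def N_def)
    then show "{\<omega>. Im (ntr N (Hfun eps n \<omega>) z) \<le> K / 2} \<subseteq> {\<omega>. F \<omega> \<ge> (\<integral>\<omega>. F \<omega> \<partial>Gspace) + K / 2}"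
      by (auto simp: F_def)
    have "{\<omega>\<in>space Gspace. F \<omega> \<ge> (\<integral>\<omega>. F \<omega> \<partial>Gspace) + K / 2} \<in> sets Gspace" by measurable
    then show "{\<omega>. F \<omega> \<ge> (\<integral>\<omega>. F \<omega> \<partial>Gspace) + K / 2} \<in> sets Gspace" by simp
  qed
  ultimately show ?thesis by (simp add: N_def)
qed

subsection \<open>The last Gaussian step\<close>

text \<open>What integration by parts asks of a functional, in a form stable under algebraic
  operations. The bound is existential because it serves integrability only; it may depend on N and
  Im z.\<close>

definition bounded_measurable :: "((nat \<times> nat \<times> nat \<Rightarrow> real) \<Rightarrow> complex) \<Rightarrow> bool" where
  "bounded_measurable f \<longleftrightarrow> f \<in> borel_measurable Gspace \<and> (\<exists>B. \<forall>\<omega>. cmod (f \<omega>) \<le> B)"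

definition coord_deriv :: "nat \<times> nat \<times> nat \<Rightarrow> ((nat \<times> nat \<times> nat \<Rightarrow> real) \<Rightarrow> complex) \<Rightarrow>
    ((nat \<times> nat \<times> nat \<Rightarrow> real) \<Rightarrow> complex) \<Rightarrow> bool" where
  "coord_deriv i f f' \<longleftrightarrow> (\<forall>\<omega> x. ((\<lambda>x. f (fun_upd \<omega> i x)) has_vector_derivative f' (fun_upd \<omega> i x)) (at x))"

lemma bounded_measurableI: "f \<in> borel_measurable Gspace \<Longrightarrow> (\<And>\<omega>. cmod (f \<omega>) \<le> B) \<Longrightarrow> bounded_measurable f"
  by (auto simp: bounded_measurable_def)

lemma bounded_measurable_const: "bounded_measurable (\<lambda>_. c)"
  by (rule bounded_measurableI[of _ "cmod c"]) auto

lemma bounded_measurable_add: "bounded_measurable f \<Longrightarrow> bounded_measurable g \<Longrightarrow> bounded_measurable (\<lambda>\<omega>. f \<omega> + g \<omega>)"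
  unfolding bounded_measurable_def by (auto intro!: borel_measurable_add) (meson add_mono norm_triangle_le)

lemma bounded_measurable_mult: assumes "bounded_measurable f" "bounded_measurable g" shows "bounded_measurable (\<lambda>\<omega>. f \<omega> * g \<omega>)"
proof -
  obtain A B where "\<And>\<omega>. cmod (f \<omega>) \<le> A" "\<And>\<omega>. cmod (g \<omega>) \<le> B" using assms by (auto simp: bounded_measurable_def)
  then have "cmod (f \<omega> * g \<omega>) \<le> A * B" for \<omega>
    unfolding norm_mult by (intro mult_mono) (auto intro: order_trans[OF norm_ge_zero])
  then show ?thesis using assms by (intro bounded_measurableI[of _ "A * B"]) (auto simp: bounded_measurable_def)
qed

lemma bounded_measurable_minus: "bounded_measurable f \<Longrightarrow> bounded_measurable (\<lambda>\<omega>. - f \<omega>)"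
  by (auto simp: bounded_measurable_def)

lemma bounded_measurable_diff: "bounded_measurable f \<Longrightarrow> bounded_measurable g \<Longrightarrow> bounded_measurable (\<lambda>\<omega>. f \<omega> - g \<omega>)"
  using bounded_measurable_add[OF _ bounded_measurable_minus, of f g] by simp

lemma bounded_measurable_cnj: "bounded_measurable f \<Longrightarrow> bounded_measurable (\<lambda>\<omega>. cnj (f \<omega>))"
  unfolding bounded_measurable_def by (auto intro!: borel_measurable_continuous_on[of cnj] continuous_intros)

lemma bounded_measurable_divide: "bounded_measurable f \<Longrightarrow> bounded_measurable (\<lambda>\<omega>. f \<omega> / c)"
  using bounded_measurable_mult[OF _ bounded_measurable_const[of "1 / c"], of f] by simp

lemma bounded_measurable_sum: "(\<And>k. k \<in> K \<Longrightarrow> bounded_measurable (f k)) \<Longrightarrow> bounded_measurable (\<lambda>\<omega>. \<Sum>k\<in>K. f k \<omega>)"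
  by (induction K rule: infinite_finite_induct) (auto intro: bounded_measurable_add bounded_measurable_const)

lemma bounded_measurable_power: "bounded_measurable f \<Longrightarrow> bounded_measurable (\<lambda>\<omega>. f \<omega> ^ n)"
  by (induction n) (auto intro: bounded_measurable_mult bounded_measurable_const)

lemmas bounded_measurable_intros = bounded_measurable_const bounded_measurable_add bounded_measurable_mult bounded_measurable_minus bounded_measurable_diff bounded_measurable_cnj bounded_measurable_divide bounded_measurable_sum bounded_measurable_power

lemma bounded_measurable_integrable: "bounded_measurable f \<Longrightarrow> integrable Gspace f"
  by (auto simp: bounded_measurable_def intro: Gs.integrable_const_bound)

lemma coord_deriv_add: "coord_deriv i f f' \<Longrightarrow> coord_deriv i g g' \<Longrightarrow> coord_deriv i (\<lambda>\<omega>. f \<omega> + g \<omega>) (\<lambda>\<omega>. f' \<omega> + g' \<omega>)"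
  by (auto simp: coord_deriv_def intro: has_vector_derivative_add)

lemma coord_deriv_diff: "coord_deriv i f f' \<Longrightarrow> coord_deriv i g g' \<Longrightarrow> coord_deriv i (\<lambda>\<omega>. f \<omega> - g \<omega>) (\<lambda>\<omega>. f' \<omega> - g' \<omega>)"
  by (auto simp: coord_deriv_def intro: has_vector_derivative_diff)

lemma coord_deriv_mult: "coord_deriv i f f' \<Longrightarrow> coord_deriv i g g' \<Longrightarrow>
    coord_deriv i (\<lambda>\<omega>. f \<omega> * g \<omega>) (\<lambda>\<omega>. f \<omega> * g' \<omega> + f' \<omega> * g \<omega>)"
  by (auto simp: coord_deriv_def intro: has_vector_derivative_mult)

lemma coord_deriv_const: "coord_deriv i (\<lambda>_. c) (\<lambda>_. 0)"
  by (auto simp: coord_deriv_def)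

lemma coord_deriv_cmult: "coord_deriv i f f' \<Longrightarrow> coord_deriv i (\<lambda>\<omega>. c * f \<omega>) (\<lambda>\<omega>. c * f' \<omega>)"
  using coord_deriv_mult[OF coord_deriv_const, of i f f' c] by simp

lemma coord_deriv_cnj: "coord_deriv i f f' \<Longrightarrow> coord_deriv i (\<lambda>\<omega>. cnj (f \<omega>)) (\<lambda>\<omega>. cnj (f' \<omega>))"
  by (auto simp: coord_deriv_def intro: has_vector_derivative_cnj)

lemma coord_deriv_sum: "(\<And>k. k \<in> K \<Longrightarrow> coord_deriv i (f k) (f' k)) \<Longrightarrow> coord_deriv i (\<lambda>\<omega>. \<Sum>k\<in>K. f k \<omega>) (\<lambda>\<omega>. \<Sum>k\<in>K. f' k \<omega>)"
  by (induction K rule: infinite_finite_induct) (auto intro: coord_deriv_add coord_deriv_const)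

lemma coord_deriv_power: "coord_deriv i f f' \<Longrightarrow> coord_deriv i (\<lambda>\<omega>. f \<omega> ^ n) (\<lambda>\<omega>. of_nat n * f \<omega> ^ (n - 1) * f' \<omega>)"
proof (induction n)
  case (Suc n)
  have "(\<lambda>\<omega>. of_nat (Suc n) * f \<omega> ^ n * f' \<omega>) = (\<lambda>\<omega>. f \<omega> * (of_nat n * f \<omega> ^ (n - 1) * f' \<omega>) + f' \<omega> * f \<omega> ^ n)"
    by (cases n) (auto simp: algebra_simps)
  then show ?case using coord_deriv_mult[OF Suc(2) Suc(1)[OF Suc(2)]] by simp
qed (simp add: coord_deriv_const)

text \<open>The imaginary part of c is written (c - cnj c) / (2 i), so that the derivative of the
  weight is a combination of the derivative of S and its conjugate, as it is for the powers of P and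
  cnj P.\<close>

lemma coord_deriv_Im_real:
  assumes f: "coord_deriv i f f'" and h: "\<And>x. (h has_real_derivative h' x) (at x)"
  shows "coord_deriv i (\<lambda>\<omega>. of_real (h (Im (f \<omega>)))) (\<lambda>\<omega>. of_real (h' (Im (f \<omega>))) * ((f' \<omega> - cnj (f' \<omega>)) / (2 * \<i>)))"
  unfolding coord_deriv_def
proof (intro allI)
  fix \<omega> x
  have "((\<lambda>x. Im (f (fun_upd \<omega> i x))) has_real_derivative Im (f' (fun_upd \<omega> i x))) (at x)"
    using f unfolding coord_deriv_def has_vector_derivative_complex_iff by blast
  from has_vector_derivative_of_real[OF DERIV_chain2[OF h this]]
  have "((\<lambda>x. complex_of_real (h (Im (f (fun_upd \<omega> i x))))) has_vector_derivative
    of_real (h' (Im (f (fun_upd \<omega> i x))) * Im (f' (fun_upd \<omega> i x)))) (at x)" .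
  moreover have "complex_of_real (Im c) = (c - cnj c) / (2 * \<i>)" for c
    by (simp add: complex_eq_iff)
  ultimately show "((\<lambda>x. complex_of_real (h (Im (f (fun_upd \<omega> i x))))) has_vector_derivative
    of_real (h' (Im (f (fun_upd \<omega> i x)))) * ((f' (fun_upd \<omega> i x) - cnj (f' (fun_upd \<omega> i x))) / (2 * \<i>))) (at x)"
    by (simp only: of_real_mult)
qed

locale last_step =
  fixes eps :: real and m :: nat and z :: complex
  assumes z: "0 < Im z"
begin

abbreviation "N \<equiv> Nsz (Suc m)"
abbreviation "t \<equiv> tscale eps (Suc m)"

text \<open>\<open>G\<close> is the resolvent of the full matrix at z and \<open>R\<close> that of
  the previous level at the random point w. \<open>B\<close>, \<open>GG\<close>, \<open>BR\<close>
  and \<open>RR\<close> are the products G R, G^2, G R^2 and R^2, and \<open>s1\<close> is the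
  derivative of the previous-level transform at w.\<close>

definition "G i j \<omega> = res N (Hfun eps (Suc m) \<omega>) z i j"
definition "S \<omega> = ntr N (Hfun eps (Suc m) \<omega>) z"
definition "w \<omega> = z + of_real t * S \<omega>"
definition "R i j \<omega> = res N (Hfun eps m \<omega>) (w \<omega>) i j"
definition "S0 \<omega> = ntr N (Hfun eps m \<omega>) (w \<omega>)"
definition "P \<omega> = S \<omega> - S0 \<omega>"
definition "B k l \<omega> = (\<Sum>i<N. G k i \<omega> * R i l \<omega>)"
definition "GG k l \<omega> = (\<Sum>i<N. G k i \<omega> * G i l \<omega>)"
definition "BR k l \<omega> = (\<Sum>i<N. B k i \<omega> * R i l \<omega>)"
definition "RR i j \<omega> = (\<Sum>k<N. R i k \<omega> * R k j \<omega>)"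
definition "s1 \<omega> = (\<Sum>i<N. RR i i \<omega>) / of_nat N"
definition "coord k l = (Suc m, min (k + 1) (l + 1), max (k + 1) (l + 1))" for k l :: nat
definition "amp k l = sqrt t * sqrt (var_entry (Suc m) (k + 1) (l + 1))" for k l :: nat
definition "V k l \<omega> = amp k l * \<omega> (coord k l)" for k l :: nat and \<omega> :: "nat \<times> nat \<times> nat \<Rightarrow> real"
definition "amp' k l = amp k l / (if k = l then 2 else 1)" for k l :: nat

lemma t_pos: "0 < t" by (simp add: tscale_def)

lemma S_Im: "0 < Im (S \<omega>)" unfolding S_def by (rule ntr_Im_pos[OF msym_Hfun z]) simp

lemma w_Im: "Im (w \<omega>) = Im z + t * Im (S \<omega>)" by (simp add: w_def)

lemma w_Im_pos: "0 < Im (w \<omega>)" using z t_pos S_Im[of \<omega>] by (simp add: w_Im add_pos_pos)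

lemma w_Im_ge: "Im z \<le> Im (w \<omega>)" using t_pos S_Im[of \<omega>] by (simp add: w_Im)

lemma H_split: "Hfun eps (Suc m) \<omega> k l = Hfun eps m \<omega> k l + V k l \<omega>"
  by (simp add: Hfun_Suc V_def amp_def coord_def Phi_def mult.assoc)

text \<open>A diagonal entry has twice the variance but moves along \<open>E\<^sub>k\<^sub>k\<close> instead of \<open>E\<^sub>k\<^sub>l + E\<^sub>l\<^sub>k\<close>; after
  halving its amplitude both cases obey the same integration by parts formula.\<close>
lemma amp_product: "k < N \<Longrightarrow> l < N \<Longrightarrow> amp k l * amp' k l = t / N"
proof -
  assume k: "k < N" and l: "l < N"
  have "amp k l * amp' k l = (sqrt t * sqrt t) * (sqrt (var_entry (Suc m) (k + 1) (l + 1)) * sqrt (var_entry (Suc m) (k + 1) (l + 1))) / (if k = l then 2 else 1)"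
    by (simp only: amp_def amp'_def times_divide_eq_right ac_simps)
  also have "\<dots> = t * var_entry (Suc m) (k + 1) (l + 1) / (if k = l then 2 else 1)"
    using t_pos unfolding var_entry_top[OF k l] by (simp only: real_sqrt_mult_self) simp
  also have "\<dots> = t / N" unfolding var_entry_top[OF k l] by simp
  finally show ?thesis .
qed

lemma amp_sym: "amp k l = amp l k"
  by (simp only: amp_def var_entry_def hdist_sym[of "k + 1" "l + 1"])

lemma G_sym: "i < N \<Longrightarrow> j < N \<Longrightarrow> G i j \<omega> = G j i \<omega>"
  unfolding G_def by (rule res_sym[OF msym_Hfun z])

lemma R_sym: "i < N \<Longrightarrow> j < N \<Longrightarrow> R i j \<omega> = R j i \<omega>"
  unfolding R_def by (rule res_sym[OF msym_Hfun w_Im_pos])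

lemma S_eq: "of_nat N * S \<omega> = (\<Sum>i<N. G i i \<omega>)"
  by (simp add: S_def ntr_def G_def)

text \<open>The trace of the resolvent identity between (full matrix, z) and (previous level, w),
  where z - w = - t S and the matrices differ by V. Symmetry of G and R regroups the second term as
  a sum of V_kl against entries of G R.\<close>

lemma self_consistency_defect:
  "of_nat N * P \<omega> = - (of_real t * S \<omega> * (\<Sum>i<N. B i i \<omega>)) - (\<Sum>k<N. \<Sum>l<N. of_real (V k l \<omega>) * B k l \<omega>)"
proof -
  have "of_nat N * P \<omega> = (\<Sum>i<N. G i i \<omega> - R i i \<omega>)"
    by (simp add: P_def S_def S0_def ntr_def G_def R_def sum_subtractf right_diff_distrib)
  also have "\<dots> = (\<Sum>i<N. - (of_real t * S \<omega>) * B i i \<omega>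
      - (\<Sum>k<N. \<Sum>l<N. G i k \<omega> * of_real (V k l \<omega>) * R l i \<omega>))"
  proof (rule sum.cong[OF refl])
    fix i assume "i \<in> {..<N}"
    then have i: "i < N" by simp
    show "G i i \<omega> - R i i \<omega> = - (of_real t * S \<omega>) * B i i \<omega> - (\<Sum>k<N. \<Sum>l<N. G i k \<omega> * of_real (V k l \<omega>) * R l i \<omega>)"
      using resolvent_identity[OF msym_Hfun[of N eps m \<omega>] msym_Hfun[of N eps "Suc m" \<omega>] w_Im_pos[of \<omega>] z i i]
      by (simp add: G_def R_def B_def H_split w_def)
  qed
  also have "\<dots> = - (of_real t * S \<omega> * (\<Sum>i<N. B i i \<omega>)) - (\<Sum>i<N. \<Sum>k<N. \<Sum>l<N. G i k \<omega> * of_real (V k l \<omega>) * R l i \<omega>)"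
    by (simp add: sum_subtractf sum_distrib_left sum_negf)
  also have "(\<Sum>i<N. \<Sum>k<N. \<Sum>l<N. G i k \<omega> * of_real (V k l \<omega>) * R l i \<omega>)
      = (\<Sum>k<N. \<Sum>l<N. \<Sum>i<N. G i k \<omega> * of_real (V k l \<omega>) * R l i \<omega>)"
  proof -
    have "(\<Sum>i<N. \<Sum>k<N. \<Sum>l<N. G i k \<omega> * of_real (V k l \<omega>) * R l i \<omega>)
      = (\<Sum>k<N. \<Sum>i<N. \<Sum>l<N. G i k \<omega> * of_real (V k l \<omega>) * R l i \<omega>)" by (rule sum.swap)
    also have "\<dots> = (\<Sum>k<N. \<Sum>l<N. \<Sum>i<N. G i k \<omega> * of_real (V k l \<omega>) * R l i \<omega>)"
      by (rule sum.cong[OF refl]) (rule sum.swap)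
    finally show ?thesis .
  qed
  also have "\<dots> = (\<Sum>k<N. \<Sum>l<N. of_real (V k l \<omega>) * B k l \<omega>)"
    unfolding B_def sum_distrib_left
  proof (intro sum.cong refl)
    fix k l i assume "k \<in> {..<N}" "l \<in> {..<N}" "i \<in> {..<N}"
    then have "G i k \<omega> = G k i \<omega>" "R l i \<omega> = R i l \<omega>" by (auto intro: G_sym R_sym)
    then show "G i k \<omega> * of_real (V k l \<omega>) * R l i \<omega> = of_real (V k l \<omega>) * (G k i \<omega> * R i l \<omega>)" by simp
  qed
  finally show ?thesis .
qed

lemma Hfun_update_coordinate:
  assumes k: "k < N" and l: "l < N" and i: "i < N" and j: "j < N"
  shows "Hfun eps (Suc m) (fun_upd \<omega> (coord k l) x) i j
    = Hfun eps (Suc m) (fun_upd \<omega> (coord k l) 0) i j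
      + x * (amp' k l * ((if i = k \<and> j = l then 1 else 0) + (if i = l \<and> j = k then 1 else 0)))"
proof -
  have A: "Hfun eps m (fun_upd \<omega> (coord k l) x) i j = Hfun eps m \<omega> i j" for x
    unfolding Hfun_def Phi_def coord_def by (intro sum.cong refl) auto
  have c: "coord i j = coord k l \<longleftrightarrow> (i = k \<and> j = l) \<or> (i = l \<and> j = k)"
    by (auto simp: coord_def min_def max_def split: if_splits)
  have a: "amp i j = amp k l" if "coord i j = coord k l"
    using that amp_sym[of k l] unfolding c by auto
  show ?thesis
  proof (cases "coord i j = coord k l")
    case True
    have "amp' k l * ((if i = k \<and> j = l then 1 else 0) + (if i = l \<and> j = k then 1 else 0)) = amp k l"
      using True unfolding c by (auto simp: amp'_def)
    then show ?thesis unfolding H_split A V_def a[OF True] True by (simp only: fun_upd_same) simp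
  next
    case False
    then have d: "(if i = k \<and> j = l then 1 else 0) = (0::real)" "(if i = l \<and> j = k then 1 else 0) = (0::real)"
      unfolding c by auto
    show ?thesis unfolding H_split A V_def d fun_upd_other[OF False] by simp
  qed
qed

lemma H0_const: "Hfun eps m (fun_upd \<omega> (coord k l) x) = Hfun eps m \<omega>"
  unfolding Hfun_def Phi_def coord_def by (intro ext sum.cong refl) auto

lemma double_delta_sum:
  fixes f :: "nat \<Rightarrow> nat \<Rightarrow> complex"
  assumes "k < N" "l < N"
  shows "(\<Sum>a<N. \<Sum>b<N. f a b * of_real (c * ((if a = k \<and> b = l then 1 else 0) + (if a = l \<and> b = k then 1 else 0))))
    = of_real c * (f k l + f l k)"
proof -
  have one: "(\<Sum>a<N. \<Sum>b<N. f a b * of_real (if a = k \<and> b = l then 1 else 0)) = f k l" if "k < N" "l < N" for k l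
  proof -
    have "(\<Sum>a<N. \<Sum>b<N. f a b * of_real (if a = k \<and> b = l then 1 else 0))
       = (\<Sum>a<N. (\<Sum>b<N. f a b * (if b = l then 1 else 0)) * (if a = k then 1 else 0))"
      unfolding sum_distrib_right by (intro sum.cong refl) auto
    then show ?thesis using that by (simp add: sum_mult_indicator_eq)
  qed
  have "(\<Sum>a<N. \<Sum>b<N. f a b * of_real (c * ((if a = k \<and> b = l then 1 else 0) + (if a = l \<and> b = k then 1 else 0))))
    = of_real c * ((\<Sum>a<N. \<Sum>b<N. f a b * of_real (if a = k \<and> b = l then 1 else 0))
      + (\<Sum>a<N. \<Sum>b<N. f a b * of_real (if a = l \<and> b = k then 1 else 0)))"
  proof -
    have "f a b * of_real (c * (x + y)) = of_real c * (f a b * of_real x) + of_real c * (f a b * of_real y)"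
      for a b and x y :: real by (simp only: of_real_mult of_real_add distrib_left ac_simps)
    then show ?thesis by (simp only: sum.distrib sum_distrib_left distrib_left)
  qed
  then show ?thesis by (simp only: one[OF assms] one[OF assms(2) assms(1)])
qed

lemma coord_deriv_G:
  assumes k: "k < N" and l: "l < N" and i: "i < N" and j: "j < N"
  shows "coord_deriv (coord k l) (G i j) (\<lambda>\<omega>. of_real (amp' k l) * - (G i k \<omega> * G l j \<omega> + G i l \<omega> * G k j \<omega>))"
  unfolding coord_deriv_def
proof (intro allI)
  fix \<omega> x
  define A where "A = Hfun eps (Suc m) (fun_upd \<omega> (coord k l) 0)"
  define K where "K a b = amp' k l * ((if a = k \<and> b = l then 1 else 0) + (if a = l \<and> b = k then 1 else 0))" for a b :: nat
  have "K a b = K b a" for a b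
    unfolding K_def by (cases "a = k"; cases "b = l"; cases "a = l"; cases "b = k"; simp)
  then have Ks: "msym N K" by (simp add: msym_def)
  have Geq: "G a b (fun_upd \<omega> (coord k l) x) = res N (\<lambda>i j. A i j + x * K i j) z a b" for x a b
  proof -
    have "res N (Hfun eps (Suc m) (fun_upd \<omega> (coord k l) x)) = res N (\<lambda>i j. A i j + x * K i j)"
      by (rule res_cong) (unfold A_def K_def, rule Hfun_update_coordinate[OF k l])
    then show ?thesis by (simp add: G_def)
  qed
  have "((\<lambda>x. G i j (fun_upd \<omega> (coord k l) x)) has_vector_derivative
      - (\<Sum>a<N. \<Sum>b<N. G i a (fun_upd \<omega> (coord k l) x) * of_real (K a b) * G b j (fun_upd \<omega> (coord k l) x))) (at x)"
    unfolding Geq by (rule res_line_derivative[OF _ Ks z i j]) (simp add: A_def)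
  also have "(\<Sum>a<N. \<Sum>b<N. G i a (fun_upd \<omega> (coord k l) x) * of_real (K a b) * G b j (fun_upd \<omega> (coord k l) x))
    = (\<Sum>a<N. \<Sum>b<N. (G i a (fun_upd \<omega> (coord k l) x) * G b j (fun_upd \<omega> (coord k l) x)) * of_real (K a b))"
    by (intro sum.cong refl) (simp only: ac_simps)
  also have "\<dots> = of_real (amp' k l) * (G i k (fun_upd \<omega> (coord k l) x) * G l j (fun_upd \<omega> (coord k l) x)
      + G i l (fun_upd \<omega> (coord k l) x) * G k j (fun_upd \<omega> (coord k l) x))"
    unfolding K_def by (rule double_delta_sum[OF k l])
  finally show "((\<lambda>x. G i j (fun_upd \<omega> (coord k l) x)) has_vector_derivative
    of_real (amp' k l) * - (G i k (fun_upd \<omega> (coord k l) x) * G l j (fun_upd \<omega> (coord k l) x)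
      + G i l (fun_upd \<omega> (coord k l) x) * G k j (fun_upd \<omega> (coord k l) x))) (at x)"
    by (simp only: mult_minus_right)
qed

lemma coord_deriv_S:
  assumes k: "k < N" and l: "l < N"
  shows "coord_deriv (coord k l) S (\<lambda>\<omega>. of_real (amp' k l) * (- 2 / of_nat N * GG k l \<omega>))"
proof -
  have "coord_deriv (coord k l) (\<lambda>\<omega>. (1 / of_nat N) * (\<Sum>i<N. G i i \<omega>))
    (\<lambda>\<omega>. (1 / of_nat N) * (\<Sum>i<N. of_real (amp' k l) * - (G i k \<omega> * G l i \<omega> + G i l \<omega> * G k i \<omega>)))"
    by (intro coord_deriv_cmult coord_deriv_sum coord_deriv_G k l) auto
  also have "(\<lambda>\<omega>. (1 / of_nat N) * (\<Sum>i<N. G i i \<omega>)) = S"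
    by (auto simp: S_eq[symmetric] fun_eq_iff)
  also have "(\<lambda>\<omega>. (1 / of_nat N) * (\<Sum>i<N. of_real (amp' k l) * - (G i k \<omega> * G l i \<omega> + G i l \<omega> * G k i \<omega>)))
    = (\<lambda>\<omega>. of_real (amp' k l) * (- 2 / of_nat N * GG k l \<omega>))"
  proof
    fix \<omega>
    have "(\<Sum>i<N. of_real (amp' k l) * - (G i k \<omega> * G l i \<omega> + G i l \<omega> * G k i \<omega>))
      = (\<Sum>i<N. of_real (amp' k l) * (- 2 * (G k i \<omega> * G i l \<omega>)))"
    proof (rule sum.cong[OF refl])
      fix i assume "i \<in> {..<N}"
      then have "G i k \<omega> = G k i \<omega>" "G l i \<omega> = G i l \<omega>" using k l by (auto intro: G_sym)
      then show "of_real (amp' k l) * - (G i k \<omega> * G l i \<omega> + G i l \<omega> * G k i \<omega>)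
        = of_real (amp' k l) * (- 2 * (G k i \<omega> * G i l \<omega>))" by simp
    qed
    then show "(1 / of_nat N) * (\<Sum>i<N. of_real (amp' k l) * - (G i k \<omega> * G l i \<omega> + G i l \<omega> * G k i \<omega>))
      = of_real (amp' k l) * (- 2 / of_nat N * GG k l \<omega>)"
      unfolding GG_def sum_distrib_left[symmetric] by simp
  qed
  finally show ?thesis .
qed

lemma coord_deriv_w:
  assumes k: "k < N" and l: "l < N"
  shows "coord_deriv (coord k l) w (\<lambda>\<omega>. of_real t * (of_real (amp' k l) * (- 2 / of_nat N * GG k l \<omega>)))"
  using coord_deriv_add[OF coord_deriv_const coord_deriv_cmult[OF coord_deriv_S[OF k l]], of z "of_real t"]
  by (simp add: w_def[abs_def])

text \<open>The matrix of the previous level does not contain this coordinate; R depends on it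
  through w alone, whence the chain rule with derivative R^2 in w.\<close>

lemma coord_deriv_R:
  assumes k: "k < N" and l: "l < N" and i: "i < N" and j: "j < N"
  shows "coord_deriv (coord k l) (R i j) (\<lambda>\<omega>. of_real t * (of_real (amp' k l) * (- 2 / of_nat N * GG k l \<omega>)) * RR i j \<omega>)"
  unfolding coord_deriv_def
proof (intro allI)
  fix \<omega> :: "nat \<times> nat \<times> nat \<Rightarrow> real" and x :: real
  let ?\<omega> = "\<lambda>x. fun_upd \<omega> (coord k l) x"
  have dw: "((\<lambda>x. w (?\<omega> x)) has_vector_derivative of_real t * (of_real (amp' k l) * (- 2 / of_nat N * GG k l (?\<omega> x)))) (at x)"
    using coord_deriv_w[OF k l] unfolding coord_deriv_def by blast
  have "((\<lambda>v. res N (Hfun eps m \<omega>) v i j) has_field_derivative RR i j (?\<omega> x)) (at (w (?\<omega> x)))"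
    using res_param_derivative[OF msym_Hfun[of N eps m \<omega>] w_Im_pos[of "?\<omega> x"] i j]
    by (simp add: RR_def R_def H0_const)
  from field_vector_diff_chain_at[OF dw this]
  show "((\<lambda>x. R i j (?\<omega> x)) has_vector_derivative
    of_real t * (of_real (amp' k l) * (- 2 / of_nat N * GG k l (?\<omega> x))) * RR i j (?\<omega> x)) (at x)"
    by (simp only: o_def R_def H0_const)
qed

text \<open>The previous-level transform follows S through w with slope t s1, so the defect inherits
  the derivative of S times 1 - t s1.\<close>

lemma coord_deriv_P:
  assumes k: "k < N" and l: "l < N"
  shows "coord_deriv (coord k l) P (\<lambda>\<omega>. of_real (amp' k l) * (- 2 / of_nat N * GG k l \<omega>) * (1 - of_real t * s1 \<omega>))"
proof -
  let ?d = "\<lambda>\<omega>. of_real (amp' k l) * (- 2 / of_nat N * GG k l \<omega>)"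
  have "coord_deriv (coord k l) (\<lambda>\<omega>. (1 / of_nat N) * (\<Sum>i<N. R i i \<omega>)) (\<lambda>\<omega>. (1 / of_nat N) * (\<Sum>i<N. of_real t * ?d \<omega> * RR i i \<omega>))"
    by (intro coord_deriv_cmult coord_deriv_sum coord_deriv_R k l) auto
  from coord_deriv_diff[OF coord_deriv_S[OF k l] this]
  have "coord_deriv (coord k l) (\<lambda>\<omega>. S \<omega> - (1 / of_nat N) * (\<Sum>i<N. R i i \<omega>))
     (\<lambda>\<omega>. ?d \<omega> - (1 / of_nat N) * (\<Sum>i<N. of_real t * ?d \<omega> * RR i i \<omega>))" .
  also have "(\<lambda>\<omega>. S \<omega> - (1 / of_nat N) * (\<Sum>i<N. R i i \<omega>)) = P"
    by (auto simp: P_def S0_def ntr_def R_def fun_eq_iff)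
  also have "(\<lambda>\<omega>. ?d \<omega> - (1 / of_nat N) * (\<Sum>i<N. of_real t * ?d \<omega> * RR i i \<omega>)) = (\<lambda>\<omega>. ?d \<omega> * (1 - of_real t * s1 \<omega>))"
  proof
    fix \<omega>
    have "D - (1 / of_nat N) * (\<Sum>i<N. of_real t * D * RR i i \<omega>) = D * (1 - of_real t * s1 \<omega>)" for D
      unfolding s1_def sum_distrib_left[symmetric] by (simp add: algebra_simps)
    then show "?d \<omega> - (1 / of_nat N) * (\<Sum>i<N. of_real t * ?d \<omega> * RR i i \<omega>) = ?d \<omega> * (1 - of_real t * s1 \<omega>)" .
  qed
  finally show ?thesis .
qed

text \<open>The product G_kk B_ll is the important one: summed over k and l it factors into N S Tr
  (G R). The product G_kl B_kl carries no free trace, and the last summand is the effect of moving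
  w.\<close>

lemma coord_deriv_B:
  assumes k: "k < N" and l: "l < N"
  shows "coord_deriv (coord k l) (B k l) (\<lambda>\<omega>. of_real (amp' k l) *
     (- (G k k \<omega> * B l l \<omega> + G k l \<omega> * B k l \<omega>) - 2 * of_real t / of_nat N * GG k l \<omega> * BR k l \<omega>))"
proof -
  let ?dw = "\<lambda>\<omega>. of_real t * (of_real (amp' k l) * (- 2 / of_nat N * GG k l \<omega>))"
  have "coord_deriv (coord k l) (B k l) (\<lambda>\<omega>. \<Sum>i<N. G k i \<omega> * (?dw \<omega> * RR i l \<omega>)
      + of_real (amp' k l) * - (G k k \<omega> * G l i \<omega> + G k l \<omega> * G k i \<omega>) * R i l \<omega>)"
    unfolding B_def[abs_def] by (intro coord_deriv_sum coord_deriv_mult coord_deriv_G coord_deriv_R k l) auto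
  also have "(\<lambda>\<omega>. \<Sum>i<N. G k i \<omega> * (?dw \<omega> * RR i l \<omega>)
      + of_real (amp' k l) * - (G k k \<omega> * G l i \<omega> + G k l \<omega> * G k i \<omega>) * R i l \<omega>)
    = (\<lambda>\<omega>. of_real (amp' k l) *
     (- (G k k \<omega> * B l l \<omega> + G k l \<omega> * B k l \<omega>) - 2 * of_real t / of_nat N * GG k l \<omega> * BR k l \<omega>))"
  proof
    fix \<omega>
    have "(\<Sum>i<N. G k i \<omega> * RR i l \<omega>) = (\<Sum>i<N. \<Sum>j<N. G k i \<omega> * R i j \<omega> * R j l \<omega>)"
      by (simp add: RR_def sum_distrib_left mult.assoc)
    also have "\<dots> = BR k l \<omega>"
      by (subst sum.swap) (simp add: BR_def B_def sum_distrib_right)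
    finally have 1: "(\<Sum>i<N. G k i \<omega> * (?dw \<omega> * RR i l \<omega>)) = ?dw \<omega> * BR k l \<omega>"
      by (simp only: mult.left_commute[of "G k _ \<omega>"] sum_distrib_left[symmetric])
    have 2: "(\<Sum>i<N. of_real (amp' k l) * - (G k k \<omega> * G l i \<omega> + G k l \<omega> * G k i \<omega>) * R i l \<omega>)
      = of_real (amp' k l) * - (G k k \<omega> * B l l \<omega> + G k l \<omega> * B k l \<omega>)"
      unfolding B_def sum_distrib_left sum.distrib[symmetric] sum_negf[symmetric]
      by (rule sum.cong[OF refl]) (simp only: distrib_right distrib_left minus_add_distrib mult_minus_left mult_minus_right ac_simps)
    show "(\<Sum>i<N. G k i \<omega> * (?dw \<omega> * RR i l \<omega>)
      + of_real (amp' k l) * - (G k k \<omega> * G l i \<omega> + G k l \<omega> * G k i \<omega>) * R i l \<omega>)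
      = of_real (amp' k l) *
     (- (G k k \<omega> * B l l \<omega> + G k l \<omega> * B k l \<omega>) - 2 * of_real t / of_nat N * GG k l \<omega> * BR k l \<omega>)"
      unfolding sum.distrib 1 2 by (simp add: algebra_simps)
  qed
  finally show ?thesis .
qed

lemma bounded_measurable_G: "i < N \<Longrightarrow> j < N \<Longrightarrow> bounded_measurable (G i j)"
  unfolding G_def[abs_def]
  by (rule bounded_measurableI[OF measurable_res res_entry_bound[OF msym_Hfun z]]) (auto intro: measurable_Hfun)

lemma measurable_S [measurable]: "S \<in> borel_measurable Gspace"
  unfolding S_def[abs_def] by measurable

lemma measurable_w [measurable]: "w \<in> borel_measurable Gspace"
  unfolding w_def[abs_def] by measurable

lemma bounded_measurable_S: "bounded_measurable S"
  by (rule bounded_measurableI) (measurable, unfold S_def, rule ntr_bound[OF msym_Hfun z], simp)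

lemma bounded_measurable_R: assumes "i < N" "j < N" shows "bounded_measurable (R i j)"
proof (rule bounded_measurableI[of _ "1 / Im z"])
  show "R i j \<in> borel_measurable Gspace"
    unfolding R_def[abs_def] by (intro measurable_res measurable_Hfun measurable_w assms)
  show "cmod (R i j \<omega>) \<le> 1 / Im z" for \<omega>
    using res_entry_bound[OF msym_Hfun w_Im_pos assms, of eps m \<omega> \<omega>] w_Im_ge[of \<omega>] z
    unfolding R_def by (intro order_trans[OF _ divide_left_mono[of "Im z" "Im (w \<omega>)" 1]]) auto
qed

lemma S0_eq: "S0 \<omega> = (\<Sum>i<N. R i i \<omega>) / of_nat N"
  by (simp add: S0_def ntr_def R_def)

lemma bounded_measurable_B: "k < N \<Longrightarrow> l < N \<Longrightarrow> bounded_measurable (B k l)"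
  unfolding B_def[abs_def] by (intro bounded_measurable_intros bounded_measurable_G bounded_measurable_R) auto

lemma bounded_measurable_GG: "k < N \<Longrightarrow> l < N \<Longrightarrow> bounded_measurable (GG k l)"
  unfolding GG_def[abs_def] by (intro bounded_measurable_intros bounded_measurable_G) auto

lemma bounded_measurable_BR: "k < N \<Longrightarrow> l < N \<Longrightarrow> bounded_measurable (BR k l)"
  unfolding BR_def[abs_def] by (intro bounded_measurable_intros bounded_measurable_B bounded_measurable_R) auto

lemma bounded_measurable_s1: "bounded_measurable s1"
  unfolding s1_def[abs_def] RR_def by (intro bounded_measurable_intros bounded_measurable_R) auto

lemma bounded_measurable_P: "bounded_measurable P"
  unfolding P_def[abs_def] S0_eq by (intro bounded_measurable_intros bounded_measurable_S bounded_measurable_R) auto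

end

text \<open>\<open>chi\<close> is the weight of the self-consistency defect: it is at most \<open>u\<close> and bounded together with its
  derivative, which pays for the factors \<open>t / Im w \<le> 1 / Im S\<close> in the moment estimate.\<close>
definition chi :: "real \<Rightarrow> real" where "chi u = u / (1 + u\<^sup>2)"
definition chi' :: "real \<Rightarrow> real" where "chi' u = (1 - u\<^sup>2) / (1 + u\<^sup>2)\<^sup>2"

lemma chi_pos_denom: "0 < 1 + (u::real)\<^sup>2"
  by (simp add: add_pos_nonneg)

lemma chi_deriv: "(chi has_real_derivative chi' u) (at u)"
proof -
  have "(\<lambda>u. u / (1 + u\<^sup>2)) = chi" by (simp add: chi_def fun_eq_iff)
  moreover have "((\<lambda>u::real. u / (1 + u\<^sup>2)) has_real_derivative (1 * (1 + u\<^sup>2) - u * (2 * u)) / ((1 + u\<^sup>2) * (1 + u\<^sup>2))) (at u)"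
    using chi_pos_denom[of u] by (intro DERIV_divide) (auto intro!: derivative_eq_intros)
  ultimately show ?thesis by (simp add: chi'_def power2_eq_square)
qed

lemma chi_nonneg: "0 \<le> u \<Longrightarrow> 0 \<le> chi u"
  using chi_pos_denom[of u] by (simp add: chi_def)

lemma chi_le_1: "\<bar>chi u\<bar> \<le> 1"
proof -
  have "0 \<le> (\<bar>u\<bar> - 1)\<^sup>2" by simp
  then have "\<bar>u\<bar> \<le> 1 + u\<^sup>2" by (simp add: power2_diff)
  then show ?thesis using chi_pos_denom[of u] by (simp add: chi_def abs_divide)
qed

lemma chi_le_id: "0 \<le> u \<Longrightarrow> chi u \<le> u"
  using chi_pos_denom[of u] by (simp add: chi_def divide_le_eq mult_le_cancel_left1) 

lemma chi'_le_1: "\<bar>chi' u\<bar> \<le> 1"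
proof -
  have "\<bar>1 - u\<^sup>2\<bar> \<le> 1 + u\<^sup>2" by (simp add: abs_le_iff)
  also have "\<dots> \<le> (1 + u\<^sup>2)\<^sup>2" by (rule self_le_power) auto
  finally show ?thesis using chi_pos_denom[of u] by (simp add: chi'_def abs_divide)
qed

context last_step
begin

definition "X \<omega> = complex_of_real (chi (Im (S \<omega>)))"
definition "X' \<omega> = complex_of_real (chi' (Im (S \<omega>)))"
text \<open>The modulus of chi P to the power 2 p with one factor P removed; that factor is the one
  expanded by the defect identity.\<close>

definition "Psi p \<omega> = X \<omega> ^ (2 * p) * (cnj (P \<omega>) ^ p * P \<omega> ^ (p - 1))"
definition "\<delta> k l \<omega> = - 2 / of_nat N * GG k l \<omega>"
definition "pf \<omega> = 1 - of_real t * s1 \<omega>"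
text \<open>\<open>Aa\<close> and \<open>Ba\<close> below are the coefficients of
  \<open>\<delta>\<close> and of its conjugate in the derivative of \<open>Psi\<close>: the first
  summand comes from the weight, the second from the powers of P or of its conjugate. At p = 1 the
  truncated exponent p - 1 - 1 does no harm, its coefficient p - 1 being 0.\<close>

definition "Q \<omega> = chi (Im (S \<omega>)) * cmod (P \<omega>)"
definition "Aa p \<omega> = of_nat (2 * p) * X \<omega> ^ (2 * p - 1) * (X' \<omega> / (2 * \<i>)) * (cnj (P \<omega>) ^ p * P \<omega> ^ (p - 1))
  + X \<omega> ^ (2 * p) * (cnj (P \<omega>) ^ p * (of_nat (p - 1) * P \<omega> ^ (p - 1 - 1) * pf \<omega>))"
definition "Ba p \<omega> = - (of_nat (2 * p) * X \<omega> ^ (2 * p - 1) * (X' \<omega> / (2 * \<i>)) * (cnj (P \<omega>) ^ p * P \<omega> ^ (p - 1)))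
  + X \<omega> ^ (2 * p) * ((of_nat p * cnj (P \<omega>) ^ (p - 1) * cnj (pf \<omega>)) * P \<omega> ^ (p - 1))"

lemma bounded_measurable_X: "bounded_measurable X" and bounded_measurable_X': "bounded_measurable X'"
proof -
  have "continuous_on UNIV chi" "continuous_on UNIV chi'"
    unfolding chi_def[abs_def] chi'_def[abs_def]
    using chi_pos_denom by (auto intro!: continuous_intros simp: less_imp_neq[symmetric] add_nonneg_eq_0_iff)
  then have [measurable]: "chi \<in> borel_measurable borel" "chi' \<in> borel_measurable borel"
    by (auto intro: borel_measurable_continuous_onI)
  show "bounded_measurable X" unfolding X_def[abs_def]
    by (rule bounded_measurableI[of _ 1]) (measurable, simp add: chi_le_1)
  show "bounded_measurable X'" unfolding X'_def[abs_def]
    by (rule bounded_measurableI[of _ 1]) (measurable, simp add: chi'_le_1)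
qed

lemma bounded_measurable_Psi: "bounded_measurable (Psi p)"
  unfolding Psi_def[abs_def] by (intro bounded_measurable_intros bounded_measurable_X bounded_measurable_P)

lemma bounded_measurable_\<delta>: "k < N \<Longrightarrow> l < N \<Longrightarrow> bounded_measurable (\<delta> k l)"
  unfolding \<delta>_def[abs_def] by (intro bounded_measurable_intros bounded_measurable_GG)

lemma bounded_measurable_Aa: "bounded_measurable (Aa p)" and bounded_measurable_Ba: "bounded_measurable (Ba p)"
  unfolding Aa_def[abs_def] Ba_def[abs_def] pf_def
  by (intro bounded_measurable_intros bounded_measurable_X bounded_measurable_X' bounded_measurable_P bounded_measurable_s1)+

lemma coord_deriv_Psi:
  assumes k: "k < N" and l: "l < N"
  shows "coord_deriv (coord k l) (Psi p) (\<lambda>\<omega>. of_real (amp' k l) * (Aa p \<omega> * \<delta> k l \<omega> + Ba p \<omega> * cnj (\<delta> k l \<omega>)))"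
proof -
  let ?a = "complex_of_real (amp' k l)"
  have dS: "coord_deriv (coord k l) S (\<lambda>\<omega>. ?a * \<delta> k l \<omega>)"
    using coord_deriv_S[OF k l] by (simp only: \<delta>_def)
  have dX: "coord_deriv (coord k l) X (\<lambda>\<omega>. X' \<omega> * ((?a * \<delta> k l \<omega> - cnj (?a * \<delta> k l \<omega>)) / (2 * \<i>)))"
    unfolding X_def[abs_def] X'_def by (rule coord_deriv_Im_real[OF dS chi_deriv])
  have dP: "coord_deriv (coord k l) P (\<lambda>\<omega>. ?a * \<delta> k l \<omega> * pf \<omega>)"
    using coord_deriv_P[OF k l] by (simp only: \<delta>_def pf_def)
  have "coord_deriv (coord k l) (Psi p) (\<lambda>\<omega>. X \<omega> ^ (2 * p) *
      (cnj (P \<omega>) ^ p * (of_nat (p - 1) * P \<omega> ^ (p - 1 - 1) * (?a * \<delta> k l \<omega> * pf \<omega>))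
       + (of_nat p * cnj (P \<omega>) ^ (p - 1) * cnj (?a * \<delta> k l \<omega> * pf \<omega>)) * P \<omega> ^ (p - 1))
      + (of_nat (2 * p) * X \<omega> ^ (2 * p - 1) * (X' \<omega> * ((?a * \<delta> k l \<omega> - cnj (?a * \<delta> k l \<omega>)) / (2 * \<i>))))
       * (cnj (P \<omega>) ^ p * P \<omega> ^ (p - 1)))" (is "coord_deriv _ _ ?D")
    unfolding Psi_def[abs_def] by (intro coord_deriv_mult coord_deriv_power coord_deriv_cnj dX dP)
  also have "?D = (\<lambda>\<omega>. ?a * (Aa p \<omega> * \<delta> k l \<omega> + Ba p \<omega> * cnj (\<delta> k l \<omega>)))"
  proof
    fix \<omega>
    have gen: "x2 * (c * (n1 * q * (a * d * f)) + n2 * c1 * (a * e * g) * r) + (n3 * x1 * (y * ((a * d - a * e) / h))) * (c * r)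
      = a * ((n3 * x1 * (y / h) * (c * r) + x2 * (c * (n1 * q * f))) * d
         + (- (n3 * x1 * (y / h) * (c * r)) + x2 * ((n2 * c1 * g) * r)) * e)"
      for x2 c n1 q a d f n2 c1 e g r n3 x1 y h :: complex
      by (simp add: algebra_simps diff_divide_distrib)
    show "?D \<omega> = ?a * (Aa p \<omega> * \<delta> k l \<omega> + Ba p \<omega> * cnj (\<delta> k l \<omega>))"
      unfolding Aa_def Ba_def complex_cnj_mult complex_cnj_complex_of_real by (rule gen)
  qed
  finally show ?thesis .
qed

text \<open>The derivative of \<open>Psi p\<close> times \<open>B k l\<close> in its own coordinate,
  stripped of the factor \<open>amp' k l\<close>, which combines with \<open>amp k l\<close> to t /
  N.\<close>

definition "Dn p k l \<omega> = Psi p \<omega> * (- (G k k \<omega> * B l l \<omega> + G k l \<omega> * B k l \<omega>) - 2 * of_real t / of_nat N * GG k l \<omega> * BR k l \<omega>)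
  + (Aa p \<omega> * \<delta> k l \<omega> + Ba p \<omega> * cnj (\<delta> k l \<omega>)) * B k l \<omega>"

lemma bounded_measurable_Dn: "k < N \<Longrightarrow> l < N \<Longrightarrow> bounded_measurable (Dn p k l)"
  unfolding Dn_def[abs_def]
  by (intro bounded_measurable_intros bounded_measurable_Psi bounded_measurable_G bounded_measurable_B bounded_measurable_GG bounded_measurable_BR bounded_measurable_Aa bounded_measurable_Ba bounded_measurable_\<delta>)

lemma IBP_entry:
  assumes k: "k < N" and l: "l < N"
  shows "(\<integral>\<omega>. of_real (V k l \<omega>) * (Psi p \<omega> * B k l \<omega>) \<partial>Gspace) = of_real (t / N) * (\<integral>\<omega>. Dn p k l \<omega> \<partial>Gspace)"
    and "integrable Gspace (\<lambda>\<omega>. of_real (V k l \<omega>) * (Psi p \<omega> * B k l \<omega>))"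
proof -
  let ?F = "\<lambda>\<omega>. Psi p \<omega> * B k l \<omega>" and ?D = "\<lambda>\<omega>. of_real (amp' k l) * Dn p k l \<omega>"
  have bF: "bounded_measurable ?F" by (intro bounded_measurable_intros bounded_measurable_Psi bounded_measurable_B k l)
  have bD: "bounded_measurable ?D" by (intro bounded_measurable_intros bounded_measurable_Dn k l)
  obtain b1 b2 where "\<And>\<omega>. cmod (?F \<omega>) \<le> b1" "\<And>\<omega>. cmod (?D \<omega>) \<le> b2"
    using bF bD unfolding bounded_measurable_def by metis
  then have b: "cmod (?F \<omega>) \<le> max b1 b2" "cmod (?D \<omega>) \<le> max b1 b2" for \<omega>
    by (meson max.coboundedI1 max.coboundedI2)+
  have "?D = (\<lambda>\<omega>. Psi p \<omega> * (of_real (amp' k l) *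
     (- (G k k \<omega> * B l l \<omega> + G k l \<omega> * B k l \<omega>) - 2 * of_real t / of_nat N * GG k l \<omega> * BR k l \<omega>))
     + of_real (amp' k l) * (Aa p \<omega> * \<delta> k l \<omega> + Ba p \<omega> * cnj (\<delta> k l \<omega>)) * B k l \<omega>)"
  proof
    fix \<omega>
    have "a * (y * x + e * b) = y * (a * x) + a * e * b" for a y x e b :: complex
      by (simp add: algebra_simps)
    then show "of_real (amp' k l) * Dn p k l \<omega> = Psi p \<omega> * (of_real (amp' k l) *
     (- (G k k \<omega> * B l l \<omega> + G k l \<omega> * B k l \<omega>) - 2 * of_real t / of_nat N * GG k l \<omega> * BR k l \<omega>))
     + of_real (amp' k l) * (Aa p \<omega> * \<delta> k l \<omega> + Ba p \<omega> * cnj (\<delta> k l \<omega>)) * B k l \<omega>"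
      unfolding Dn_def .
  qed
  then have "coord_deriv (coord k l) ?F ?D"
    by (rule ssubst) (rule coord_deriv_mult[OF coord_deriv_Psi[OF k l] coord_deriv_B[OF k l]])
  then have der: "((\<lambda>x. ?F (fun_upd \<omega> (coord k l) x)) has_vector_derivative ?D (fun_upd \<omega> (coord k l) x)) (at x)" for \<omega> x
    unfolding coord_deriv_def by blast
  have mF: "?F \<in> borel_measurable Gspace" and mD: "?D \<in> borel_measurable Gspace"
    using bF bD by (auto simp: bounded_measurable_def)
  note ibp = Gspace_IBP[OF mF mD b der]
  have e: "of_real (V k l \<omega>) * ?F \<omega> = of_real (amp k l) * (of_real (\<omega> (coord k l)) * ?F \<omega>)" for \<omega>
    by (simp add: V_def)
  show "integrable Gspace (\<lambda>\<omega>. of_real (V k l \<omega>) * ?F \<omega>)"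
    unfolding e by (rule integrable_mult_right[OF ibp(2)])
  have "(\<integral>\<omega>. of_real (V k l \<omega>) * ?F \<omega> \<partial>Gspace) = of_real (amp k l) * (of_real (amp' k l) * (\<integral>\<omega>. Dn p k l \<omega> \<partial>Gspace))"
    unfolding e integral_mult_right_zero ibp(1) ..
  also have "\<dots> = of_real (amp k l * amp' k l) * (\<integral>\<omega>. Dn p k l \<omega> \<partial>Gspace)" by simp
  finally show "(\<integral>\<omega>. of_real (V k l \<omega>) * ?F \<omega> \<partial>Gspace) = of_real (t / N) * (\<integral>\<omega>. Dn p k l \<omega> \<partial>Gspace)"
    unfolding amp_product[OF k l] .
qed

text \<open>The double sums without a free trace. Each pairs two matrices entrywise and is thus
  accessible to Cauchy-Schwarz in Hilbert-Schmidt norm.\<close>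

definition "T1 \<omega> = (\<Sum>k<N. \<Sum>l<N. G k l \<omega> * B k l \<omega>)"
definition "T2 \<omega> = (\<Sum>k<N. \<Sum>l<N. GG k l \<omega> * BR k l \<omega>)"
definition "T3 \<omega> = (\<Sum>k<N. \<Sum>l<N. GG k l \<omega> * B k l \<omega>)"
definition "T4 \<omega> = (\<Sum>k<N. \<Sum>l<N. cnj (GG k l \<omega>) * B k l \<omega>)"
definition "Z p \<omega> = of_real (t / N) * (Psi p \<omega> * (T1 \<omega> + of_real (2 * t / N) * T2 \<omega>)
  + of_real (2 / N) * (Aa p \<omega> * T3 \<omega> + Ba p \<omega> * T4 \<omega>))"

lemma bounded_measurable_Z: "bounded_measurable (Z p)"
  unfolding Z_def[abs_def] T1_def T2_def T3_def T4_def
  by (intro bounded_measurable_intros bounded_measurable_Psi bounded_measurable_G bounded_measurable_B bounded_measurable_GG bounded_measurable_BR bounded_measurable_Aa bounded_measurable_Ba) auto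

lemma Dn_sum:
  "- (of_real (t / N) * (\<Sum>k<N. \<Sum>l<N. Dn p k l \<omega>)) - Psi p \<omega> * (of_real t * S \<omega> * (\<Sum>i<N. B i i \<omega>)) = Z p \<omega>"
proof -
  have "(\<Sum>k<N. \<Sum>l<N. Dn p k l \<omega>) =
     (\<Sum>k<N. \<Sum>l<N. - Psi p \<omega> * (G k k \<omega> * B l l \<omega>)) + (\<Sum>k<N. \<Sum>l<N. - Psi p \<omega> * (G k l \<omega> * B k l \<omega>))
     + (\<Sum>k<N. \<Sum>l<N. - (Psi p \<omega> * of_real (2 * t / N)) * (GG k l \<omega> * BR k l \<omega>))
     + (\<Sum>k<N. \<Sum>l<N. - (of_real (2 / N) * Aa p \<omega>) * (GG k l \<omega> * B k l \<omega>))
     + (\<Sum>k<N. \<Sum>l<N. - (of_real (2 / N) * Ba p \<omega>) * (cnj (GG k l \<omega>) * B k l \<omega>))"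
    unfolding sum.distrib[symmetric]
    by (intro sum.cong refl) (simp add: Dn_def \<delta>_def algebra_simps)
  also have "\<dots> = - Psi p \<omega> * ((\<Sum>k<N. G k k \<omega>) * (\<Sum>l<N. B l l \<omega>)) + - Psi p \<omega> * T1 \<omega>
     + - (Psi p \<omega> * of_real (2 * t / N)) * T2 \<omega> + - (of_real (2 / N) * Aa p \<omega>) * T3 \<omega> + - (of_real (2 / N) * Ba p \<omega>) * T4 \<omega>"
  proof -
    have "(\<Sum>k<N. \<Sum>l<N. G k k \<omega> * B l l \<omega>) = (\<Sum>k<N. G k k \<omega>) * (\<Sum>l<N. B l l \<omega>)"
      by (simp only: sum_product)
    moreover have "(\<Sum>k<N. \<Sum>l<N. c * f k l) = c * (\<Sum>k<N. \<Sum>l<N. f k l)" for c and f :: "nat \<Rightarrow> nat \<Rightarrow> complex"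
      by (simp only: sum_distrib_left)
    ultimately show ?thesis by (simp only: T1_def T2_def T3_def T4_def)
  qed
  finally have sum: "(\<Sum>k<N. \<Sum>l<N. Dn p k l \<omega>) = - Psi p \<omega> * (of_nat N * S \<omega> * (\<Sum>l<N. B l l \<omega>)) + - Psi p \<omega> * T1 \<omega>
     + - (Psi p \<omega> * of_real (2 * t / N)) * T2 \<omega> + - (of_real (2 / N) * Aa p \<omega>) * T3 \<omega> + - (of_real (2 / N) * Ba p \<omega>) * T4 \<omega>"
    by (simp only: S_eq)
  have tN: "of_real (t / N) * (of_nat N * c) = of_real t * c" for c :: complex
    by (simp add: Nsz_def)
  have "of_real (t / N) * (- Psi p \<omega> * (of_nat N * S \<omega> * (\<Sum>l<N. B l l \<omega>)))
    = - Psi p \<omega> * (of_real t * S \<omega> * (\<Sum>i<N. B i i \<omega>))"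
    using tN[of "Psi p \<omega> * (S \<omega> * (\<Sum>i<N. B i i \<omega>))"] by (simp only: ac_simps mult_minus_left mult_minus_right)
  then show ?thesis
    unfolding sum Z_def by (simp only: distrib_left) (simp add: algebra_simps)
qed

text \<open>Integration by parts of the terms \<open>V\<^sub>k\<^sub>l B\<^sub>k\<^sub>l\<close> produces a copy of \<open>t S Tr (G R)\<close> that cancels the one in the
  defect; \<open>Z\<close> collects what is left.\<close>
lemma expectation_identity:
  "(\<integral>\<omega>. Psi p \<omega> * (of_nat N * P \<omega>) \<partial>Gspace) = (\<integral>\<omega>. Z p \<omega> \<partial>Gspace)"
proof -
  let ?V = "\<lambda>k l \<omega>. of_real (V k l \<omega>) * (Psi p \<omega> * B k l \<omega>)"
  let ?t = "\<lambda>\<omega>. Psi p \<omega> * (of_real t * S \<omega> * (\<Sum>i<N. B i i \<omega>))"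
  have it: "integrable Gspace ?t"
    by (intro bounded_measurable_integrable bounded_measurable_intros bounded_measurable_Psi bounded_measurable_S bounded_measurable_B) auto
  have iV: "integrable Gspace (\<lambda>\<omega>. \<Sum>k<N. \<Sum>l<N. ?V k l \<omega>)"
    by (intro Bochner_Integration.integrable_sum IBP_entry(2)) auto
  have iD: "integrable Gspace (\<lambda>\<omega>. \<Sum>k<N. \<Sum>l<N. Dn p k l \<omega>)"
    by (intro bounded_measurable_integrable bounded_measurable_intros bounded_measurable_Dn) auto
  have "(\<integral>\<omega>. Psi p \<omega> * (of_nat N * P \<omega>) \<partial>Gspace) = (\<integral>\<omega>. - ?t \<omega> - (\<Sum>k<N. \<Sum>l<N. ?V k l \<omega>) \<partial>Gspace)"
    unfolding self_consistency_defect right_diff_distrib mult_minus_right sum_distrib_left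
    by (intro Bochner_Integration.integral_cong refl) (simp only: mult.left_commute sum_distrib_left)
  also have "\<dots> = - (\<integral>\<omega>. ?t \<omega> \<partial>Gspace) - (\<integral>\<omega>. (\<Sum>k<N. \<Sum>l<N. ?V k l \<omega>) \<partial>Gspace)"
    using it iV by simp
  also have "(\<integral>\<omega>. (\<Sum>k<N. \<Sum>l<N. ?V k l \<omega>) \<partial>Gspace) = (\<Sum>k<N. \<Sum>l<N. (\<integral>\<omega>. ?V k l \<omega> \<partial>Gspace))"
    by (subst Bochner_Integration.integral_sum, intro Bochner_Integration.integrable_sum IBP_entry(2), simp_all,
      intro sum.cong refl Bochner_Integration.integral_sum IBP_entry(2), auto)
  also have "\<dots> = (\<Sum>k<N. \<Sum>l<N. of_real (t / N) * (\<integral>\<omega>. Dn p k l \<omega> \<partial>Gspace))"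
    by (intro sum.cong refl IBP_entry(1)) auto
  also have "\<dots> = of_real (t / N) * (\<integral>\<omega>. (\<Sum>k<N. \<Sum>l<N. Dn p k l \<omega>) \<partial>Gspace)"
  proof -
    have "(\<integral>\<omega>. (\<Sum>k<N. \<Sum>l<N. Dn p k l \<omega>) \<partial>Gspace) = (\<Sum>k<N. (\<integral>\<omega>. (\<Sum>l<N. Dn p k l \<omega>) \<partial>Gspace))"
      by (intro Bochner_Integration.integral_sum bounded_measurable_integrable bounded_measurable_intros bounded_measurable_Dn) auto
    also have "\<dots> = (\<Sum>k<N. \<Sum>l<N. (\<integral>\<omega>. Dn p k l \<omega> \<partial>Gspace))"
      by (intro sum.cong refl Bochner_Integration.integral_sum bounded_measurable_integrable bounded_measurable_Dn) auto
    finally show ?thesis by (simp only: sum_distrib_left)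
  qed
  also have "- (\<integral>\<omega>. ?t \<omega> \<partial>Gspace) - of_real (t / N) * (\<integral>\<omega>. (\<Sum>k<N. \<Sum>l<N. Dn p k l \<omega>) \<partial>Gspace)
      = (\<integral>\<omega>. - (of_real (t / N) * (\<Sum>k<N. \<Sum>l<N. Dn p k l \<omega>)) - ?t \<omega> \<partial>Gspace)"
    using it iD by simp
  also have "\<dots> = (\<integral>\<omega>. Z p \<omega> \<partial>Gspace)" by (simp only: Dn_sum)
  finally show ?thesis .
qed

end

text \<open>A Young inequality: if q is at least 4 C a, both terms are at most a quarter of q^(2 p);
  otherwise both are at most a quarter of (4 C a)^(2 p). The coefficient 1/2 lets the moment be
  absorbed later.\<close>

lemma absorb_powers:
  fixes C a q :: real
  assumes C: "1 \<le> C" and a: "0 < a" and q: "0 \<le> q" and p: "1 \<le> p"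
  shows "C * a * q ^ (2 * p - 1) + C * a\<^sup>2 * q ^ (2 * p - 2) \<le> q ^ (2 * p) / 2 + (4 * C * a) ^ (2 * p)"
proof -
  obtain r where r: "p = Suc r" using p by (cases p) auto
  define b where "b = 4 * C * a"
  have b: "0 < b" using C a by (simp add: b_def)
  have e: "2 * p - 1 = Suc (2 * r)" "2 * p - 2 = 2 * r" "2 * p = Suc (Suc (2 * r))" using r by auto
  have Ca: "C * a = b / 4" by (simp add: b_def)
  have "C * a\<^sup>2 \<le> C * C * a\<^sup>2" using C by (intro mult_right_mono) auto
  also have "\<dots> = b\<^sup>2 / 16" by (simp add: b_def power2_eq_square)
  also have "\<dots> \<le> b\<^sup>2 / 4" by (intro divide_left_mono) auto
  finally have Ca2: "C * a\<^sup>2 \<le> b\<^sup>2 / 4" .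
  have "C * a * q ^ (2 * p - 1) + C * a\<^sup>2 * q ^ (2 * p - 2) \<le> b / 4 * q ^ Suc (2 * r) + b\<^sup>2 / 4 * q ^ (2 * r)"
    unfolding e(1,2) Ca by (rule add_left_mono, rule mult_right_mono[OF Ca2]) (use q in simp)
  also have "\<dots> \<le> q ^ (2 * p) / 2 + b ^ (2 * p)"
  proof (cases "b \<le> q")
    case True
    have "b * q ^ Suc (2 * r) \<le> q * q ^ Suc (2 * r)" using True q by (intro mult_right_mono) auto
    moreover have "b\<^sup>2 * q ^ (2 * r) \<le> q\<^sup>2 * q ^ (2 * r)" using True q b by (intro mult_right_mono power_mono) auto
    moreover have "q * q ^ Suc (2 * r) = q ^ (2 * p)" "q\<^sup>2 * q ^ (2 * r) = q ^ (2 * p)"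
      unfolding e by (simp_all add: power2_eq_square)
    moreover have "0 \<le> b ^ (2 * p)" using b by simp
    ultimately show ?thesis by linarith
  next
    case False
    then have qb: "q \<le> b" by simp
    have "b * q ^ Suc (2 * r) \<le> b * b ^ Suc (2 * r)"
      by (rule mult_left_mono[OF power_mono[OF qb q]]) (use b in simp)
    moreover have "b\<^sup>2 * q ^ (2 * r) \<le> b\<^sup>2 * b ^ (2 * r)"
      by (rule mult_left_mono[OF power_mono[OF qb q]]) simp
    moreover have "b * b ^ Suc (2 * r) = b ^ (2 * p)" "b\<^sup>2 * b ^ (2 * r) = b ^ (2 * p)"
      unfolding e by (simp_all add: power2_eq_square)
    moreover have "0 \<le> q ^ (2 * p)" "0 \<le> b ^ (2 * p)" using q b by simp_all
    ultimately show ?thesis by linarith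
  qed
  finally show ?thesis by (simp add: b_def)
qed

section \<open>Deterministic bounds and moments of the defect\<close>

context last_step
begin

abbreviation "\<eta> \<equiv> Im z"

lemma N_pos: "0 < real N" by simp

lemma N_neq_0 [simp]: "(N = 0) = False" by (simp add: Nsz_def)

lemma frob_G: "(frob N (\<lambda>i j. G i j \<omega>))\<^sup>2 = N * Im (S \<omega>) / \<eta>"
  using frob_res[OF msym_Hfun z Nsz_pos, of "Suc m" eps "Suc m" \<omega>] by (simp add: G_def S_def)

lemma frob_B: "frob N (\<lambda>i j. B i j \<omega>) \<le> frob N (\<lambda>i j. G i j \<omega>) / Im (w \<omega>)"
  using frob_mmul_res[OF msym_Hfun w_Im_pos, of N "\<lambda>i j. G i j \<omega>" eps m \<omega> \<omega>]
  by (simp add: B_def[abs_def] mmul_def[abs_def] R_def)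

lemma frob_GG: "frob N (\<lambda>i j. GG i j \<omega>) \<le> frob N (\<lambda>i j. G i j \<omega>) / \<eta>"
  using frob_mmul_res[OF msym_Hfun z, of N "\<lambda>i j. G i j \<omega>" eps "Suc m" \<omega>]
  by (simp add: GG_def[abs_def] mmul_def[abs_def] G_def)

lemma frob_BR: "frob N (\<lambda>i j. BR i j \<omega>) \<le> frob N (\<lambda>i j. G i j \<omega>) / (Im (w \<omega>) * Im (w \<omega>))"
proof -
  have "frob N (\<lambda>i j. BR i j \<omega>) \<le> frob N (\<lambda>i j. B i j \<omega>) / Im (w \<omega>)"
    using frob_mmul_res[OF msym_Hfun w_Im_pos, of N "\<lambda>i j. B i j \<omega>" eps m \<omega> \<omega>]
    by (simp add: BR_def[abs_def] mmul_def[abs_def] R_def)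
  also have "\<dots> \<le> frob N (\<lambda>i j. G i j \<omega>) / Im (w \<omega>) / Im (w \<omega>)"
    using frob_B w_Im_pos[of \<omega>] by (intro divide_right_mono) auto
  finally show ?thesis by simp
qed

lemma ratio_le_1: "t * Im (S \<omega>) / Im (w \<omega>) \<le> 1"
  using w_Im_pos[of \<omega>] z by (simp add: w_Im)

lemma ratio_le: "t / Im (w \<omega>) \<le> 1 / Im (S \<omega>)"
  using ratio_le_1[of \<omega>] S_Im[of \<omega>] w_Im_pos[of \<omega>] by (simp add: field_simps)

text \<open>Ward's identity gives N u / \<eta> for the squared norm of G, with u = Im S. Every
  further factor G costs 1 / \<eta> and every factor R costs 1 / Im w. The prefactor t and the u
  from Ward absorb one 1 / Im w; \<open>T2\<close> has a second one, and there t / Im w leaves the 1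
  / u that \<open>chi\<close> pays for.\<close>

lemma T_bounds:
  shows "t / N * cmod (T1 \<omega>) \<le> 1 / \<eta>"
    and "t / N * (2 * t / N * cmod (T2 \<omega>)) \<le> 2 / (N * \<eta>\<^sup>2) / Im (S \<omega>)"
    and "t / N * (2 / N * cmod (T3 \<omega>)) \<le> 2 / (N * \<eta>\<^sup>2)"
    and "t / N * (2 / N * cmod (T4 \<omega>)) \<le> 2 / (N * \<eta>\<^sup>2)"
proof -
  define F where "F = frob N (\<lambda>i j. G i j \<omega>)"
  define y where "y = Im (w \<omega>)"
  define u where "u = Im (S \<omega>)"
  have F0: "0 \<le> F" by (simp add: F_def)
  have y: "0 < y" and u: "0 < u" using w_Im_pos S_Im by (simp_all add: y_def u_def)
  have FF: "F * F = N * u / \<eta>" using frob_G[of \<omega>] by (simp add: F_def u_def power2_eq_square)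
  have r1: "t * u / y \<le> 1" using ratio_le_1[of \<omega>] by (simp add: u_def y_def)
  have r2: "t / y \<le> 1 / u" using ratio_le[of \<omega>] by (simp add: u_def y_def)
  have tp: "0 < t" by (rule t_pos)
  note z = z
  have fB: "frob N (\<lambda>i j. B i j \<omega>) \<le> F / y" using frob_B by (simp add: F_def y_def)
  have fGG: "frob N (\<lambda>i j. GG i j \<omega>) \<le> F / \<eta>" using frob_GG by (simp add: F_def)
  have fBR: "frob N (\<lambda>i j. BR i j \<omega>) \<le> F / (y * y)" using frob_BR by (simp add: F_def y_def)
  have "cmod (T1 \<omega>) \<le> F * (F / y)" unfolding T1_def
    using frob_Cauchy_Schwarz[where N = N and A = "\<lambda>k l. G k l \<omega>" and B = "\<lambda>k l. B k l \<omega>"] mult_left_mono[OF fB F0] by (simp add: F_def)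
  then have "t / N * cmod (T1 \<omega>) \<le> t / N * (F * (F / y))" using tp by (intro mult_left_mono) auto
  also have "\<dots> = t / N * (F * F) / y" by simp
  also have "\<dots> = (t * u / y) * (1 / \<eta>)" unfolding FF using N_pos by simp
  also have "\<dots> \<le> 1 * (1 / \<eta>)" using r1 z by (intro mult_right_mono) auto
  finally show "t / N * cmod (T1 \<omega>) \<le> 1 / \<eta>" by simp
  have "cmod (T2 \<omega>) \<le> frob N (\<lambda>i j. GG i j \<omega>) * frob N (\<lambda>i j. BR i j \<omega>)" unfolding T2_def
    by (rule frob_Cauchy_Schwarz)
  also have "\<dots> \<le> (F / \<eta>) * (F / (y * y))" using fGG fBR F0 z by (intro mult_mono) auto
  finally have "t / N * (2 * t / N * cmod (T2 \<omega>)) \<le> t / N * (2 * t / N * ((F / \<eta>) * (F / (y * y))))"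
    using tp by (intro mult_left_mono) auto
  also have "\<dots> = t / N * (2 * t / N) * (F * F) / (\<eta> * (y * y))" by simp
  also have "\<dots> = 2 / (N * \<eta>\<^sup>2) * ((t * u / y) * (t / y))" unfolding FF using N_pos by (simp add: power2_eq_square field_simps)
  also have "\<dots> \<le> 2 / (N * \<eta>\<^sup>2) * (1 * (1 / u))"
    using r1 r2 tp u y by (intro mult_left_mono mult_mono) auto
  finally show "t / N * (2 * t / N * cmod (T2 \<omega>)) \<le> 2 / (N * \<eta>\<^sup>2) / Im (S \<omega>)" by (simp add: u_def)
  have gen: "t / N * (2 / N * c) \<le> 2 / (N * \<eta>\<^sup>2)" if "c \<le> (F / \<eta>) * (F / y)" for c
  proof -
    have "t / N * (2 / N * c) \<le> t / N * (2 / N * ((F / \<eta>) * (F / y)))"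
      using tp that by (intro mult_left_mono) auto
    also have "\<dots> = t / N * (2 / N) * (F * F) / (\<eta> * y)" by simp
    also have "\<dots> = 2 / (N * \<eta>\<^sup>2) * (t * u / y)" unfolding FF using N_pos by (simp add: power2_eq_square field_simps)
    also have "\<dots> \<le> 2 / (N * \<eta>\<^sup>2) * 1" using r1 by (intro mult_left_mono) auto
    finally show ?thesis by simp
  qed
  have "cmod (T3 \<omega>) \<le> frob N (\<lambda>i j. GG i j \<omega>) * frob N (\<lambda>i j. B i j \<omega>)" unfolding T3_def
    by (rule frob_Cauchy_Schwarz)
  also have "\<dots> \<le> (F / \<eta>) * (F / y)" using fGG fB F0 z by (intro mult_mono) auto
  finally show "t / N * (2 / N * cmod (T3 \<omega>)) \<le> 2 / (N * \<eta>\<^sup>2)" by (rule gen)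
  have "cmod (T4 \<omega>) \<le> frob N (\<lambda>i j. cnj (GG i j \<omega>)) * frob N (\<lambda>i j. B i j \<omega>)" unfolding T4_def
    by (rule frob_Cauchy_Schwarz)
  also have "frob N (\<lambda>i j. cnj (GG i j \<omega>)) = frob N (\<lambda>i j. GG i j \<omega>)" by (rule frob_cnj)
  also have "frob N (\<lambda>i j. GG i j \<omega>) * frob N (\<lambda>i j. B i j \<omega>) \<le> (F / \<eta>) * (F / y)" using fGG fB F0 z by (intro mult_mono) auto
  finally show "t / N * (2 / N * cmod (T4 \<omega>)) \<le> 2 / (N * \<eta>\<^sup>2)" by (rule gen)
qed

text \<open>The slope s1 is at most Im S0 / Im w, and Im S0 is at most Im S + |P|. With t / Im w
  \<le> 1 / Im S the estimate closes in terms of the defect itself.\<close>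

lemma pf_bound: "cmod (pf \<omega>) \<le> 2 + cmod (P \<omega>) / Im (S \<omega>)"
proof -
  have u: "0 < Im (S \<omega>)" and y: "0 < Im (w \<omega>)" using S_Im w_Im_pos by auto
  have s1: "cmod (s1 \<omega>) \<le> Im (S0 \<omega>) / Im (w \<omega>)"
    using ntr_derivative_bound[OF msym_Hfun w_Im_pos Nsz_pos, of "Suc m" eps m \<omega> \<omega>]
    by (simp add: s1_def RR_def R_def S0_def)
  have "Im (S0 \<omega>) \<le> Im (S \<omega>) + cmod (P \<omega>)"
    using abs_Im_le_cmod[of "P \<omega>"] by (simp add: P_def)
  from order_trans[OF s1 divide_right_mono[OF this less_imp_le[OF y]]]
  have "t * cmod (s1 \<omega>) \<le> t * ((Im (S \<omega>) + cmod (P \<omega>)) / Im (w \<omega>))"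
    using t_pos by (intro mult_left_mono) auto
  also have "\<dots> = (t / Im (w \<omega>)) * (Im (S \<omega>) + cmod (P \<omega>))" by simp
  also have "\<dots> \<le> (1 / Im (S \<omega>)) * (Im (S \<omega>) + cmod (P \<omega>))"
    using ratio_le[of \<omega>] u by (intro mult_right_mono) auto
  also have "\<dots> = 1 + cmod (P \<omega>) / Im (S \<omega>)" using u by (simp add: field_simps)
  finally have "t * cmod (s1 \<omega>) \<le> 1 + cmod (P \<omega>) / Im (S \<omega>)" .
  moreover have "cmod (pf \<omega>) \<le> 1 + t * cmod (s1 \<omega>)"
    using norm_triangle_ineq4[of 1 "of_real t * s1 \<omega>"] t_pos by (simp add: pf_def norm_mult)
  ultimately show ?thesis by linarith
qed

lemma Psi_norm:
  assumes p: "1 \<le> p"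
  shows "cmod (Psi p \<omega>) = chi (Im (S \<omega>)) * Q \<omega> ^ (2 * p - 1)"
proof -
  obtain r where r: "p = Suc r" using p by (cases p) auto
  have "0 \<le> chi (Im (S \<omega>))" using S_Im[of \<omega>] by (intro chi_nonneg) auto
  then have "cmod (Psi p \<omega>) = chi (Im (S \<omega>)) ^ (2 * p) * (cmod (P \<omega>) ^ p * cmod (P \<omega>) ^ (p - 1))"
    by (simp add: Psi_def X_def norm_mult norm_power)
  then show ?thesis unfolding r Q_def power_mult_distrib
    by (simp add: power_add[symmetric] mult_2)
qed

text \<open>Two powers of x = chi (Im S) are spent on the slope factor: x^2 (2 + |P| / Im S) \<le> 2
  + Q, because x \<le> 1 and x \<le> Im S.\<close>

lemma AB_bound:
  assumes p: "1 \<le> p"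
  shows "cmod (Aa p \<omega>) + cmod (Ba p \<omega>) \<le> 4 * real p * Q \<omega> ^ (2 * p - 1) + 4 * real p * Q \<omega> ^ (2 * p - 2)"
proof -
  define x where "x = chi (Im (S \<omega>))"
  define v where "v = cmod (P \<omega>)"
  define u where "u = Im (S \<omega>)"
  define f where "f = cmod (pf \<omega>)"
  obtain r where r: "p = Suc r" using p by (cases p) auto
  have u: "0 < u" using S_Im by (simp add: u_def)
  have x0: "0 \<le> x" and x1: "x \<le> 1" and xu: "x \<le> u"
    using chi_nonneg[of u] chi_le_1[of u] chi_le_id[of u] u by (auto simp: x_def u_def)
  have v0: "0 \<le> v" and f0: "0 \<le> f" by (simp_all add: v_def f_def)
  have nX: "cmod (X \<omega>) = x" using x0 by (simp add: X_def x_def)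
  have nX': "cmod (X' \<omega> / (2 * \<i>)) \<le> 1 / 2" using chi'_le_1[of "Im (S \<omega>)"] by (simp add: X'_def norm_divide norm_mult)
  have Qd: "Q \<omega> = x * v" by (simp add: Q_def x_def v_def)
  have first: "cmod (of_nat (2 * p) * X \<omega> ^ (2 * p - 1) * (X' \<omega> / (2 * \<i>)) * (cnj (P \<omega>) ^ p * P \<omega> ^ (p - 1))) \<le> real p * Q \<omega> ^ (2 * p - 1)"
  proof -
    have "cmod (of_nat (2 * p) * X \<omega> ^ (2 * p - 1) * (X' \<omega> / (2 * \<i>)) * (cnj (P \<omega>) ^ p * P \<omega> ^ (p - 1)))
      = real (2 * p) * x ^ (2 * p - 1) * cmod (X' \<omega> / (2 * \<i>)) * (v ^ p * v ^ (p - 1))"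
      by (simp only: norm_mult norm_power nX norm_of_nat complex_mod_cnj v_def)
    also have "\<dots> \<le> real (2 * p) * x ^ (2 * p - 1) * (1 / 2) * (v ^ p * v ^ (p - 1))"
      using nX' x0 v0 by (intro mult_right_mono mult_left_mono) auto
    also have "\<dots> = real p * (x ^ (2 * p - 1) * (v ^ p * v ^ (p - 1)))" by simp
    also have "v ^ p * v ^ (p - 1) = v ^ (2 * p - 1)" unfolding power_add[symmetric] using p by (simp add: mult_2)
    finally show ?thesis by (simp only: Qd power_mult_distrib)
  qed
  have x2: "x ^ (2 * p) * v ^ (2 * p - 2) * f \<le> Q \<omega> ^ (2 * p - 2) * 2 + Q \<omega> ^ (2 * p - 1)"
  proof -
    have "x\<^sup>2 * f \<le> x\<^sup>2 * (2 + v / u)" using pf_bound[of \<omega>] by (intro mult_left_mono) (auto simp: f_def v_def u_def)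
    also have "\<dots> = 2 * x\<^sup>2 + (x / u) * (x * v)" by (simp add: power2_eq_square algebra_simps)
    also have "\<dots> \<le> 2 * 1 + 1 * (x * v)"
      using x0 x1 xu u v0 by (intro add_mono mult_left_mono mult_right_mono power_le_one) auto
    finally have le: "x\<^sup>2 * f \<le> 2 + Q \<omega>" by (simp add: Qd)
    have "x ^ (2 * p) * v ^ (2 * p - 2) * f = Q \<omega> ^ (2 * p - 2) * (x\<^sup>2 * f)"
      unfolding r Qd by (simp add: power_mult_distrib power2_eq_square)
    also have "\<dots> \<le> Q \<omega> ^ (2 * p - 2) * (2 + Q \<omega>)" using le x0 v0 by (intro mult_left_mono) (auto simp: Qd)
    also have "\<dots> = Q \<omega> ^ (2 * p - 2) * 2 + Q \<omega> ^ (2 * p - 1)" unfolding r by (simp add: algebra_simps)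
    finally show ?thesis .
  qed
  have secA: "cmod (X \<omega> ^ (2 * p) * (cnj (P \<omega>) ^ p * (of_nat (p - 1) * P \<omega> ^ (p - 1 - 1) * pf \<omega>)))
    = real (p - 1) * (x ^ (2 * p) * v ^ (2 * p - 2) * f)"
  proof -
    have "cmod (X \<omega> ^ (2 * p) * (cnj (P \<omega>) ^ p * (of_nat (p - 1) * P \<omega> ^ (p - 1 - 1) * pf \<omega>)))
      = x ^ (2 * p) * (v ^ p * (real (p - 1) * v ^ (p - 1 - 1) * f))"
      by (simp only: norm_mult norm_power nX norm_of_nat complex_mod_cnj v_def f_def)
    also have "\<dots> = real (p - 1) * (x ^ (2 * p) * (v ^ p * v ^ (p - 1 - 1)) * f)" by simp
    also have "\<dots> = real (p - 1) * (x ^ (2 * p) * v ^ (2 * p - 2) * f)"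
    proof (cases "p = 1")
      case False
      then have "p + (p - 1 - 1) = 2 * p - 2" using p by simp
      then show ?thesis by (simp only: power_add[symmetric])
    qed simp
    finally show ?thesis .
  qed
  have secB: "cmod (X \<omega> ^ (2 * p) * ((of_nat p * cnj (P \<omega>) ^ (p - 1) * cnj (pf \<omega>)) * P \<omega> ^ (p - 1)))
    = real p * (x ^ (2 * p) * v ^ (2 * p - 2) * f)"
  proof -
    have "cmod (X \<omega> ^ (2 * p) * ((of_nat p * cnj (P \<omega>) ^ (p - 1) * cnj (pf \<omega>)) * P \<omega> ^ (p - 1)))
      = x ^ (2 * p) * ((real p * v ^ (p - 1) * f) * v ^ (p - 1))"
      by (simp only: norm_mult norm_power nX norm_of_nat complex_mod_cnj v_def f_def)
    also have "\<dots> = real p * (x ^ (2 * p) * (v ^ (p - 1) * v ^ (p - 1)) * f)" by simp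
    also have "v ^ (p - 1) * v ^ (p - 1) = v ^ (2 * p - 2)" unfolding r power_add[symmetric] by (simp add: mult_2)
    finally show ?thesis .
  qed
  have "cmod (Aa p \<omega>) \<le> real p * Q \<omega> ^ (2 * p - 1) + real (p - 1) * (x ^ (2 * p) * v ^ (2 * p - 2) * f)"
    unfolding Aa_def by (rule order_trans[OF norm_triangle_ineq]) (use first secA in linarith)
  moreover have "cmod (Ba p \<omega>) \<le> real p * Q \<omega> ^ (2 * p - 1) + real p * (x ^ (2 * p) * v ^ (2 * p - 2) * f)"
    unfolding Ba_def by (rule order_trans[OF norm_triangle_ineq]) (use first secB in \<open>simp only: norm_minus_cancel\<close>)
  moreover have "real (p - 1) * (x ^ (2 * p) * v ^ (2 * p - 2) * f) \<le> real p * (Q \<omega> ^ (2 * p - 2) * 2 + Q \<omega> ^ (2 * p - 1))"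
    using x2 x0 v0 f0 by (intro mult_mono) auto
  moreover have "real p * (x ^ (2 * p) * v ^ (2 * p - 2) * f) \<le> real p * (Q \<omega> ^ (2 * p - 2) * 2 + Q \<omega> ^ (2 * p - 1))"
    using x2 by (intro mult_left_mono) auto
  ultimately show ?thesis by (simp add: algebra_simps)
qed

lemma Q_nonneg: "0 \<le> Q \<omega>"
  unfolding Q_def using S_Im[of \<omega>] by (intro mult_nonneg_nonneg chi_nonneg) auto

text \<open>In terms of a, the error 1 / \<eta> is N a and 2 / (N \<eta>^2) is 2 N a^2. As a \<le>
  1, the a^2 next to Q^(2 p - 1) may be replaced by a, and the coefficients 1 + 2 + 8 p there make
  up C.\<close>

lemma Z_bound:
  assumes p: "1 \<le> p" and a1: "1 / (N * \<eta>) \<le> 1"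
  defines "a \<equiv> 1 / (N * \<eta>)" and "C \<equiv> 3 + 8 * real p"
  shows "cmod (Z p \<omega>) \<le> N * (Q \<omega> ^ (2 * p) / 2 + (4 * C * a) ^ (2 * p))"
proof -
  define q1 where "q1 = Q \<omega> ^ (2 * p - 1)"
  define q2 where "q2 = Q \<omega> ^ (2 * p - 2)"
  define x where "x = chi (Im (S \<omega>))"
  define u where "u = Im (S \<omega>)"
  define D where "D = 2 / (N * \<eta>\<^sup>2)"
  have tN: "0 \<le> t / N" using t_pos by simp
  have u: "0 < u" using S_Im by (simp add: u_def)
  have q0: "0 \<le> q1" "0 \<le> q2" using Q_nonneg by (simp_all add: q1_def q2_def)
  have x0: "0 \<le> x" and x1: "x \<le> 1" and xu: "x / u \<le> 1"
    using chi_nonneg[of u] chi_le_1[of u] chi_le_id[of u] u by (auto simp: x_def u_def)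
  have a0: "0 < a" using z N_pos by (simp add: a_def)
  have D0: "0 \<le> D" by (simp add: D_def)
  have Da: "D = N * (2 * a\<^sup>2)" using z N_pos by (simp add: D_def a_def power2_eq_square field_simps)
  have ia: "1 / \<eta> = N * a" using N_pos by (simp add: a_def)
  have "cmod (Z p \<omega>) \<le> t / N * (cmod (Psi p \<omega>) * (cmod (T1 \<omega>) + 2 * t / N * cmod (T2 \<omega>))
    + 2 / N * (cmod (Aa p \<omega>) * cmod (T3 \<omega>) + cmod (Ba p \<omega>) * cmod (T4 \<omega>)))"
  proof -
    have c1: "cmod (of_real (2 * t / N)) = 2 * t / N" "cmod (of_real (2 / real N)) = 2 / N" "cmod (of_real (t / N)) = t / N"
      using t_pos by (simp_all add: norm_divide norm_mult)
    have "cmod (Psi p \<omega> * (T1 \<omega> + of_real (2 * t / N) * T2 \<omega>)) \<le> cmod (Psi p \<omega>) * (cmod (T1 \<omega>) + 2 * t / N * cmod (T2 \<omega>))"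
      unfolding norm_mult[of "Psi p \<omega>"]
      by (intro mult_left_mono order_trans[OF norm_triangle_ineq]) (simp_all only: norm_mult c1 order_refl norm_ge_zero)
    moreover have "cmod (of_real (2 / N) * (Aa p \<omega> * T3 \<omega> + Ba p \<omega> * T4 \<omega>)) \<le> 2 / N * (cmod (Aa p \<omega>) * cmod (T3 \<omega>) + cmod (Ba p \<omega>) * cmod (T4 \<omega>))"
      unfolding norm_mult[of "of_real (2 / N)"] c1
      by (intro mult_left_mono order_trans[OF norm_triangle_ineq]) (simp_all add: norm_mult)
    ultimately show ?thesis
      unfolding Z_def norm_mult[of "of_real (t / N)"] c1
      using tN by (intro mult_left_mono order_trans[OF norm_triangle_ineq] add_mono) auto
  qed
  also have "\<dots> = cmod (Psi p \<omega>) * (t / N * cmod (T1 \<omega>)) + cmod (Psi p \<omega>) * (t / N * (2 * t / N * cmod (T2 \<omega>)))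
    + (cmod (Aa p \<omega>) * (t / N * (2 / N * cmod (T3 \<omega>))) + cmod (Ba p \<omega>) * (t / N * (2 / N * cmod (T4 \<omega>))))"
    by (simp add: algebra_simps)
  also have "\<dots> \<le> cmod (Psi p \<omega>) * (1 / \<eta>) + cmod (Psi p \<omega>) * (D / u) + (cmod (Aa p \<omega>) * D + cmod (Ba p \<omega>) * D)"
    using T_bounds[of \<omega>] unfolding D_def u_def by (intro add_mono mult_left_mono) auto
  also have "\<dots> = x * q1 * (1 / \<eta>) + (x / u) * q1 * D + (cmod (Aa p \<omega>) + cmod (Ba p \<omega>)) * D"
    unfolding Psi_norm[OF p] x_def[symmetric] q1_def[symmetric] by (simp add: algebra_simps)
  also have "\<dots> \<le> 1 * q1 * (1 / \<eta>) + 1 * q1 * D + (4 * real p * q1 + 4 * real p * q2) * D"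
  proof -
    have "x * q1 * (1 / \<eta>) \<le> 1 * q1 * (1 / \<eta>)" using x1 q0 z by (intro mult_right_mono) auto
    moreover have "(x / u) * q1 * D \<le> 1 * q1 * D" using xu q0 D0 by (intro mult_right_mono) auto
    moreover have "(cmod (Aa p \<omega>) + cmod (Ba p \<omega>)) * D \<le> (4 * real p * q1 + 4 * real p * q2) * D"
      unfolding q1_def q2_def by (rule mult_right_mono[OF AB_bound[OF p] D0])
    ultimately show ?thesis by linarith
  qed
  also have "\<dots> = N * (a * q1 + 2 * a\<^sup>2 * q1 + 8 * real p * a\<^sup>2 * q1 + 8 * real p * a\<^sup>2 * q2)"
    unfolding ia Da by (simp add: algebra_simps)
  also have "\<dots> \<le> N * (C * a * q1 + C * a\<^sup>2 * q2)"
  proof (rule mult_left_mono)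
    have "a\<^sup>2 \<le> a" using a0 a1 by (simp add: a_def[symmetric] power2_eq_square)
    then have "a\<^sup>2 * q1 \<le> a * q1" using q0 by (intro mult_right_mono) auto
    then have "(2 + 8 * real p) * (a\<^sup>2 * q1) \<le> (2 + 8 * real p) * (a * q1)" by (intro mult_left_mono) auto
    moreover have "0 \<le> 3 * (a\<^sup>2 * q2)" using q0 by simp
    ultimately show "a * q1 + 2 * a\<^sup>2 * q1 + 8 * real p * a\<^sup>2 * q1 + 8 * real p * a\<^sup>2 * q2 \<le> C * a * q1 + C * a\<^sup>2 * q2"
      unfolding C_def by (simp add: algebra_simps)
  qed simp
  also have "\<dots> \<le> N * (Q \<omega> ^ (2 * p) / 2 + (4 * C * a) ^ (2 * p))"
    unfolding q1_def q2_def by (intro mult_left_mono absorb_powers a0 Q_nonneg p) (auto simp: C_def)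
  finally show ?thesis .
qed

lemma Psi_P: "Psi p \<omega> * P \<omega> = of_real (Q \<omega> ^ (2 * p))" if p: "1 \<le> p"
proof -
  obtain r where r: "p = Suc r" using p by (cases p) auto
  have "Psi p \<omega> * P \<omega> = X \<omega> ^ (2 * p) * (P \<omega> * cnj (P \<omega>)) ^ p"
    unfolding r by (simp add: Psi_def power_mult_distrib)
  also have "P \<omega> * cnj (P \<omega>) = of_real ((cmod (P \<omega>))\<^sup>2)" by (simp only: complex_norm_square)
  also have "X \<omega> ^ (2 * p) * of_real ((cmod (P \<omega>))\<^sup>2) ^ p = of_real (Q \<omega> ^ (2 * p))"
    unfolding X_def Q_def of_real_power[symmetric] of_real_mult[symmetric] power_mult[symmetric] power_mult_distrib ..
  finally show ?thesis .
qed

lemma measurable_Q [measurable]: "Q \<in> borel_measurable Gspace"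
proof -
  have [measurable]: "P \<in> borel_measurable Gspace" "X \<in> borel_measurable Gspace" using bounded_measurable_P bounded_measurable_X by (auto simp: bounded_measurable_def)
  have "Q = (\<lambda>\<omega>. Re (X \<omega>) * cmod (P \<omega>))" by (simp add: Q_def X_def fun_eq_iff)
  then show ?thesis by simp
qed

lemma integrable_Q_power: "integrable Gspace (\<lambda>\<omega>. Q \<omega> ^ n)"
proof -
  obtain b where b: "\<And>\<omega>. cmod (P \<omega>) \<le> b" using bounded_measurable_P by (auto simp: bounded_measurable_def)
  have "Q \<omega> \<le> b" for \<omega>
  proof -
    have "Q \<omega> \<le> 1 * cmod (P \<omega>)" unfolding Q_def using chi_le_1[of "Im (S \<omega>)"] by (intro mult_right_mono) auto
    then show ?thesis using b[of \<omega>] by simp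
  qed
  then have "\<bar>Q \<omega> ^ n\<bar> \<le> b ^ n" for \<omega> using Q_nonneg[of \<omega>] by (simp add: power_mono)
  then show ?thesis by (intro Gs.integrable_const_bound[of _ "b ^ n"] AE_I2) auto
qed

text \<open>N times the moment is the expectation of \<open>Z\<close>, which is at most N times half
  the moment plus an error term. Since Q is bounded the moment is finite, and half of it can be
  subtracted.\<close>

lemma moment_bound:
  assumes p: "1 \<le> p" and a1: "1 / (N * \<eta>) \<le> 1"
  shows "(\<integral>\<omega>. Q \<omega> ^ (2 * p) \<partial>Gspace) \<le> 2 * (4 * (3 + 8 * real p) * (1 / (N * \<eta>))) ^ (2 * p)"
proof -
  define b where "b = (4 * (3 + 8 * real p) * (1 / (N * \<eta>))) ^ (2 * p)"
  define I where "I = (\<integral>\<omega>. Q \<omega> ^ (2 * p) \<partial>Gspace)"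
  have I0: "0 \<le> I" unfolding I_def using Q_nonneg by (intro integral_nonneg_AE AE_I2) auto
  have "(\<integral>\<omega>. Z p \<omega> \<partial>Gspace) = (\<integral>\<omega>. of_real (real N * Q \<omega> ^ (2 * p)) \<partial>Gspace)"
    unfolding expectation_identity[symmetric]
    by (intro Bochner_Integration.integral_cong refl) (simp add: mult.left_commute[of _ "of_nat N"] Psi_P[OF p])
  also have "\<dots> = of_real (real N * I)" unfolding integral_complex_of_real I_def by simp
  finally have "real N * I = cmod (\<integral>\<omega>. Z p \<omega> \<partial>Gspace)" using I0 by (simp add: norm_mult)
  also have "\<dots> \<le> (\<integral>\<omega>. cmod (Z p \<omega>) \<partial>Gspace)" by (rule integral_norm_bound)
  also have "\<dots> \<le> (\<integral>\<omega>. N * (Q \<omega> ^ (2 * p) / 2 + b) \<partial>Gspace)"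
    unfolding b_def using integrable_Q_power
    by (intro integral_mono integrable_norm bounded_measurable_integrable bounded_measurable_Z Z_bound[OF p a1]) auto
  also have "\<dots> = N * (I / 2 + b)" using integrable_Q_power[of "2 * p"] by (simp add: I_def)
  finally have "I \<le> I / 2 + b" using N_pos by (simp only: mult_le_cancel_left_pos)
  then show ?thesis by (simp add: I_def b_def)
qed

lemma Q_tail:
  assumes p: "1 \<le> p" and a1: "1 / (N * \<eta>) \<le> 1" and \<psi>: "0 < \<psi>"
  shows "measure Gspace {\<omega>. \<psi> \<le> Q \<omega>} \<le> 2 * (4 * (3 + 8 * real p) / (N * \<eta> * \<psi>)) ^ (2 * p)"
proof -
  have "measure Gspace {\<omega>\<in>space Gspace. \<psi> ^ (2 * p) \<le> Q \<omega> ^ (2 * p)} \<le> (\<integral>\<omega>. Q \<omega> ^ (2 * p) \<partial>Gspace) / \<psi> ^ (2 * p)"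
    by (rule integral_Markov_inequality_measure[OF integrable_Q_power, where A = "{}"])
      (use Q_nonneg \<psi> in auto)
  also have "{\<omega>\<in>space Gspace. \<psi> ^ (2 * p) \<le> Q \<omega> ^ (2 * p)} = {\<omega>. \<psi> \<le> Q \<omega>}"
    using p \<psi> Q_nonneg by (auto intro: power_mono less_imp_le dest: power_le_imp_le_base simp: power_mono_iff)
  also have "(\<integral>\<omega>. Q \<omega> ^ (2 * p) \<partial>Gspace) / \<psi> ^ (2 * p) \<le> 2 * (4 * (3 + 8 * real p) * (1 / (N * \<eta>))) ^ (2 * p) / \<psi> ^ (2 * p)"
    using moment_bound[OF p a1] \<psi> by (intro divide_right_mono) auto
  also have "\<dots> = 2 * (4 * (3 + 8 * real p) / (N * \<eta> * \<psi>)) ^ (2 * p)"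
    by (simp add: power_divide power_mult_distrib)
  finally show ?thesis .
qed

end

subsection \<open>Propagation to small scales\<close>

text \<open>The \<open>Q\<close> of the locale with z as an argument, since propagation uses many
  points z for the same sample.\<close>

definition defect :: "real \<Rightarrow> nat \<Rightarrow> (nat \<times> nat \<times> nat \<Rightarrow> real) \<Rightarrow> complex \<Rightarrow> real" where
  "defect eps m \<omega> z = (let s = ntr (Nsz (Suc m)) (Hfun eps (Suc m) \<omega>) z in
     chi (Im s) * cmod (s - ntr (Nsz (Suc m)) (Hfun eps m \<omega>) (z + of_real (tscale eps (Suc m)) * s)))"

lemma (in last_step) Q_eq_defect: "Q \<omega> = defect eps m \<omega> z"
  by (simp add: Q_def defect_def Let_def S_def P_def S0_def w_def)

lemma defect_tail:
  assumes z: "0 < Im z" and p: "1 \<le> p" and a: "1 \<le> Nsz (Suc m) * Im z" and \<psi>: "0 < \<psi>"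
  shows "measure Gspace {\<omega>. \<psi> \<le> defect eps m \<omega> z} \<le> 2 * (4 * (3 + 8 * real p) / (Nsz (Suc m) * Im z * \<psi>)) ^ (2 * p)"
proof -
  interpret last_step eps m z by unfold_locales (rule z)
  show ?thesis using Q_tail[OF p _ \<psi>] a z by (simp add: Q_eq_defect)
qed

lemma measurable_defect:
  assumes z: "0 < Im z"
  shows "(\<lambda>\<omega>. defect eps m \<omega> z) \<in> borel_measurable Gspace"
proof -
  interpret last_step eps m z by unfold_locales (rule z)
  show ?thesis using measurable_Q by (simp add: Q_eq_defect[abs_def])
qed

text \<open>A climb through the dyadic heights from y to Y: each doubling costs at most Im S \<le>
  K, and from Y on the trivial bound 1 / Y takes over.\<close>

lemma ntr_log_bound:
  assumes H: "msym N H" and N: "0 < N" and Y: "0 < Y" and K: "0 \<le> K"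
  shows "0 < y \<Longrightarrow> (\<And>l. 2 ^ l * y < Y \<Longrightarrow> Im (ntr N H (Complex E (2 ^ l * y))) \<le> K) \<Longrightarrow> Y \<le> 2 ^ L * y
    \<Longrightarrow> cmod (ntr N H (Complex E y)) \<le> real L * K + 1 / Y"
proof (induction L arbitrary: y)
  case 0
  have "cmod (ntr N H (Complex E y)) \<le> 1 / y" using ntr_bound[OF H _ N, of "Complex E y"] 0 by simp
  also have "\<dots> \<le> 1 / Y" using 0 Y by (intro divide_left_mono) auto
  finally show ?case by simp
next
  case (Suc L)
  show ?case
  proof (cases "Y \<le> y")
    case True
    have "cmod (ntr N H (Complex E y)) \<le> 1 / y" using ntr_bound[OF H _ N, of "Complex E y"] Suc.prems by simp
    also have "\<dots> \<le> 1 / Y" using True Y by (intro divide_left_mono) auto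
    finally show ?thesis using K by (simp add: add_increasing)
  next
    case False
    have "cmod (ntr N H (Complex E (2 * y))) \<le> real L * K + 1 / Y"
    proof (rule Suc.IH)
      show "Im (ntr N H (Complex E (2 ^ l * (2 * y)))) \<le> K" if "2 ^ l * (2 * y) < Y" for l
        using Suc.prems(2)[of "Suc l"] that by (simp add: ac_simps)
    qed (use Suc.prems in auto)
    moreover have "Im (ntr N H (Complex E y)) \<le> K" using Suc.prems(2)[of 0] False by simp
    ultimately show ?thesis using ntr_double_scale[OF H Suc.prems(1), of E] by (simp add: algebra_simps)
  qed
qed

text \<open>Spacing 1 / N is fine enough because the heights in use are at least 4 / N: a point and
  its grid neighbour lie within half their height of each other, where imaginary parts are
  comparable. The number of points stays polynomial in N.\<close>

definition grid_point :: "nat \<Rightarrow> int \<Rightarrow> nat \<Rightarrow> complex" where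
  "grid_point N j k = Complex (real_of_int j / real N) (real k / real N)"

lemma grid_point_near:
  assumes N: "0 < N" and z: "0 \<le> Im z"
  defines "j \<equiv> \<lfloor>Re z * N\<rfloor>" and "k \<equiv> nat \<lfloor>Im z * N\<rfloor>"
  shows "cmod (grid_point N j k - z) \<le> 2 / N" and "\<bar>real_of_int j / N - Re z\<bar> \<le> 1 / N"
    and "real k \<le> Im z * N" and "Im z * N < real k + 1"
proof -
  have Np: "0 < real N" using N by simp
  have kr: "real k = of_int \<lfloor>Im z * N\<rfloor>" using z by (simp add: k_def)
  show k1: "real k \<le> Im z * N" and k2: "Im z * N < real k + 1" unfolding kr by linarith+
  have j1: "of_int j \<le> Re z * N" "Re z * N < of_int j + 1" unfolding j_def by linarith+
  have "of_int j / N - Re z = (of_int j - Re z * N) / N" using Np by (simp add: field_simps)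
  moreover have "\<bar>of_int j - Re z * N\<bar> \<le> 1" using j1 by linarith
  ultimately show j2: "\<bar>real_of_int j / N - Re z\<bar> \<le> 1 / N" using Np by (simp add: abs_divide divide_right_mono)
  have "real k / N - Im z = (real k - Im z * N) / N" using Np by (simp add: field_simps)
  moreover have "\<bar>real k - Im z * N\<bar> \<le> 1" using k1 k2 by linarith
  ultimately have k3: "\<bar>real k / N - Im z\<bar> \<le> 1 / N" using Np by (simp add: abs_divide divide_right_mono)
  have "cmod (grid_point N j k - z) \<le> \<bar>Re (grid_point N j k - z)\<bar> + \<bar>Im (grid_point N j k - z)\<bar>" by (rule cmod_le)
  also have "\<dots> \<le> 2 / N" using j2 k3 by (simp add: grid_point_def)
  finally show "cmod (grid_point N j k - z) \<le> 2 / N" .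
qed

text \<open>Going down the grid one row at a time, \<open>Im s\<close> loses at most a constant factor, so \<open>w = g + t s(g)\<close> stays
  at height at least \<open>\<eta>1\<close>, where the previous level is controlled; the small defect then restores the bound.\<close>
lemma propagate:
  fixes c d \<delta> L \<eta>1 K0 Kup \<psi> :: real and A m :: nat and \<omega> :: "nat \<times> nat \<times> nat \<Rightarrow> real" and eps :: real
  defines "N \<equiv> Nsz (Suc m)" and "t \<equiv> tscale eps (Suc m)"
  defines "s \<equiv> ntr (Nsz (Suc m)) (Hfun eps (Suc m) \<omega>)"
    and "s' \<equiv> ntr (Nsz m) (Hfun eps m \<omega>)"
    and "S0 \<equiv> ntr (Nsz (Suc m)) (Hfun eps m \<omega>)"
  defines "K2 \<equiv> K0 / 36"
  assumes up: "\<And>j k. \<bar>real_of_int j\<bar> \<le> L * N \<Longrightarrow> A \<le> k \<Longrightarrow> k \<le> 20 * N \<Longrightarrow> Im (s (grid_point N j k)) < Kup"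
    and low: "\<And>j k. real_of_int j / N \<in> {c - \<delta> / 2<..<d + \<delta> / 2} \<Longrightarrow> \<eta>1 / 2 \<le> real k / N \<Longrightarrow> k \<le> 20 * N \<Longrightarrow> K0 / 2 < Im (s (grid_point N j k))"
    and low': "\<And>j k. real_of_int j / N \<in> {c - \<delta> / 2<..<d + \<delta> / 2} \<Longrightarrow> \<eta>1 / 2 \<le> real k / N \<Longrightarrow> k \<le> 20 * N \<Longrightarrow> K0 / 2 < Im (s' (grid_point N j k))"
    and def: "\<And>j k. \<bar>real_of_int j\<bar> \<le> L * N \<Longrightarrow> A \<le> k \<Longrightarrow> k \<le> 20 * N \<Longrightarrow> defect eps m \<omega> (grid_point N j k) < \<psi>"
    and K0: "0 < K0" and Kup: "0 < Kup" and \<delta>: "0 < \<delta>" and \<eta>1: "0 < \<eta>1" "\<eta>1 \<le> 1"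
    and L: "\<bar>c\<bar> + \<delta> \<le> L" "\<bar>d\<bar> + \<delta> \<le> L"
    and A: "4 \<le> A" and n1: "16 \<le> N * \<delta>" and n2: "8 \<le> N * \<eta>1"
    and n3: "\<eta>1 \<le> t * (2 / 9 * K2)" and n4: "t * (real (m + 5) * Kup + 1 / 10) \<le> \<delta> / 8" and n5: "t * Kup \<le> 1"
    and \<psi>: "\<psi> = (2 / 9 * K2) / (1 + Kup\<^sup>2) * K2"
    and z: "Re z \<in> {c<..<d}" "real A + 1 \<le> Im z * N" "Im z < 10"
  shows "2 / 9 * K2 \<le> Im (s z)" and "Im (s z) \<le> 9 / 2 * Kup"
proof -
  have Np: "0 < N" "0 < real N" and Nm: "0 < Nsz m" by (simp_all add: N_def)
  have tp: "0 < t" by (simp add: t_def tscale_def)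
  have K2: "0 < K2" using K0 by (simp add: K2_def)
  have Hs: "msym N (Hfun eps (Suc m) \<omega>)" "msym (Nsz m) (Hfun eps m \<omega>)" by auto
  have s_eq: "s = ntr N (Hfun eps (Suc m) \<omega>)" by (simp add: s_def N_def)
  have iN: "1 / N \<le> \<delta> / 16" using n1 Np by (simp add: field_simps)
  have inL: "\<bar>real_of_int j\<bar> \<le> L * N" if "real_of_int j / N \<in> {c - \<delta> / 2<..<d + \<delta> / 2}" for j
  proof -
    have "\<bar>real_of_int j / N\<bar> \<le> L" using that L \<delta> by auto
    then show ?thesis using Np by (simp add: abs_divide pos_divide_le_eq)
  qed
  \<comment> \<open>N is 2^(m + 1), so m + 5 doublings lift the height k / N to 16 k, above the
    cut-off 10.\<close>
  have Sbound: "cmod (s (grid_point N j k)) \<le> real (m + 5) * Kup + 1 / 10"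
    if j: "\<bar>real_of_int j\<bar> \<le> L * N" and k: "A \<le> k" for j k
    unfolding s_eq grid_point_def
  proof (rule ntr_log_bound[OF Hs(1) Np(1)])
    have kp: "1 \<le> real k" using k A by simp
    show "0 < real k / N" using kp Np by simp
    show "10 \<le> 2 ^ (m + 5) * (real k / N)"
    proof -
      have "2 ^ (m + 5) * (real k / N) = 16 * real k" by (simp add: N_def Nsz_def power_add)
      then show ?thesis using kp by simp
    qed
    fix l assume l: "2 ^ l * (real k / N) < 10"
    have "real (2 ^ l * k) < 10 * real N" using l Np by (simp add: field_simps)
    then have k20: "2 ^ l * k \<le> 20 * N" by linarith
    have "A \<le> 2 ^ l * k" using k by (metis le_trans mult_le_mono1 nat_mult_1 one_le_numeral one_le_power)
    from up[OF j this k20]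
    show "Im (ntr N (Hfun eps (Suc m) \<omega>) (Complex (real_of_int j / N) (2 ^ l * (real k / N)))) \<le> Kup"
      by (simp add: s_eq grid_point_def)
  qed (use Kup in auto)
  \<comment> \<open>The factor 2/9 for passing from the grid to w and 1/2 for the half block turn K0
    / 2 into K0 / 18. This is twice K2, and the surplus K2 is what the defect may consume.\<close>
  have S0low: "K0 / 18 \<le> Im (S0 w)"
    if w: "Re w \<in> {c - \<delta> / 4..d + \<delta> / 4}" "\<eta>1 \<le> Im w" "Im w \<le> 19" for w
  proof -
    define j where "j = \<lfloor>Re w * N\<rfloor>"
    define k where "k = nat \<lfloor>Im w * N\<rfloor>"
    have w0: "0 \<le> Im w" using w \<eta>1 by linarith
    note g = grid_point_near[OF Np(1) w0, folded j_def k_def]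
    have "Im w < (real k + 1) / N" using g(4) Np by (simp only: pos_less_divide_eq)
    then have kw: "Im w - 1 / N \<le> real k / N" by (simp add: add_divide_distrib)
    have i8: "1 / N \<le> \<eta>1 / 8" using n2 Np by (simp add: field_simps)
    have kb: "\<eta>1 / 2 \<le> real k / N" using kw i8 w \<eta>1 by linarith
    have "Im w * real N \<le> 19 * real N" using w(3) Np by (intro mult_right_mono) auto
    then have "real k \<le> 20 * real N" using g(3) Np by linarith
    then have k20: "k \<le> 20 * N" by linarith
    have jJ: "real_of_int j / N \<in> {c - \<delta> / 2<..<d + \<delta> / 2}"
      using g(2) iN w(1) \<delta> unfolding atLeastAtMost_iff greaterThanLessThan_iff by linarith
    have gI: "Im (grid_point N j k) = real k / N" by (simp add: grid_point_def)
    have h2: "2 / real N \<le> \<eta>1 / 4" using n2 Np by (simp add: field_simps)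
    have "\<eta>1 / 4 \<le> r / 2" if "\<eta>1 / 2 \<le> r" for r using that by linarith
    note h2 = order_trans[OF h2 this[OF kb]]
    have "0 < Im (grid_point N j k)" using kb \<eta>1 gI by linarith
    moreover have "cmod (w - grid_point N j k) \<le> Im (grid_point N j k) / 2"
      unfolding gI norm_minus_commute[of w] by (rule order_trans[OF g(1) h2])
    ultimately have "2 / 9 * Im (s' (grid_point N j k)) \<le> Im (s' w)"
      unfolding s'_def by (rule ntr_Im_comparable[OF Hs(2)])
    moreover have "K0 / 2 < Im (s' (grid_point N j k))" by (rule low'[OF jJ kb k20])
    ultimately have "K0 / 9 \<le> Im (s' w)" by linarith
    moreover have "Im (s' w) / 2 \<le> Im (S0 w)" unfolding s'_def S0_def
      by (rule ntr_half_block) (use w \<eta>1 in linarith)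
    ultimately show ?thesis by linarith
  qed
  \<comment> \<open>The energy windows are nested: Re w differs from the grid energy by at most
    \<delta> / 8, so w lies in the window widened by \<delta> / 4, and the grid point next to w in
    the one widened by \<delta> / 2.\<close>
  have desc: "K2 \<le> Im (s (grid_point N j k))"
    if j: "real_of_int j / N \<in> {c - \<delta> / 8..d + \<delta> / 8}" and k: "A \<le> k" "k \<le> 10 * N" for j k
  proof -
    have jJ: "real_of_int j / N \<in> {c - \<delta> / 2<..<d + \<delta> / 2}" using j \<delta> by auto
    note jL = inL[OF jJ]
    show ?thesis using k
    proof (induction "10 * N - k" arbitrary: k rule: less_induct)
      case less
      show ?case
      proof (cases "\<eta>1 / 2 \<le> real k / N")
        case True
        from low[OF jJ True] less.prems show ?thesis using K0 by (simp add: K2_def)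
      next
        case False
        have kN: "k < 10 * N"
        proof (rule ccontr)
          assume "\<not> k < 10 * N"
          then have "real k / N = 10" using less.prems Np by simp
          then show False using False \<eta>1 by simp
        qed
        define g where "g = grid_point N j k"
        define g1 where "g1 = grid_point N j (Suc k)"
        have IH: "K2 \<le> Im (s g1)" unfolding g1_def using less.prems kN by (intro less.hyps) auto
        have Imk: "0 < Im g" using less.prems A Np by (simp add: g_def grid_point_def)
        have "g - g1 = Complex 0 (- (1 / N))" using Np by (simp add: g_def g1_def grid_point_def complex_eq_iff field_simps)
        then have "cmod (g - g1) = 1 / N" by (simp add: cmod_def)
        also have "\<dots> \<le> Im g1 / 2" using less.prems A Np by (simp add: g1_def grid_point_def field_simps)
        finally have "2 / 9 * Im (s g1) \<le> Im (s g)"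
          unfolding s_eq using Np by (intro ntr_Im_comparable[OF Hs(1)]) (simp_all add: g1_def grid_point_def)
        then have ug: "2 / 9 * K2 \<le> Im (s g)" using IH by linarith
        have k20: "k \<le> 20 * N" using less.prems by simp
        have uup: "Im (s g) < Kup" unfolding g_def by (rule up[OF jL less.prems(1) k20])
        define w where "w = g + of_real t * s g"
        have wI: "Im w = Im g + t * Im (s g)" by (simp add: w_def)
        have "t * (2 / 9 * K2) \<le> t * Im (s g)" using ug tp by (intro mult_left_mono) auto
        then have w1: "\<eta>1 \<le> Im w" using n3 Imk wI by linarith
        have "t * Im (s g) \<le> t * Kup" using uup tp by (intro mult_left_mono) auto
        moreover have "Im g < 1" using False \<eta>1 unfolding g_def grid_point_def complex.sel by linarith
        ultimately have w2: "Im w \<le> 19" using n5 wI by linarith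
        have "\<bar>Re w - Re g\<bar> \<le> t * cmod (s g)" using tp abs_Re_le_cmod[of "s g"]
          by (simp add: w_def abs_mult)
        also have "\<dots> \<le> t * (real (m + 5) * Kup + 1 / 10)"
          unfolding g_def using Sbound[OF jL less.prems(1)] tp by (intro mult_left_mono) auto
        finally have "\<bar>Re w - Re g\<bar> \<le> \<delta> / 8" using n4 by linarith
        moreover have "Re g \<in> {c - \<delta> / 8..d + \<delta> / 8}" using j by (simp add: g_def grid_point_def)
        ultimately have w3: "Re w \<in> {c - \<delta> / 4..d + \<delta> / 4}" unfolding atLeastAtMost_iff by linarith
        have S0w: "K0 / 18 \<le> Im (S0 w)" by (rule S0low[OF w3 w1 w2])
        have dw: "chi (Im (s g)) * cmod (s g - S0 w) < \<psi>"
          using def[OF jL less.prems(1) k20] by (simp add: defect_def Let_def s_def S0_def w_def t_def g_def)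
        \<comment> \<open>chi is bounded below on imaginary parts between 2/9 K2 and Kup. As \<psi>
          is this lower bound times K2, the weighted defect bound becomes |s - S0| < K2.\<close>
        have "(2 / 9 * K2) / (1 + Kup\<^sup>2) \<le> chi (Im (s g))"
          unfolding chi_def
        proof (rule frac_le)
          show "0 < 1 + (Im (s g))\<^sup>2" by (rule chi_pos_denom)
          show "1 + (Im (s g))\<^sup>2 \<le> 1 + Kup\<^sup>2" using uup ug K2 by (intro add_left_mono power_mono) auto
        qed (use ug K2 in auto)
        then have "(2 / 9 * K2) / (1 + Kup\<^sup>2) * cmod (s g - S0 w) \<le> chi (Im (s g)) * cmod (s g - S0 w)"
          by (intro mult_right_mono) auto
        with dw have lt: "(2 / 9 * K2) / (1 + Kup\<^sup>2) * cmod (s g - S0 w) < (2 / 9 * K2) / (1 + Kup\<^sup>2) * K2"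
          unfolding \<psi> by linarith
        have "0 < (2 / 9 * K2) / (1 + Kup\<^sup>2)" using K2 chi_pos_denom[of Kup] by simp
        with lt have "cmod (s g - S0 w) < K2" by (simp only: mult_less_cancel_left_pos)
        then have "Im (S0 w) - Im (s g) < K2" using abs_Im_le_cmod[of "s g - S0 w"] by simp
        then show ?thesis using S0w by (simp add: K2_def g_def)
      qed
    qed
  qed
  define j where "j = \<lfloor>Re z * N\<rfloor>"
  define k where "k = nat \<lfloor>Im z * N\<rfloor>"
  have zp: "0 < Im z * N" using z(2) by linarith
  then have z0: "0 < Im z" using Np by (simp add: zero_less_mult_iff)
  note g = grid_point_near[OF Np(1) less_imp_le[OF z0], folded j_def k_def]
  have kA: "A \<le> k" using g(4) z(2) by linarith
  have "Im z * N < 10 * N" using z(3) Np by simp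
  then have k10: "k \<le> 10 * N" using g(3) by linarith
  have jj: "real_of_int j / N \<in> {c - \<delta> / 8..d + \<delta> / 8}"
    using g(2) iN z(1) \<delta> unfolding atLeastAtMost_iff greaterThanLessThan_iff by linarith
  have gI: "Im (grid_point N j k) = real k / N" by (simp add: grid_point_def)
  \<comment> \<open>With A \<ge> 4 the distance 2 / N is at most half of both heights, so the
    comparison works from the grid point to z and back.\<close>
  have k4: "4 / N \<le> real k / N" using kA A by (intro divide_right_mono) auto
  have "real k / N \<le> Im z" using g(3) Np by (simp add: field_simps)
  then have z4: "4 / N \<le> Im z" using k4 by linarith
  have h4: "2 / real N \<le> real k / N / 2" "2 / real N \<le> Im z / 2"
    using divide_right_mono[OF k4, of 2] divide_right_mono[OF z4, of 2] by simp_all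
  have "cmod (z - grid_point N j k) \<le> Im (grid_point N j k) / 2"
    unfolding gI norm_minus_commute[of z] by (rule order_trans[OF g(1) h4(1)])
  moreover have "0 < 4 / real N" using Np by simp
  then have "0 < Im (grid_point N j k)" using k4 unfolding gI by linarith
  ultimately have "2 / 9 * Im (s (grid_point N j k)) \<le> Im (s z)"
    unfolding s_eq by (intro ntr_Im_comparable[OF Hs(1)])
  with desc[OF jj kA k10] show "2 / 9 * K2 \<le> Im (s z)" by linarith
  have "cmod (grid_point N j k - z) \<le> Im z / 2" by (rule order_trans[OF g(1) h4(2)])
  then have "2 / 9 * Im (s z) \<le> Im (s (grid_point N j k))"
    unfolding s_eq by (intro ntr_Im_comparable[OF Hs(1) z0])
  moreover have "Im (s (grid_point N j k)) < Kup"
  proof (rule up[OF inL kA])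
    show "real_of_int j / N \<in> {c - \<delta> / 2<..<d + \<delta> / 2}" using jj \<delta> by auto
    show "k \<le> 20 * N" using k10 by simp
  qed
  ultimately show "Im (s z) \<le> 9 / 2 * Kup" by linarith
qed

subsection \<open>The main estimate\<close>

text \<open>Compact boxes exhaust the open set. On each box a continuous function that stays below C
  does so with a margin 1 / (i + 1), and a non-strict bound can be tested on a countable dense
  subset.\<close>

lemma sets_ball_less:
  fixes f :: "'a \<Rightarrow> complex \<Rightarrow> real"
  assumes O: "open O'" and cont: "\<And>\<omega>. continuous_on O' (f \<omega>)"
    and meas: "\<And>z. z \<in> O' \<Longrightarrow> (\<lambda>\<omega>. f \<omega> z) \<in> borel_measurable M"
  shows "{\<omega>\<in>space M. \<forall>z\<in>O'. f \<omega> z < C} \<in> sets M"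
proof -
  obtain D where D: "countable D" "D \<subseteq> Pow O'" "\<And>X. X \<in> D \<Longrightarrow> \<exists>a b. X = cbox a b" "\<Union>D = O'"
    using open_countable_Union_open_cbox[OF O] by metis
  have "{\<omega>\<in>space M. \<forall>z\<in>K. f \<omega> z < C} \<in> sets M" if K: "K \<in> D" for K
  proof -
    have sub: "K \<subseteq> O'" using D(2) K by auto
    have cK: "compact K" using D(3)[OF K] compact_cbox by auto
    obtain T where T: "countable T" "T \<subseteq> K" "K \<subseteq> closure T" using separable by blast
    have clT: "closure T = K" using T(2,3) compact_imp_closed[OF cK] closure_minimal by blast
    have "(\<forall>z\<in>K. f \<omega> z < C) \<longleftrightarrow> (\<exists>i::nat. \<forall>z\<in>T. f \<omega> z \<le> C - 1 / real (Suc i))" for \<omega>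
    proof
      assume lt: "\<forall>z\<in>K. f \<omega> z < C"
      show "\<exists>i::nat. \<forall>z\<in>T. f \<omega> z \<le> C - 1 / real (Suc i)"
      proof (cases "K = {}")
        case False
        obtain z0 where z0: "z0 \<in> K" "\<And>z. z \<in> K \<Longrightarrow> f \<omega> z \<le> f \<omega> z0"
          using continuous_attains_sup[OF cK False continuous_on_subset[OF cont sub]] by metis
        have "0 < C - f \<omega> z0" using lt z0 by simp
        then obtain i where "inverse (real (Suc i)) < C - f \<omega> z0" using reals_Archimedean by blast
        then have "f \<omega> z \<le> C - 1 / real (Suc i)" if "z \<in> T" for z
          using z0(2)[of z] that T(2) by (auto simp: inverse_eq_divide)
        then show ?thesis by blast
      qed (use T in auto)
    next
      assume "\<exists>i::nat. \<forall>z\<in>T. f \<omega> z \<le> C - 1 / real (Suc i)"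
      then obtain i :: nat where i: "\<And>z. z \<in> T \<Longrightarrow> f \<omega> z \<le> C - 1 / real (Suc i)" by blast
      show "\<forall>z\<in>K. f \<omega> z < C"
      proof
        fix z assume "z \<in> K"
        have "f \<omega> z \<le> C - 1 / real (Suc i)"
          by (rule continuous_le_on_closure[of T "f \<omega>"])
            (use continuous_on_subset[OF cont sub] clT \<open>z \<in> K\<close> i in auto)
        also have "\<dots> < C" by simp
        finally show "f \<omega> z < C" .
      qed
    qed
    then have "{\<omega>\<in>space M. \<forall>z\<in>K. f \<omega> z < C} = {\<omega>\<in>space M. \<exists>i::nat. \<forall>z\<in>T. f \<omega> z \<le> C - 1 / real (Suc i)}"
      by simp
    also have "\<dots> \<in> sets M"
    proof (intro sets.sets_Collect_countable_Ex sets.sets_Collect_countable_All' T(1))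
      fix i :: nat and z assume "z \<in> T"
      then have [measurable]: "(\<lambda>\<omega>. f \<omega> z) \<in> borel_measurable M" using T(2) sub by (intro meas) auto
      show "{\<omega>\<in>space M. f \<omega> z \<le> C - 1 / real (Suc i)} \<in> sets M" by measurable
    qed
    finally show ?thesis .
  qed
  then have "{\<omega>\<in>space M. \<forall>K\<in>D. \<forall>z\<in>K. f \<omega> z < C} \<in> sets M"
    by (rule sets.sets_Collect_countable_All'[OF _ D(1)])
  also have "{\<omega>\<in>space M. \<forall>K\<in>D. \<forall>z\<in>K. f \<omega> z < C} = {\<omega>\<in>space M. \<forall>z\<in>O'. f \<omega> z < C}"
    unfolding D(4)[symmetric] by auto
  finally show ?thesis .
qed

lemma sets_ball_le:
  fixes f :: "'a \<Rightarrow> complex \<Rightarrow> real"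
  assumes "open O'" and "\<And>\<omega>. continuous_on O' (f \<omega>)"
    and "\<And>z. z \<in> O' \<Longrightarrow> (\<lambda>\<omega>. f \<omega> z) \<in> borel_measurable M"
  shows "{\<omega>\<in>space M. \<forall>z\<in>O'. f \<omega> z \<le> C} \<in> sets M"
proof -
  have eq: "a \<le> C \<longleftrightarrow> (\<forall>i::nat. a < C + 1 / real (Suc i))" for a
  proof
    assume "\<forall>i::nat. a < C + 1 / real (Suc i)"
    show "a \<le> C"
    proof (rule ccontr)
      assume "\<not> a \<le> C"
      then obtain i where "inverse (real (Suc i)) < a - C" using reals_Archimedean[of "a - C"] by auto
      moreover have "a < C + 1 / real (Suc i)" using \<open>\<forall>i::nat. a < C + 1 / real (Suc i)\<close> by blast
      ultimately show False by (simp add: inverse_eq_divide)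
    qed
  qed (auto intro: le_less_trans)
  have "{\<omega>\<in>space M. \<forall>z\<in>O'. f \<omega> z \<le> C} = {\<omega>\<in>space M. \<forall>i::nat. \<forall>z\<in>O'. f \<omega> z < C + 1 / real (Suc i)}"
    unfolding eq by auto
  also have "\<dots> \<in> sets M"
    by (intro sets.sets_Collect_countable_All sets_ball_less assms)
  finally show ?thesis .
qed

lemma Omega_eq: "Omega \<alpha> {c<..<d} n = {z. Re z \<in> {c<..<d} \<and> real (Nsz n) powr (-1 + \<alpha>) < Im z \<and> Im z < 10}"
  unfolding Omega_def by (auto intro: complex_eqI) (metis complex.collapse)

lemma Omega_Im_pos: "z \<in> Omega \<alpha> {c<..<d} n \<Longrightarrow> 0 < Im z"
  unfolding Omega_eq by (auto intro: le_less_trans[OF powr_ge_zero])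

lemma open_Omega: "open (Omega \<alpha> {c<..<d} n)"
proof -
  have "open {z. c < Re z \<and> Re z < d \<and> real (Nsz n) powr (-1 + \<alpha>) < Im z \<and> Im z < 10}"
    by (intro open_Collect_conj open_Collect_less continuous_intros)
  then show ?thesis by (simp add: Omega_eq)
qed

text \<open>Monotonicity of \<open>measure\<close> needs the larger event to be measurable, and this
  event quantifies over uncountably many z.\<close>

lemma good_event_measurable:
  "{\<omega> \<in> space Gspace. \<forall>z\<in>Omega \<alpha> {c<..<d} n.
      Kl \<le> Im (Stieltjes eps n \<omega> z) \<and> Im (Stieltjes eps n \<omega> z) \<le> Ku \<and>
      Kl < cmod (Stieltjes eps n \<omega> z) \<and> cmod (Stieltjes eps n \<omega> z) < b} \<in> sets Gspace"
proof -
  let ?O = "Omega \<alpha> {c<..<d} n"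
  let ?s = "\<lambda>\<omega>. ntr (Nsz n) (Hfun eps n \<omega>)"
  have cont: "continuous_on ?O (?s \<omega>)" for \<omega>
    by (intro continuous_at_imp_continuous_on ballI DERIV_isCont[OF ntr_param_derivative[OF msym_Hfun Omega_Im_pos]])
  have cI: "continuous_on ?O (\<lambda>z. Im (?s \<omega> z))" "continuous_on ?O (\<lambda>z. - Im (?s \<omega> z))"
    "continuous_on ?O (\<lambda>z. cmod (?s \<omega> z))" "continuous_on ?O (\<lambda>z. - cmod (?s \<omega> z))" for \<omega>
    by (intro continuous_intros cont)+
  have mI: "(\<lambda>\<omega>. Im (?s \<omega> z)) \<in> borel_measurable Gspace" "(\<lambda>\<omega>. - Im (?s \<omega> z)) \<in> borel_measurable Gspace"
    "(\<lambda>\<omega>. cmod (?s \<omega> z)) \<in> borel_measurable Gspace" "(\<lambda>\<omega>. - cmod (?s \<omega> z)) \<in> borel_measurable Gspace" for z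
    by measurable
  note op = open_Omega[of \<alpha> c d n]
  have "{\<omega> \<in> space Gspace. (\<forall>z\<in>?O. - Im (?s \<omega> z) \<le> - Kl) \<and> (\<forall>z\<in>?O. Im (?s \<omega> z) \<le> Ku) \<and>
      (\<forall>z\<in>?O. - cmod (?s \<omega> z) < - Kl) \<and> (\<forall>z\<in>?O. cmod (?s \<omega> z) < b)} \<in> sets Gspace"
    by (intro sets.sets_Collect_conj sets_ball_le[OF op cI(2) mI(2)] sets_ball_le[OF op cI(1) mI(1)]
      sets_ball_less[OF op cI(4) mI(4)] sets_ball_less[OF op cI(3) mI(3)])
  also have "{\<omega> \<in> space Gspace. (\<forall>z\<in>?O. - Im (?s \<omega> z) \<le> - Kl) \<and> (\<forall>z\<in>?O. Im (?s \<omega> z) \<le> Ku) \<and>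
      (\<forall>z\<in>?O. - cmod (?s \<omega> z) < - Kl) \<and> (\<forall>z\<in>?O. cmod (?s \<omega> z) < b)}
    = {\<omega> \<in> space Gspace. \<forall>z\<in>?O. Kl \<le> Im (Stieltjes eps n \<omega> z) \<and> Im (Stieltjes eps n \<omega> z) \<le> Ku \<and>
      Kl < cmod (Stieltjes eps n \<omega> z) \<and> cmod (Stieltjes eps n \<omega> z) < b}"
    using Omega_Im_pos[of _ \<alpha> c d n] by (auto simp: Stieltjes_eq)
  finally show ?thesis .
qed

text \<open>If a point closer than \<delta> to the interval were outside Wt, the segment joining it
  to a point of the interval would meet the frontier of Wt at a distance below \<delta>.\<close>

lemma neighbourhood_of_interval:
  fixes c d \<delta> :: real and Wt :: "real set"
  assumes cd: "c < d" and sub: "{c<..<d} \<subseteq> Wt"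
    and dist: "\<And>x y. x \<in> {c<..<d} \<Longrightarrow> y \<in> frontier Wt \<Longrightarrow> \<delta> \<le> dist x y"
  shows "{c - \<delta><..<d + \<delta>} \<subseteq> Wt"
proof
  fix y assume y: "y \<in> {c - \<delta><..<d + \<delta>}"
  show "y \<in> Wt"
  proof (rule ccontr)
    assume nW: "y \<notin> Wt"
    then have out: "y \<le> c \<or> d \<le> y" using sub by (meson greaterThanLessThan_iff not_le subsetD)
    obtain x where x: "x \<in> {c<..<d}" "\<bar>x - y\<bar> < \<delta>"
    proof (cases "y \<le> c")
      case True
      define x where "x = min ((c + d) / 2) ((c + (y + \<delta>)) / 2)"
      have "c < x" "x < d" "x < y + \<delta>" "y < x" using y cd True by (auto simp: x_def min_def)
      then show ?thesis using that[of x] by auto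
    next
      case False
      define x where "x = max ((c + d) / 2) ((d + (y - \<delta>)) / 2)"
      have "c < x" "x < d" "y - \<delta> < x" "x < y" using y cd False out by (auto simp: x_def max_def)
      then show ?thesis using that[of x] by auto
    qed
    have "closed_segment x y \<inter> frontier Wt \<noteq> {}"
      using x(1) sub nW by (intro connected_Int_frontier connected_segment) auto
    then obtain f where f: "f \<in> closed_segment x y" "f \<in> frontier Wt" by blast
    have "dist x f \<le> dist x y" using f(1) by (auto simp: closed_segment_eq_real_ivl dist_real_def split: if_splits)
    then show False using dist[OF x(1) f(2)] x(2) by (simp add: dist_real_def)
  qed
qed

lemma tscale_eq: "tscale eps n = real (Nsz n) powr (- (1 + eps))"
  by (simp add: tscale_def Nsz_def powr_realpow[symmetric] powr_powr mult.commute)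

text \<open>The half-width h = min (Im z) (\<delta> / 2) of the tent keeps its support inside Wt. As
  Im z \<le> 20, the ratio h / Im z is at least min 1 (\<delta> / 40), so the bound is uniform in
  the height.\<close>

lemma mean_bound:
  assumes dos: "is_dos eps \<rho>" and low: "\<And>x. x \<in> Wt \<Longrightarrow> \<kappa> \<le> \<rho> n x" and \<kappa>: "0 < \<kappa>"
    and sub: "{c - \<delta><..<d + \<delta>} \<subseteq> Wt" and \<delta>: "0 < \<delta>"
    and z: "Re z \<in> {c - \<delta> / 2<..<d + \<delta> / 2}" "0 < Im z" "Im z \<le> 20"
  shows "\<kappa> * min 1 (\<delta> / 40) / 4 \<le> (\<integral>\<omega>. Im (ntr (Nsz n) (Hfun eps n \<omega>) z) \<partial>Gspace)"
proof -
  define h where "h = min (Im z) (\<delta> / 2)"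
  have h: "0 < h" "h \<le> Im z" using z \<delta> by (auto simp: h_def)
  have hd: "h \<le> \<delta> / 2" by (simp add: h_def)
  have sub': "{Re z - h<..<Re z + h} \<subseteq> Wt"
    using z(1) hd by (intro order_trans[OF _ sub]) auto
  have "min 1 (\<delta> / 40) \<le> h / Im z"
  proof (cases "Im z \<le> \<delta> / 2")
    case False
    then have "h / Im z = (\<delta> / 2) / Im z" by (simp add: h_def)
    moreover have "(\<delta> / 2) / 20 \<le> (\<delta> / 2) / Im z" using z \<delta> by (intro divide_left_mono) auto
    ultimately show ?thesis by (simp add: min_le_iff_disj)
  qed (use z in \<open>simp add: h_def\<close>)
  then have "\<kappa> / 4 * min 1 (\<delta> / 40) \<le> \<kappa> / 4 * (h / Im z)" using \<kappa> by (intro mult_left_mono) auto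
  also have "\<dots> = \<kappa> * h / (4 * Im z)" by simp
  also have "\<dots> \<le> (\<integral>\<omega>. Im (ntr (Nsz n) (Hfun eps n \<omega>) (Complex (Re z) (Im z))) \<partial>Gspace)"
    by (rule expected_Im_lower[OF dos low \<kappa> sub' h])
  finally show ?thesis by simp
qed

theorem theorem4p1:
  fixes eps \<alpha> c d :: real and W Wt :: "real set" and \<rho> :: "nat \<Rightarrow> real \<Rightarrow> real"
  assumes "-1 < eps" and "eps < -1/2"
    and "is_dos eps \<rho>"
    and "bulk_set \<rho> W Wt"
    and "W \<subseteq> {c<..<d}" and "{c<..<d} \<subseteq> Wt"
    and "\<exists>\<delta>>0. \<forall>x\<in>{c<..<d}. \<forall>y\<in>frontier Wt. \<delta> \<le> dist x y"
    and "0 < \<alpha>" and "\<alpha> < 1"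
  shows "\<exists>Kl Ku. 0 < Kl \<and> 0 < Ku \<and>
    (\<forall>p>0. eventually (\<lambda>r.
       measure Gspace {\<omega> \<in> space Gspace. \<forall>z\<in>Omega \<alpha> {c<..<d} r.
          Kl \<le> Im (Stieltjes eps r \<omega> z) \<and> Im (Stieltjes eps r \<omega> z) \<le> Ku \<and>
          Kl < cmod (Stieltjes eps r \<omega> z) \<and> cmod (Stieltjes eps r \<omega> z) < Ku * ln (real (Nsz r))}
       \<ge> 1 - real (Nsz r) powr (- p)) sequentially)"
proof -
  obtain a b where ab: "a \<le> b" "W = {a..b}" using assms(4) by (auto simp: bulk_set_def)
  then have cd: "c < d" using assms(5) by (auto simp: subset_iff)
  obtain \<kappa> where \<kappa>: "0 < \<kappa>" and evk: "eventually (\<lambda>n. \<forall>E\<in>Wt. \<kappa> \<le> \<rho> n E) sequentially"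
    using assms(4) by (auto simp: bulk_set_def)
  obtain \<delta> where \<delta>: "0 < \<delta>" and dist: "\<And>x y. x \<in> {c<..<d} \<Longrightarrow> y \<in> frontier Wt \<Longrightarrow> \<delta> \<le> dist x y"
    using assms(7) by blast
  have nbh: "{c - \<delta><..<d + \<delta>} \<subseteq> Wt" by (rule neighbourhood_of_interval[OF cd assms(6) dist])
  define \<tau> where "\<tau> = 1 + eps"
  \<comment> \<open>The midpoint of \<tau> and 1/2. Above \<tau>, the scale N^(-\<theta>) is
    eventually below any multiple of t; below 1/2, the exponent 1 - 2 \<theta> of the concentration
    bound is positive.\<close>
  define \<theta> where "\<theta> = \<tau> / 2 + 1 / 4"
  have \<tau>: "0 < \<tau>" "\<tau> < 1 / 2" using assms(1,2) by (auto simp: \<tau>_def)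
  have \<theta>: "\<tau> < \<theta>" "\<theta> < 1 / 2" "0 < \<theta>" "\<theta> < 1" using \<tau> by (auto simp: \<theta>_def)
  define K0 where "K0 = \<kappa> * min 1 (\<delta> / 40) / 4"
  have K0: "0 < K0" using \<kappa> \<delta> by (simp add: K0_def)
  define K2 where "K2 = K0 / 36"
  have K2: "0 < K2" using K0 by (simp add: K2_def)
  define Kup where "Kup = 4 * exp 2 * pi"
  have Kup1: "1 \<le> Kup"
  proof -
    have "1 * 1 \<le> exp 2 * pi" using pi_gt3 by (intro mult_mono) auto
    then show ?thesis by (simp add: Kup_def)
  qed
  define \<psi> where "\<psi> = (2 / 9 * K2) / (1 + Kup\<^sup>2) * K2"
  have \<psi>: "0 < \<psi>" unfolding \<psi>_def using K2 chi_pos_denom[of Kup] by simp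
  define L where "L = \<bar>c\<bar> + \<bar>d\<bar> + \<delta>"
  have L0: "0 < L" using \<delta> by (simp add: L_def)
  \<comment> \<open>Half of the lower bound 2/9 K2 for Im S, so that |S| exceeds it strictly. The
    factor 18 in Ku is chosen for the logarithmic bound at the end and also covers 9/2 Kup.\<close>
  define Kl where "Kl = K2 / 9"
  define Ku where "Ku = 18 * Kup"
  have "eventually (\<lambda>r. measure Gspace {\<omega> \<in> space Gspace. \<forall>z\<in>Omega \<alpha> {c<..<d} r.
          Kl \<le> Im (Stieltjes eps r \<omega> z) \<and> Im (Stieltjes eps r \<omega> z) \<le> Ku \<and>
          Kl < cmod (Stieltjes eps r \<omega> z) \<and> cmod (Stieltjes eps r \<omega> z) < Ku * ln (real (Nsz r))}
       \<ge> 1 - real (Nsz r) powr (- p)) sequentially" if p: "0 < p" for p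
  proof -
    \<comment> \<open>Order of the moment: the defect tail decays like N^(-2 \<alpha> P), which has
      to beat N^(-(p + 4)).\<close>
    define P where "P = nat \<lceil>(p + 4) / (2 * \<alpha>)\<rceil> + 1"
    have P1: "1 \<le> P" by (simp add: P_def)
    have "(p + 4) / (2 * \<alpha>) \<le> real P" unfolding P_def by linarith
    then have P2: "p + 4 \<le> 2 * \<alpha> * real P" using assms(8) by (simp add: pos_divide_le_eq mult.commute)
    \<comment> \<open>The 4 of \<open>defect_tail\<close> becomes 8 because grid heights only
      satisfy N \<eta> \<ge> N^\<alpha> / 2.\<close>
    define C4 where "C4 = 2 * (8 * (3 + 8 * real P) / \<psi>) ^ (2 * P)"
    have C4: "0 \<le> C4" unfolding C4_def using \<psi> by simp
    \<comment> \<open>64 = 8 * 2 * 4: the 8 of \<open>lower_tail\<close>, a 2 for the previous level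
      with only N / 2 sites, and a 4 for grid heights down to half of N^(-\<theta>).\<close>
    define c1 where "c1 = K0\<^sup>2 / 64"
    have c1: "0 < c1" using K0 by (simp add: c1_def)
    have \<beta>: "0 < 1 - 2 * \<theta>" using \<theta> by simp
    let ?x = "\<lambda>m. real (Nsz (Suc m))"
    have xlim: "filterlim ?x at_top sequentially"
    proof -
      have "filterlim (\<lambda>m::nat. (2::real) ^ Suc m) at_top sequentially" by real_asymp
      then show ?thesis by (simp add: Nsz_def)
    qed
    note ev = eventually_compose_filterlim[OF _ xlim]
    have "eventually (\<lambda>x::real. 8 \<le> x powr \<alpha>) at_top" using assms(8) by real_asymp
    note e1 = ev[OF this]
    have "eventually (\<lambda>x::real. 16 \<le> x * \<delta>) at_top" using \<delta> by real_asymp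
    note e2 = ev[OF this]
    have "eventually (\<lambda>x::real. 8 \<le> x * x powr (- \<theta>)) at_top" using \<theta>(4) by real_asymp
    note e3 = ev[OF this]
    have "eventually (\<lambda>x::real. x powr (- \<theta>) \<le> 1) at_top" using \<theta>(3) by real_asymp
    note e4 = ev[OF this]
    have "eventually (\<lambda>x::real. x powr (- \<theta>) \<le> x powr (- \<tau>) * (2 / 9 * K2)) at_top" using \<theta>(1) K2 by real_asymp
    note e5 = ev[OF this]
    \<comment> \<open>At x = 2^(m + 1) the expression ln x / ln 2 + 4 is m + 5, the number of
      doublings in the bound on |S|.\<close>
    have "eventually (\<lambda>x::real. x powr (- \<tau>) * ((ln x / ln 2 + 4) * Kup + 1 / 10) \<le> \<delta> / 8) at_top"
      using \<tau>(1) \<delta> by real_asymp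
    note e6 = ev[OF this]
    have "eventually (\<lambda>x::real. x powr (- \<tau>) * Kup \<le> 1) at_top" using \<tau>(1) Kup1 by real_asymp
    note e7 = ev[OF this]
    have "eventually (\<lambda>x::real. exp (- (1 / 2 * x powr \<alpha>)) \<le> x powr (- (p + 4))) at_top" using assms(8) by real_asymp
    note e8 = ev[OF this]
    have "eventually (\<lambda>x::real. exp (- (c1 * x powr (1 - 2 * \<theta>))) \<le> x powr (- (p + 4))) at_top" using c1 \<beta> by real_asymp
    note e9 = ev[OF this]
    have "eventually (\<lambda>x::real. (2 * L * x + 1) * (20 * x + 1) * ((4 + C4) * x powr (- (p + 4))) \<le> x powr (- p)) at_top"
      using L0 C4 by real_asymp
    note e10 = ev[OF this]
    have e11: "eventually (\<lambda>m. \<forall>E\<in>Wt. \<kappa> \<le> \<rho> (Suc m) E) sequentially"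
      by (rule iffD2[OF eventually_sequentially_Suc evk])
    have e12: "eventually (\<lambda>m::nat. 2 \<le> m) sequentially" by (rule eventually_ge_at_top)
    \<comment> \<open>Levels are written as Suc m so that a previous level m exists; the index is
      shifted back at the end.\<close>
    have "eventually (\<lambda>m. measure Gspace {\<omega> \<in> space Gspace. \<forall>z\<in>Omega \<alpha> {c<..<d} (Suc m).
          Kl \<le> Im (Stieltjes eps (Suc m) \<omega> z) \<and> Im (Stieltjes eps (Suc m) \<omega> z) \<le> Ku \<and>
          Kl < cmod (Stieltjes eps (Suc m) \<omega> z) \<and> cmod (Stieltjes eps (Suc m) \<omega> z) < Ku * ln (real (Nsz (Suc m)))}
       \<ge> 1 - real (Nsz (Suc m)) powr (- p)) sequentially"
      using e1 e2 e3 e4 e5 e6 e7 e8 e9 e10 e11 e12 evk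
    proof eventually_elim
      case (elim m)
      define N where "N = Nsz (Suc m)"
      define x where "x = real N"
      \<comment> \<open>Half the lower edge of the spectral domain in grid units: rounding a point
        of the domain down to the grid and one further row still stay above A.\<close>
      define A where "A = nat \<lceil>x powr \<alpha> / 2\<rceil>"
      define \<eta>1 where "\<eta>1 = x powr (- \<theta>)"
      note el = elim[folded N_def, folded x_def]
      have Np: "0 < N" and xp: "0 < x" by (simp_all add: N_def x_def)
      have x1: "1 \<le> x" using Np by (simp add: x_def)
      have \<eta>p: "0 < \<eta>1" "\<eta>1 \<le> 1" using xp el(4) by (simp_all add: \<eta>1_def)
      have Alow: "x powr \<alpha> / 2 \<le> real A" unfolding A_def by linarith
      have Aup: "real A \<le> x powr \<alpha> / 2 + 1" unfolding A_def using el(1) by linarith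
      have A4: "4 \<le> A" using Alow el(1) by linarith
      define F where "F = x powr (- (p + 4))"
      have F0: "0 \<le> F" by (simp add: F_def)
      have B1: "measure Gspace {\<omega>. Kup \<le> Im (ntr N (Hfun eps (Suc m) \<omega>) (grid_point N j k))} \<le> 2 * F" if k: "A \<le> k" for j k
      proof -
        have "0 < real k" using k A4 by linarith
        then have "0 < Im (grid_point N j k)" using Np by (simp add: grid_point_def)
        from upper_tail[OF this, where eps = eps and n = "Suc m", folded N_def]
        have "measure Gspace {\<omega>. Kup \<le> Im (ntr N (Hfun eps (Suc m) \<omega>) (grid_point N j k))} \<le> 2 * exp (- 2 * exp 2 * (x * (pi * Im (grid_point N j k))))"
          unfolding Kup_def x_def .
        also have "x * (pi * Im (grid_point N j k)) = pi * k" using Np by (simp add: grid_point_def x_def)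
        also have "2 * exp (- 2 * exp 2 * (pi * k)) \<le> 2 * exp (- (1 / 2 * x powr \<alpha>))"
        proof -
          have "1 * 1 \<le> (2 * exp 2) * pi" using pi_gt3 by (intro mult_mono) (auto intro: order_trans[of 1 2])
          then have "1 * real k \<le> (2 * exp 2) * pi * real k" by (intro mult_right_mono) auto
          moreover have "x powr \<alpha> / 2 \<le> real k" using Alow k by linarith
          ultimately show ?thesis by simp
        qed
        also have "\<dots> \<le> 2 * F" using el(8) by (simp add: F_def)
        finally show ?thesis .
      qed
      \<comment> \<open>Stated for a general level n with at least N / 2 sites, in order to cover
        the full matrix and the previous level at the same grid points.\<close>
      have B23: "measure Gspace {\<omega>. Im (ntr (Nsz n) (Hfun eps n \<omega>) (grid_point N j k)) \<le> K0 / 2} \<le> F"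
        if n: "\<And>E. E \<in> Wt \<Longrightarrow> \<kappa> \<le> \<rho> n E" "x / 2 \<le> real (Nsz n)"
          and j: "real_of_int j / N \<in> {c - \<delta> / 2<..<d + \<delta> / 2}" and k: "\<eta>1 / 2 \<le> real k / N" "k \<le> 20 * N" for n j k
      proof -
        have g: "0 < Im (grid_point N j k)" "Im (grid_point N j k) \<le> 20"
        proof -
          show "0 < Im (grid_point N j k)" using k \<eta>p unfolding grid_point_def complex.sel by linarith
          have "real k \<le> 20 * real N" using k(2) by linarith
          then show "Im (grid_point N j k) \<le> 20" using Np by (simp add: grid_point_def pos_divide_le_eq)
        qed
        have mean: "K0 \<le> (\<integral>\<omega>. Im (ntr (Nsz n) (Hfun eps n \<omega>) (grid_point N j k)) \<partial>Gspace)"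
          unfolding K0_def by (rule mean_bound[OF assms(3) n(1) \<kappa> nbh \<delta> _ g]) (use j in \<open>simp_all add: grid_point_def\<close>)
        have "measure Gspace {\<omega>. Im (ntr (Nsz n) (Hfun eps n \<omega>) (grid_point N j k)) \<le> K0 / 2}
          \<le> exp (- (K0\<^sup>2 * real (Nsz n) * (Im (grid_point N j k))\<^sup>2 / 8))"
          by (rule lower_tail[OF g(1) K0 mean])
        also have "\<dots> \<le> exp (- (c1 * x powr (1 - 2 * \<theta>)))"
        proof -
          have "(\<eta>1 / 2)\<^sup>2 \<le> (Im (grid_point N j k))\<^sup>2" using k(1) \<eta>p by (intro power_mono) (simp_all add: grid_point_def)
          then have "(x / 2) * (\<eta>1 / 2)\<^sup>2 \<le> real (Nsz n) * (Im (grid_point N j k))\<^sup>2"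
            using n(2) xp by (intro mult_mono) auto
          then have "K0\<^sup>2 / 8 * ((x / 2) * (\<eta>1 / 2)\<^sup>2) \<le> K0\<^sup>2 / 8 * (real (Nsz n) * (Im (grid_point N j k))\<^sup>2)"
            by (intro mult_left_mono) auto
          moreover have "c1 * x powr (1 - 2 * \<theta>) = K0\<^sup>2 / 8 * ((x / 2) * (\<eta>1 / 2)\<^sup>2)"
          proof -
            have "\<eta>1\<^sup>2 = x powr (- 2 * \<theta>)" unfolding \<eta>1_def power2_eq_square powr_add[symmetric] by simp
            moreover have "x powr (1 - 2 * \<theta>) = x * x powr (- 2 * \<theta>)"
              using powr_add[of x 1 "- 2 * \<theta>"] xp by simp
            ultimately show ?thesis by (simp add: c1_def power_divide)
          qed
          moreover have "K0\<^sup>2 / 8 * (real (Nsz n) * (Im (grid_point N j k))\<^sup>2) = K0\<^sup>2 * real (Nsz n) * (Im (grid_point N j k))\<^sup>2 / 8"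
            by simp
          ultimately have "c1 * x powr (1 - 2 * \<theta>) \<le> K0\<^sup>2 * real (Nsz n) * (Im (grid_point N j k))\<^sup>2 / 8" by metis
          then show ?thesis by simp
        qed
        also have "\<dots> \<le> F" using el(9) by (simp add: F_def)
        finally show ?thesis .
      qed
      have B4: "measure Gspace {\<omega>. \<psi> \<le> defect eps m \<omega> (grid_point N j k)} \<le> C4 * F" if k: "A \<le> k" for j k
      proof -
        have kp: "1 \<le> real k" using k A4 by linarith
        then have zp: "0 < Im (grid_point N j k)" using Np by (simp add: grid_point_def)
        have Nk: "real N * Im (grid_point N j k) = real k" using Np by (simp add: grid_point_def)
        have "measure Gspace {\<omega>. \<psi> \<le> defect eps m \<omega> (grid_point N j k)} \<le> 2 * (4 * (3 + 8 * real P) / (real k * \<psi>)) ^ (2 * P)"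
          using defect_tail[OF zp P1 _ \<psi>, where eps = eps and m = m, folded N_def] kp unfolding Nk by simp
        also have "\<dots> \<le> 2 * ((8 * (3 + 8 * real P) / \<psi>) / x powr \<alpha>) ^ (2 * P)"
        proof (intro mult_left_mono power_mono)
          have "x powr \<alpha> * \<psi> \<le> 2 * (real k * \<psi>)"
            using Alow k \<psi> by (simp add: mult.assoc[symmetric] mult_right_mono)
          moreover have "0 < x powr \<alpha>" using xp by simp
          ultimately have "4 * (3 + 8 * real P) / (real k * \<psi>) \<le> 4 * (3 + 8 * real P) / (x powr \<alpha> * \<psi> / 2)"
            using \<psi> kp by (intro divide_left_mono mult_pos_pos) auto
          then show "4 * (3 + 8 * real P) / (real k * \<psi>) \<le> (8 * (3 + 8 * real P) / \<psi>) / x powr \<alpha>"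
            by (simp add: mult.commute)
        qed (use \<psi> in auto)
        also have "\<dots> = C4 * (1 / (x powr \<alpha>) ^ (2 * P))" by (simp add: C4_def power_divide power_mult_distrib)
        also have "1 / (x powr \<alpha>) ^ (2 * P) \<le> F"
        proof -
          have "(x powr \<alpha>) ^ (2 * P) = x powr (\<alpha> * real (2 * P))"
            using xp by (simp add: powr_powr powr_realpow[symmetric])
          then have "1 / (x powr \<alpha>) ^ (2 * P) = x powr (- (2 * \<alpha> * real P))"
            by (simp add: powr_minus_divide ac_simps)
          also have "\<dots> \<le> F" unfolding F_def using P2 x1 by (intro powr_mono) auto
          finally show ?thesis .
        qed
        finally show ?thesis using C4 by (auto intro: mult_left_mono)
      qed
      define JJ where "JJ = {- \<lfloor>L * x\<rfloor>..\<lfloor>L * x\<rfloor>}"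
      define KK where "KK = {..20 * N}"
      \<comment> \<open>The side conditions are built into the bad sets, so that the union runs over
        a plain rectangle of indices and irrelevant pairs contribute the empty set.\<close>
      define b1 where "b1 j k = {\<omega>. A \<le> k \<and> Kup \<le> Im (ntr N (Hfun eps (Suc m) \<omega>) (grid_point N j k))}" for j k
      define cnd where "cnd j k \<longleftrightarrow> real_of_int j / N \<in> {c - \<delta> / 2<..<d + \<delta> / 2} \<and> \<eta>1 / 2 \<le> real k / N" for j k
      define b2 where "b2 j k = {\<omega>. cnd j k \<and> Im (ntr N (Hfun eps (Suc m) \<omega>) (grid_point N j k)) \<le> K0 / 2}" for j k
      define b3 where "b3 j k = {\<omega>. cnd j k \<and> Im (ntr (Nsz m) (Hfun eps m \<omega>) (grid_point N j k)) \<le> K0 / 2}" for j k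
      define b4 where "b4 j k = {\<omega>. A \<le> k \<and> \<psi> \<le> defect eps m \<omega> (grid_point N j k)}" for j k
      define bad where "bad = (\<Union>q\<in>JJ \<times> KK. b1 (fst q) (snd q) \<union> b2 (fst q) (snd q) \<union> b3 (fst q) (snd q) \<union> b4 (fst q) (snd q))"
      have setI: "{\<omega>. Q \<and> R \<omega>} \<in> sets Gspace" if "Q \<Longrightarrow> {\<omega>\<in>space Gspace. R \<omega>} \<in> sets Gspace" for Q R
        using that by (cases Q) auto
      have s1: "b1 j k \<in> sets Gspace" for j k unfolding b1_def by (rule setI) measurable
      have s2: "b2 j k \<in> sets Gspace" for j k unfolding b2_def by (rule setI) measurable
      have s3: "b3 j k \<in> sets Gspace" for j k unfolding b3_def by (rule setI) measurable
      have s4: "b4 j k \<in> sets Gspace" for j k unfolding b4_def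
      proof (rule setI)
        assume "A \<le> k"
        then have "0 < real k" using A4 by linarith
        then have "0 < Im (grid_point N j k)" using Np by (simp add: grid_point_def)
        note [measurable] = measurable_defect[OF this, of eps m]
        show "{\<omega>\<in>space Gspace. \<psi> \<le> defect eps m \<omega> (grid_point N j k)} \<in> sets Gspace" by measurable
      qed
      have badm: "bad \<in> sets Gspace" unfolding bad_def JJ_def KK_def
        by (intro sets.finite_UN sets.Un s1 s2 s3 s4) auto
      \<comment> \<open>About 40 L N^2 grid points, each contributing at most a multiple of N^(-(p +
        4)); the spare powers of N absorb the constants.\<close>
      have P_bad: "measure Gspace bad \<le> x powr (- p)"
      proof -
        have fin: "finite (JJ \<times> KK)" by (simp add: JJ_def KK_def)
        have cardJ: "real (card JJ) \<le> 2 * L * x + 1"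
        proof -
          have "0 \<le> \<lfloor>L * x\<rfloor>" using L0 xp by simp
          then have "real (card JJ) = 2 * of_int \<lfloor>L * x\<rfloor> + 1" by (simp add: JJ_def)
          then show ?thesis using of_int_floor_le[of "L * x"] by linarith
        qed
        have cardK: "real (card KK) = 20 * x + 1" by (simp add: KK_def x_def)
        have one: "measure Gspace (b1 j k \<union> b2 j k \<union> b3 j k \<union> b4 j k) \<le> (4 + C4) * F" if k: "k \<le> 20 * N" for j k
        proof -
          have m1: "measure Gspace (b1 j k) \<le> 2 * F" using B1[of k j] F0 by (cases "A \<le> k") (auto simp: b1_def)
          have hN: "x / 2 \<le> real (Nsz (Suc m))" "x / 2 \<le> real (Nsz m)" by (simp_all add: x_def N_def Nsz_def)
          have m2: "measure Gspace (b2 j k) \<le> F"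
            using B23[of "Suc m" j k, folded N_def] el(11) hN(1) k F0 by (cases "cnd j k") (auto simp: b2_def cnd_def N_def)
          have m3: "measure Gspace (b3 j k) \<le> F"
            using B23[of m j k] el(13) hN(2) k F0 by (cases "cnd j k") (auto simp: b3_def cnd_def)
          have m4: "measure Gspace (b4 j k) \<le> C4 * F" using B4[of k j] F0 C4 by (cases "A \<le> k") (auto simp: b4_def)
          have "measure Gspace (b1 j k \<union> b2 j k \<union> b3 j k \<union> b4 j k)
             \<le> measure Gspace (b1 j k) + measure Gspace (b2 j k) + measure Gspace (b3 j k) + measure Gspace (b4 j k)"
            using measure_Un_le[OF s1[of j k] s2[of j k]]
              measure_Un_le[OF sets.Un[OF s1[of j k] s2[of j k]] s3[of j k]]
              measure_Un_le[OF sets.Un[OF sets.Un[OF s1[of j k] s2[of j k]] s3[of j k]] s4[of j k]]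
            by linarith
          then show ?thesis using m1 m2 m3 m4 by (simp add: algebra_simps)
        qed
        have "measure Gspace bad \<le> (\<Sum>q\<in>JJ \<times> KK. measure Gspace (b1 (fst q) (snd q) \<union> b2 (fst q) (snd q) \<union> b3 (fst q) (snd q) \<union> b4 (fst q) (snd q)))"
          unfolding bad_def using s1 s2 s3 s4 by (intro measure_UNION_le fin) auto
        also have "\<dots> \<le> (\<Sum>q\<in>JJ \<times> KK. (4 + C4) * F)"
          by (intro sum_mono one) (auto simp: KK_def)
        also have "\<dots> = real (card JJ) * real (card KK) * ((4 + C4) * F)" by (simp add: card_cartesian_product)
        also have "\<dots> \<le> (2 * L * x + 1) * (20 * x + 1) * ((4 + C4) * F)"
          unfolding cardK using cardJ F0 C4 xp by (intro mult_right_mono) auto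
        also have "\<dots> \<le> x powr (- p)" using el(10) by (simp add: F_def)
        finally show ?thesis .
      qed
      define good where "good = {\<omega> \<in> space Gspace. \<forall>z\<in>Omega \<alpha> {c<..<d} (Suc m).
          Kl \<le> Im (Stieltjes eps (Suc m) \<omega> z) \<and> Im (Stieltjes eps (Suc m) \<omega> z) \<le> Ku \<and>
          Kl < cmod (Stieltjes eps (Suc m) \<omega> z) \<and> cmod (Stieltjes eps (Suc m) \<omega> z) < Ku * ln (real (Nsz (Suc m)))}"
      have "space Gspace - bad \<subseteq> good"
      proof
        fix \<omega> assume w: "\<omega> \<in> space Gspace - bad"
        have nb: "\<omega> \<notin> b1 j k \<and> \<omega> \<notin> b2 j k \<and> \<omega> \<notin> b3 j k \<and> \<omega> \<notin> b4 j k"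
          if j: "\<bar>real_of_int j\<bar> \<le> L * N" and k: "k \<le> 20 * N" for j k
        proof -
          have "j \<le> \<lfloor>L * x\<rfloor>" "- j \<le> \<lfloor>L * x\<rfloor>" using j by (auto simp: le_floor_iff x_def abs_le_iff)
          then have "(j, k) \<in> JJ \<times> KK" using k by (auto simp: JJ_def KK_def)
          then show ?thesis using w unfolding bad_def by fastforce
        qed
        have jL: "\<bar>real_of_int j\<bar> \<le> L * N" if "real_of_int j / N \<in> {c - \<delta> / 2<..<d + \<delta> / 2}" for j
        proof -
          have "\<bar>real_of_int j / N\<bar> \<le> L" using that \<delta> by (auto simp: L_def)
          then show ?thesis using Np by (simp add: abs_divide pos_divide_le_eq)
        qed
        have \<tau>e: "tscale eps (Suc m) = x powr (- \<tau>)" by (simp add: tscale_eq \<tau>_def x_def N_def)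
        have lnN: "ln (real (Nsz (Suc m))) = real (Suc m) * ln 2"
          unfolding Nsz_def of_nat_power of_nat_numeral by (rule ln_realpow)
        then have lnx: "ln x / ln 2 + 4 = real (m + 5)" by (simp add: x_def N_def)
        have bulk: "2 / 9 * K2 \<le> Im (ntr N (Hfun eps (Suc m) \<omega>) z) \<and> Im (ntr N (Hfun eps (Suc m) \<omega>) z) \<le> 9 / 2 * Kup"
          if z: "Re z \<in> {c<..<d}" "x powr \<alpha> < Im z * N" "Im z < 10" for z
        proof -
          have Az: "real A + 1 \<le> Im z * N" using Aup z(2) el(1) by linarith
          note pr = propagate[where eps = eps and m = m and \<omega> = \<omega> and L = L and A = A and Kup = Kup and c = c and d = d
            and \<delta> = \<delta> and ?\<eta>1.0 = \<eta>1 and ?K0.0 = K0 and \<psi> = \<psi> and z = z, folded N_def K2_def]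
          have q1: "Im (ntr N (Hfun eps (Suc m) \<omega>) (grid_point N j k)) < Kup" if "\<bar>real_of_int j\<bar> \<le> L * N" "A \<le> k" "k \<le> 20 * N" for j k
            using nb[OF that(1,3)] that(2) by (auto simp: b1_def)
          have q2: "K0 / 2 < Im (ntr N (Hfun eps (Suc m) \<omega>) (grid_point N j k))"
            if "real_of_int j / N \<in> {c - \<delta> / 2<..<d + \<delta> / 2}" "\<eta>1 / 2 \<le> real k / N" "k \<le> 20 * N" for j k
            using nb[OF jL[OF that(1)] that(3)] that(1,2) by (auto simp: b2_def cnd_def)
          have q3: "K0 / 2 < Im (ntr (Nsz m) (Hfun eps m \<omega>) (grid_point N j k))"
            if "real_of_int j / N \<in> {c - \<delta> / 2<..<d + \<delta> / 2}" "\<eta>1 / 2 \<le> real k / N" "k \<le> 20 * N" for j k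
            using nb[OF jL[OF that(1)] that(3)] that(1,2) by (auto simp: b3_def cnd_def)
          have q4: "defect eps m \<omega> (grid_point N j k) < \<psi>" if "\<bar>real_of_int j\<bar> \<le> L * N" "A \<le> k" "k \<le> 20 * N" for j k
            using nb[OF that(1,3)] that(2) by (auto simp: b4_def)
          have r: "\<bar>c\<bar> + \<delta> \<le> L" "\<bar>d\<bar> + \<delta> \<le> L" by (simp_all add: L_def)
          have r1: "16 \<le> real N * \<delta>" "8 \<le> real N * \<eta>1" using el(2,3) by (simp_all add: x_def \<eta>1_def)
          have r2: "\<eta>1 \<le> tscale eps (Suc m) * (2 / 9 * K2)" using el(5) by (simp only: \<tau>e \<eta>1_def)
          have r3: "tscale eps (Suc m) * (real (m + 5) * Kup + 1 / 10) \<le> \<delta> / 8" using el(6) unfolding \<tau>e lnx .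
          have r4: "tscale eps (Suc m) * Kup \<le> 1" using el(7) unfolding \<tau>e .
          have Kp: "0 < Kup" using Kup1 by simp
          show ?thesis
            using pr(1)[OF q1 q2 q3 q4 K0 Kp \<delta> \<eta>p r A4 r1 r2 r3 r4 \<psi>_def z(1) Az z(3)]
              pr(2)[OF q1 q2 q3 q4 K0 Kp \<delta> \<eta>p r A4 r1 r2 r3 r4 \<psi>_def z(1) Az z(3)] by blast
        qed
        show "\<omega> \<in> good" unfolding good_def
        proof (intro CollectI conjI ballI)
          show "\<omega> \<in> space Gspace" using w by blast
          fix z assume z: "z \<in> Omega \<alpha> {c<..<d} (Suc m)"
          have zi: "0 < Im z" by (rule Omega_Im_pos[OF z])
          have zr: "Re z \<in> {c<..<d}" "x powr (-1 + \<alpha>) < Im z" "Im z < 10" using z by (auto simp: Omega_eq x_def N_def)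
          have "x powr (-1 + \<alpha>) * x < Im z * x" using zr(2) xp by (rule mult_strict_right_mono)
          also have "x powr (-1 + \<alpha>) * x = x powr \<alpha>"
            using powr_add[of x "-1 + \<alpha>" 1] xp by simp
          finally have zN: "x powr \<alpha> < Im z * N" by (simp add: x_def)
          let ?s = "ntr N (Hfun eps (Suc m) \<omega>)"
          have St: "Stieltjes eps (Suc m) \<omega> z = ?s z" by (simp add: Stieltjes_eq[OF zi] N_def)
          have b: "2 / 9 * K2 \<le> Im (?s z)" "Im (?s z) \<le> 9 / 2 * Kup" using bulk[OF zr(1) zN zr(3)] by auto
          show "Kl \<le> Im (Stieltjes eps (Suc m) \<omega> z)" unfolding St using b(1) K2 by (simp add: Kl_def)
          show "Im (Stieltjes eps (Suc m) \<omega> z) \<le> Ku" unfolding St using b(2) Kup1 by (simp add: Ku_def)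
          have "Kl < Im (?s z)" using b(1) K2 by (simp add: Kl_def)
          also have "\<dots> \<le> cmod (?s z)" by (rule order_trans[OF abs_ge_self abs_Im_le_cmod])
          finally show "Kl < cmod (Stieltjes eps (Suc m) \<omega> z)" unfolding St .
          \<comment> \<open>The dyadic climb starts at z itself. All its heights below 10 remain in
            the region where Im S is already bounded by 9/2 Kup.\<close>
          have "cmod (?s (Complex (Re z) (Im z))) \<le> real (m + 5) * (9 / 2 * Kup) + 1 / 10"
          proof (rule ntr_log_bound[OF msym_Hfun Np])
            show "0 < Im z" by fact
            show "Im (?s (Complex (Re z) (2 ^ l * Im z))) \<le> 9 / 2 * Kup" if "2 ^ l * Im z < 10" for l
            proof -
              have "1 * (Im z * N) \<le> 2 ^ l * (Im z * N)" using zi by (intro mult_right_mono) auto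
              then have "x powr \<alpha> < Im (Complex (Re z) (2 ^ l * Im z)) * N" using zN by (simp add: mult.assoc)
              from bulk[OF _ this] zr(1) that show ?thesis by simp
            qed
            have "2 ^ (m + 5) * Im z = 16 * (Im z * N)" by (simp add: N_def Nsz_def power_add)
            then show "10 \<le> 2 ^ (m + 5) * Im z" using zN el(1) by linarith
          qed (use Kup1 in auto)
          also have "\<dots> < Ku * ln (real (Nsz (Suc m)))"
          proof -
            \<comment> \<open>With ln 2 \<ge> 2/3 the right side grows like 12 Kup (m + 1), against
              9/2 Kup (m + 5) + 1/10 on the left; at m = 2 this is 36 Kup against 31.5 Kup +
              0.1.\<close>
            have m2: "2 \<le> real m" using el(12) by simp
            have "ln (real (Nsz (Suc m))) = real (m + 1) * ln 2" using lnN by simp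
            moreover have "real (m + 1) * (2 / 3) \<le> real (m + 1) * ln 2"
              using ln2_ge_two_thirds by (intro mult_left_mono) auto
            ultimately have "Ku * (real (m + 1) * (2 / 3)) \<le> Ku * ln (real (Nsz (Suc m)))"
              using Kup1 by (intro mult_left_mono) (auto simp: Ku_def)
            moreover have "real (m + 5) * (9 / 2 * Kup) + 1 / 10 < Ku * (real (m + 1) * (2 / 3))"
            proof -
              have "2 * Kup \<le> real m * Kup" using m2 Kup1 by (intro mult_right_mono) auto
              moreover have "real (m + 5) * (9 / 2 * Kup) + 1 / 10 = 9 / 2 * (real m * Kup) + 45 / 2 * Kup + 1 / 10"
                by (simp add: algebra_simps)
              moreover have "Ku * (real (m + 1) * (2 / 3)) = 12 * (real m * Kup) + 12 * Kup"
                by (simp add: Ku_def algebra_simps)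
              ultimately show ?thesis using Kup1 by linarith
            qed
            ultimately show ?thesis by linarith
          qed
          finally show "cmod (Stieltjes eps (Suc m) \<omega> z) < Ku * ln (real (Nsz (Suc m)))" unfolding St by simp
        qed
      qed
      moreover have "good \<in> sets Gspace" unfolding good_def by (rule good_event_measurable)
      ultimately have "measure Gspace (space Gspace - bad) \<le> measure Gspace good"
        by (intro Gs.finite_measure_mono)
      moreover have "measure Gspace (space Gspace - bad) = 1 - measure Gspace bad"
        by (rule Gs.prob_compl[OF badm])
      ultimately have "1 - x powr (- p) \<le> measure Gspace good" using P_bad by linarith
      then show ?case by (simp add: good_def x_def N_def)
    qed
    then show ?thesis
      using eventually_sequentially_Suc by (rule iffD1[rotated])
  qed
  moreover have "0 < Kl" "0 < Ku" using K2 Kup1 by (simp_all add: Kl_def Ku_def)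
  ultimately show ?thesis by blast
qed

end
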